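(* Let $k\subseteq l$ be distinct algebraic number fields such that $k$ is neither $\mathbb{Q}$ nor an imaginary quadratic field, and $r(l)>r(k)$. Let $\beta_1,\dots,\beta_{r(k)}$ be multiplicatively independent elements of $F_k$ satisfying \[ \prod_{i=1}^{r(k)}\bigl([k:\mathbb{Q}]\,h(\beta_i)\bigr)\le r(k)!\,\mathrm{Reg}(k), \] and let $\psi_1,\dots,\psi_{r(l/k)}$ be multiplicatively independent elements of $E_{l/k}$ satisfying \[ \prod_{j=1}^{r(l/k)}\bigl([l:\mathbb{Q}]\,h(\psi_j)\bigr)\le r(l/k)!\,\mathrm{Reg}(E_{l/k}). \] Then the elements of $\{\beta_1,\dots,\beta_{r(k)}\}\cup\{\psi_1,\dots,\psi_{r(l/k)}\}$ are multiplicatively independent units in $F_l$, and \[ \prod_{i=1}^{r(k)}\bigl([k:\mathbb{Q}]\,h(\beta_i)\bigr)\prod_{j=1}^{r(l/k)}\bigl([l:\mathbb{Q}]\,h(\psi_j)\bigr)\le r(l)!\,\mathrm{Reg}(l). \]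
   Context: For a number field $K$, $r(K)$ is the rank of $O_K^{\times}$, $\mathrm{Reg}(K)$ its regulator, and $F_K=O_K^{\times}/\mathrm{Tor}(O_K^{\times})$; $F_k$ is regarded as a subgroup of $F_l$ via $\alpha\,\mathrm{Tor}(O_k^{\times})\mapsto\alpha\,\mathrm{Tor}(O_l^{\times})$. The norm induces $\mathrm{norm}_{l/k}:F_l\to F_k$, and $E_{l/k}=\{\alpha\in F_l:\mathrm{norm}_{l/k}(\alpha)=1\}$ is the group of relative units, of rank $r(l/k)=r(l)-r(k)$. Absolute values: for each place $w$ of a number field $L$, $\|\cdot\|_w$ extends the usual archimedean (if $w\mid\infty$) or $p$-adic (if $w\mid p$) absolute value of $\mathbb{Q}$, and $|\cdot|_w=\|\cdot\|_w^{[L_w:\mathbb{Q}_w]/[L:\mathbb{Q}]}$. The absolute logarithmic Weil height is $h(\alpha)=\sum_w\log^+|\alpha|_w$, independent of $L\ni\alpha$ and zero on roots of unity, hence defined on $F_L$. Relative regulator: for each archimedean place $v$ of $k$ choose a place $\widehat w_v$ of $l$ above $v$; let $S(l/k)$ be the set of archimedean places of $l$ other than the $\widehat w_v$ (so $|S(l/k)|=r(l/k)$). For a basis $\eta_1,\dots,\eta_{r(l/k)}$ of $E_{l/k}$, $\mathrm{Reg}(E_{l/k})=\bigl|\det\bigl([l_w:\mathbb{Q}_w]\log\|\eta_j\|_w\bigr)_{w\in S(l/k),\,1\le j\le r(l/k)}\bigr|$, independent of the choices. *)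

theory Defs
  imports
    "HOL-Algebra.Algebra"
    "HOL-Algebra.Algebraic_Closure_Type"
    "HOL-Analysis.Infinite_Sum"
    "Jordan_Normal_Form.Determinant"
begin

section \<open>Number fields\<close>

text \<open>
  A number field is a subfield of an arbitrary ambient field of characteristic 0, given as a set,
  whose dimension over the prime field \<open>\<rat>\<close> is finite.
\<close>

abbreviation ambient :: "'a::field_char_0 ring" where
  "ambient \<equiv> ring_of_type_algebra"

definition number_field :: "'a::field_char_0 set \<Rightarrow> bool" where
  "number_field K \<longleftrightarrow> subfield K ambient \<and> ring.finite_dimension ambient \<rat> K"

definition field_degree :: "'a::field_char_0 set \<Rightarrow> nat" where
  "field_degree K = ring.dim ambient \<rat> K"

definition imaginary_quadratic :: "'a::field_char_0 set \<Rightarrow> bool" where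
  "imaginary_quadratic K \<longleftrightarrow>
     (\<exists>d s. d < (0::rat) \<and> s\<^sup>2 = of_rat d \<and> K = {of_rat a + of_rat b * s | a b. True})"

text \<open>
  The norm of \<open>x\<close> is the determinant of multiplication by \<open>x\<close> on the \<open>k\<close>-vector space \<open>l\<close>;
  it does not depend on the chosen basis.
\<close>

definition field_norm :: "'a::field_char_0 set \<Rightarrow> 'a set \<Rightarrow> 'a \<Rightarrow> 'a" where
  "field_norm l k x = (SOME d. \<exists>bs A.
     ring.independent ambient k bs \<and> ring.Span ambient k bs = l \<and>
     A \<in> carrier_mat (length bs) (length bs) \<and>
     (\<forall>i<length bs. \<forall>j<length bs. A $$ (i, j) \<in> k) \<and>
     (\<forall>j<length bs. x * bs ! j = (\<Sum>i<length bs. A $$ (i, j) * bs ! i)) \<and>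
     d = Determinant.det A)"


section \<open>Abelian groups\<close>

definition torsion :: "('g, 'b) monoid_scheme \<Rightarrow> 'g set" where
  "torsion G = {x \<in> carrier G. \<exists>n>0. x [^]\<^bsub>G\<^esub> (n::nat) = \<one>\<^bsub>G\<^esub>}"

definition mult_independent :: "('g, 'b) monoid_scheme \<Rightarrow> 'i set \<Rightarrow> ('i \<Rightarrow> 'g) \<Rightarrow> bool" where
  "mult_independent G I x \<longleftrightarrow> finite I \<and> x \<in> I \<rightarrow> carrier G \<and>
     (\<forall>e::'i \<Rightarrow> int. finprod G (\<lambda>i. x i [^]\<^bsub>G\<^esub> e i) I = \<one>\<^bsub>G\<^esub> \<longrightarrow> (\<forall>i\<in>I. e i = 0))"

definition group_rank :: "('g, 'b) monoid_scheme \<Rightarrow> nat" where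
  "group_rank G = (GREATEST n. \<exists>x. mult_independent G {..<n} x)"

definition group_basis :: "('g, 'b) monoid_scheme \<Rightarrow> 'g list \<Rightarrow> bool" where
  "group_basis G us \<longleftrightarrow>
     mult_independent G {..<length us} (\<lambda>i. us ! i) \<and> generate G (set us) = carrier G"


section \<open>Units and relative units\<close>

definition integers_ring :: "'a::field_char_0 set \<Rightarrow> 'a ring" where
  "integers_ring K = ambient\<lparr>carrier := {x \<in> K. algebraic_int x}\<rparr>"

definition unit_group :: "'a::field_char_0 set \<Rightarrow> 'a monoid" where
  "unit_group K = units_of (integers_ring K)"

definition unit_rank :: "'a::field_char_0 set \<Rightarrow> nat" where
  "unit_rank K = group_rank (unit_group K)"

definition rel_unit_rank :: "'a::field_char_0 set \<Rightarrow> 'a set \<Rightarrow> nat" where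
  "rel_unit_rank l k = unit_rank l - unit_rank k"

definition units_mod_tor :: "'a::field_char_0 set \<Rightarrow> 'a set monoid" where
  "units_mod_tor K = unit_group K Mod torsion (unit_group K)"

text \<open>
  Elements of \<open>units_mod_tor K\<close> are cosets. The product of a coset (or of its image under
  the norm) with the torsion subgroup of the target is the coset of the image of any representative.
\<close>

definition F_embed :: "'a::field_char_0 set \<Rightarrow> 'a set \<Rightarrow> 'a set" where
  "F_embed l A = torsion (unit_group l) <#>\<^bsub>unit_group l\<^esub> A"

definition F_norm :: "'a::field_char_0 set \<Rightarrow> 'a set \<Rightarrow> 'a set \<Rightarrow> 'a set" where
  "F_norm l k A = torsion (unit_group k) <#>\<^bsub>unit_group k\<^esub> (field_norm l k ` A)"

definition rel_units :: "'a::field_char_0 set \<Rightarrow> 'a set \<Rightarrow> 'a set monoid" where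
  "rel_units l k = (units_mod_tor l)
     \<lparr>carrier := {A \<in> carrier (units_mod_tor l). F_norm l k A = \<one>\<^bsub>units_mod_tor k\<^esub>}\<rparr>"


section \<open>Places\<close>

text \<open>
  A place \<open>w\<close> of \<open>L\<close> is represented by its normalized absolute value \<open>\<parallel>\<cdot>\<parallel>\<^sub>w\<close>, the only absolute
  value in its class that restricts to the usual archimedean or \<open>p\<close>-adic absolute value on \<open>\<rat>\<close>.
  It is taken to be \<open>extensional\<close>, so that it is determined by its values on \<open>L\<close>.
\<close>

definition absolute_value :: "'a::field_char_0 set \<Rightarrow> ('a \<Rightarrow> real) \<Rightarrow> bool" where
  "absolute_value L w \<longleftrightarrow> w \<in> extensional L \<and>
     (\<forall>x\<in>L. w x \<ge> 0 \<and> (w x = 0 \<longleftrightarrow> x = 0)) \<and>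
     (\<forall>x\<in>L. \<forall>y\<in>L. w (x * y) = w x * w y \<and> w (x + y) \<le> w x + w y)"

definition padic_abs :: "nat \<Rightarrow> rat \<Rightarrow> real" where
  "padic_abs p q = (if q = 0 then 0 else
     real p powi (int (multiplicity (int p) (snd (quotient_of q)))
                - int (multiplicity (int p) (fst (quotient_of q)))))"

definition arch_places :: "'a::field_char_0 set \<Rightarrow> ('a \<Rightarrow> real) set" where
  "arch_places L = {w. absolute_value L w \<and> (\<forall>q. w (of_rat q) = \<bar>of_rat q\<bar>)}"

definition finite_places :: "'a::field_char_0 set \<Rightarrow> ('a \<Rightarrow> real) set" where
  "finite_places L =
     {w. absolute_value L w \<and>
        (\<exists>p. Factorial_Ring.prime p \<and> (\<forall>q. w (of_rat q) = padic_abs p q))}"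

text \<open>
  The completion \<open>L\<^sub>w\<close> is the ring of Cauchy sequences modulo null sequences; the completion
  \<open>\<rat>\<^sub>w\<close> sits inside it as the classes of the rational Cauchy sequences.
\<close>

definition cauchy_ring :: "'a::field_char_0 set \<Rightarrow> ('a \<Rightarrow> real) \<Rightarrow> (nat \<Rightarrow> 'a) ring" where
  "cauchy_ring L w =
     \<lparr>carrier = {s. (\<forall>n. s n \<in> L) \<and> (\<forall>e>0. \<exists>N. \<forall>m\<ge>N. \<forall>n\<ge>N. w (s m - s n) < e)},
      monoid.mult = (\<lambda>s t n. s n * t n), one = (\<lambda>n. 1),
      ring.zero = (\<lambda>n. 0), add = (\<lambda>s t n. s n + t n)\<rparr>"

definition null_ideal :: "'a::field_char_0 set \<Rightarrow> ('a \<Rightarrow> real) \<Rightarrow> (nat \<Rightarrow> 'a) set" where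
  "null_ideal L w = {s \<in> carrier (cauchy_ring L w). (\<lambda>n. w (s n)) \<longlonglongrightarrow> 0}"

definition completion :: "'a::field_char_0 set \<Rightarrow> ('a \<Rightarrow> real) \<Rightarrow> (nat \<Rightarrow> 'a) set ring" where
  "completion L w = cauchy_ring L w Quot null_ideal L w"

definition rat_completion :: "'a::field_char_0 set \<Rightarrow> ('a \<Rightarrow> real) \<Rightarrow> (nat \<Rightarrow> 'a) set set" where
  "rat_completion L w =
     (\<lambda>s. null_ideal L w +>\<^bsub>cauchy_ring L w\<^esub> s) `
       {s \<in> carrier (cauchy_ring L w). \<forall>n. s n \<in> \<rat>}"

definition local_degree :: "'a::field_char_0 set \<Rightarrow> ('a \<Rightarrow> real) \<Rightarrow> nat" where
  "local_degree L w =
     ring.dim (completion L w) (rat_completion L w) (carrier (completion L w))"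


section \<open>Heights\<close>

text \<open>
  The value does not depend on the number field \<open>L\<close> containing \<open>x\<close>; all but finitely many
  terms of the sum vanish.
\<close>

definition weil_height :: "'a::field_char_0 set \<Rightarrow> 'a \<Rightarrow> real" where
  "weil_height L x = (\<Sum>\<^sub>\<infinity>w \<in> arch_places L \<union> finite_places L.
     ln (max 1 (w x powr (real (local_degree L w) / real (field_degree L)))))"

text \<open>
  Absolute values and heights are constant on cosets of the torsion subgroup.
\<close>

definition F_height :: "'a::field_char_0 set \<Rightarrow> 'a set \<Rightarrow> real" where
  "F_height L A = the_elem (weil_height L ` A)"

definition F_abs :: "('a \<Rightarrow> real) \<Rightarrow> 'a set \<Rightarrow> real" where
  "F_abs w A = the_elem (w ` A)"


section \<open>Regulators\<close>

definition log_det :: "'a::field_char_0 set \<Rightarrow> ('a \<Rightarrow> real) list \<Rightarrow> 'a set list \<Rightarrow> real" where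
  "log_det L ws us = \<bar>Determinant.det (mat (length ws) (length us)
     (\<lambda>(i, j). real (local_degree L (ws ! i)) * ln (F_abs (ws ! i) (us ! j))))\<bar>"

text \<open>
  The list \<open>ws\<close> enumerates the rows, i.e. all archimedean places except the omitted ones. By
  Dirichlet's unit theorem the matrices are square, and their determinants do not depend, up to
  sign, on any of the choices.
\<close>

definition regulator :: "'a::field_char_0 set \<Rightarrow> real" where
  "regulator K = (SOME R. \<exists>w0 ws us.
     w0 \<in> arch_places K \<and> distinct ws \<and> set ws = arch_places K - {w0} \<and>
     group_basis (units_mod_tor K) us \<and> R = log_det K ws us)"

definition rel_regulator :: "'a::field_char_0 set \<Rightarrow> 'a set \<Rightarrow> real" where
  "rel_regulator l k = (SOME R. \<exists>c ws us.
     (\<forall>v\<in>arch_places k. c v \<in> arch_places l \<and> restrict (c v) k = v) \<and>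
     distinct ws \<and> set ws = arch_places l - c ` arch_places k \<and>
     group_basis (rel_units l k) us \<and> R = log_det l ws us)"

end

theory Submission
  imports Defs "Jordan_Normal_Form.Char_Poly"
begin

text \<open>
  Taking logarithms at the archimedean places turns the units modulo torsion of \<open>k\<close> and \<open>l\<close> into
  lattices of real functions. Summing a function over the places above each place of \<open>k\<close>
  corresponds to the norm, so its kernel on the lattice of \<open>l\<close> is the lattice of relative units.
  A basis of the latter together with lifts of a basis of the image of the norm is a basis of the
  lattice of \<open>l\<close>. In coordinates adapted to it the logarithm matrix is block triangular, whence
  \<open>Reg(l) = [F\<^sub>k : norm F\<^sub>l] Reg(k) Reg(E) \<ge> Reg(k) Reg(E)\<close>, and \<open>r(k)! r(l/k)! \<le> r(l)!\<close> gives the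
  bound. Independence follows since the norm kills relative units and raises units of \<open>k\<close> to the
  power \<open>[l : k]\<close>.

  The lower bound for the rank in Dirichlet's unit theorem plays no role: \<open>det\<close> is 0 on
  non-square matrices, so a deficient rank makes one of the two regulators on the left vanish.
\<close>

section \<open>Determinants of families\<close>

text \<open>The definitions speak of abstract absolute values, completions and determinants of
  multiplication maps, while the lattice argument needs finitely many coordinates in which the norm
  is a sum. Complex embeddings connect the two: each embedding of \<open>k\<close> has [l : k]
  extensions to \<open>l\<close>, the norm goes to the product over them, every archimedean place
  comes from an embedding by weak approximation, and the local degree counts the embeddings that
  induce the place. Regulators are chosen by \<open>SOME\<close>, so bases must be shown to exist.
  They do because the logarithm lattices are discrete: only finitely many algebraic integers of a
  number field have bounded conjugates. The choices behind the chosen values remain unknown, so the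
  covolume inequality is proved for arbitrary bases and omitted places. Two coordinate systems on
  the lattice of \<open>l\<close> express each other with integer coefficients, and a nonzero
  integer determinant has absolute value at least 1.\<close>

text \<open>Functions of two indices replace matrices, so that blocks, shifted indices and
  transposes are plain lambda terms; only entries with both indices below \<open>n\<close>
  count.\<close>

definition fdet :: "nat \<Rightarrow> (nat \<Rightarrow> nat \<Rightarrow> 'b::comm_ring_1) \<Rightarrow> 'b" where
  "fdet n f = Determinant.det (mat n n (\<lambda>(i, j). f i j))"

lemma fdet_cong:
  assumes "\<And>i j. i < n \<Longrightarrow> j < n \<Longrightarrow> f i j = g i j"
  shows "fdet n f = fdet n g"
  unfolding fdet_def by (intro arg_cong[of _ _ Determinant.det] eq_matI) (auto simp: assms)

lemma fdet_leibniz: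
  "fdet n f = (\<Sum>p | p permutes {0..<n}. signof p * (\<Prod>i = 0..<n. f i (p i)))"
  unfolding fdet_def
proof (subst det_def'[of _ n], simp, intro sum.cong refl arg_cong2[of _ _ _ _ times] prod.cong)
  fix p i assume "p \<in> {p. p permutes {0..<n}}" "i \<in> {0..<n}"
  thus "mat n n (\<lambda>(i, j). f i j) $$ (i, p i) = f i (p i)"
    using permutes_in_image[of p "{0..<n}" i] by simp
qed

lemma fdet_mult:
  "fdet n (\<lambda>i j. \<Sum>m<n. f i m * g m j) = fdet n f * fdet n g"
proof -
  let ?F = "mat n n (\<lambda>(i, j). f i j)" and ?G = "mat n n (\<lambda>(i, j). g i j)"
  have "mat n n (\<lambda>(i, j). \<Sum>m<n. f i m * g m j) = ?F * ?G"
    by (rule eq_matI) (auto simp: scalar_prod_def atLeast0LessThan)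
  thus ?thesis unfolding fdet_def by (simp add: det_mult[of _ n])
qed

lemma fdet_transpose: "fdet n (\<lambda>i j. f j i) = fdet n f"
proof -
  have "mat n n (\<lambda>(i, j). f j i) = transpose_mat (mat n n (\<lambda>(i, j). f i j))"
    by (rule eq_matI) auto
  thus ?thesis unfolding fdet_def by (simp add: det_transpose[of _ n])
qed

text \<open>The kernel vector has entries in the domain itself, so a singular integer matrix has an
  integer relation among its columns. Ranks of lattices are compared through such relations.\<close>

lemma fdet_kernel:
  fixes f :: "nat \<Rightarrow> nat \<Rightarrow> 'b::idom"
  assumes "fdet n f = 0"
  shows "\<exists>c. (\<exists>j<n. c j \<noteq> 0) \<and> (\<forall>i<n. (\<Sum>j<n. f i j * c j) = 0)"
proof -
  let ?F = "mat n n (\<lambda>(i, j). f i j)"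
  obtain v where v: "v \<in> carrier_vec n" "v \<noteq> 0\<^sub>v n" "?F *\<^sub>v v = 0\<^sub>v n"
    using assms det_0_iff_vec_prod_zero[of ?F n] unfolding fdet_def by auto
  have "\<exists>j<n. v $ j \<noteq> 0"
    using v(1,2) by (metis carrier_vecD dim_vec eq_vecI index_zero_vec(1) index_zero_vec(2))
  moreover have "(\<Sum>j<n. f i j * v $ j) = 0" if i: "i < n" for i
  proof -
    have "(?F *\<^sub>v v) $ i = 0" using v(3) i by simp
    thus ?thesis using i v(1) by (simp add: scalar_prod_def atLeast0LessThan)
  qed
  ultimately show ?thesis by (intro exI[of _ "\<lambda>j. v $ j"]) auto
qed

text \<open>Zero rows pad the system to a square one. Its determinant vanishes because every term of
  the Leibniz sum contains a factor from row \<open>n\<close>.\<close>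

lemma underdetermined_system:
  fixes f :: "nat \<Rightarrow> nat \<Rightarrow> 'b::idom"
  assumes "n < m"
  shows "\<exists>c. (\<exists>j<m. c j \<noteq> 0) \<and> (\<forall>i<n. (\<Sum>j<m. f i j * c j) = 0)"
proof -
  define g where "g = (\<lambda>i j. if i < n then f i j else 0)"
  have "(\<Prod>i = 0..<m. g i (p i)) = 0" for p :: "nat \<Rightarrow> nat"
    using assms by (intro prod_zero bexI[of _ n]) (auto simp: g_def)
  hence "fdet m g = 0" unfolding fdet_leibniz by (intro sum.neutral ballI) (simp only: mult_zero_right)
  then obtain c where c: "\<exists>j<m. c j \<noteq> 0" "\<forall>i<m. (\<Sum>j<m. g i j * c j) = 0"
    using fdet_kernel by blast
  have "(\<Sum>j<m. f i j * c j) = 0" if "i < n" for i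
    using c(2)[rule_format, of i] that assms by (simp add: g_def)
  with c(1) show ?thesis by blast
qed

lemma fdet_inverse:
  fixes f :: "nat \<Rightarrow> nat \<Rightarrow> 'b::field"
  assumes "fdet n f \<noteq> 0"
  shows "\<exists>g. \<forall>i<n. \<forall>j<n. (\<Sum>m<n. f i m * g m j) = (if i = j then 1 else 0)
                        \<and> (\<Sum>m<n. g i m * f m j) = (if i = j then 1 else 0)"
proof -
  let ?F = "mat n n (\<lambda>(i, j). f i j)"
  have "?F \<in> Units (ring_mat TYPE('b) n ())"
    using assms unfolding fdet_def by (intro det_non_zero_imp_unit) auto
  then obtain G where G: "G \<in> carrier_mat n n" "?F * G = 1\<^sub>m n" "G * ?F = 1\<^sub>m n"
    unfolding Units_def ring_mat_def by auto
  have "(\<Sum>m<n. f i m * G $$ (m, j)) = (if i = j then 1 else 0)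
      \<and> (\<Sum>m<n. G $$ (i, m) * f m j) = (if i = j then 1 else 0)" if ij: "i < n" "j < n" for i j
  proof -
    have "(?F * G) $$ (i, j) = (\<Sum>m<n. f i m * G $$ (m, j))"
      using ij G(1) by (simp add: scalar_prod_def atLeast0LessThan)
    moreover have "(G * ?F) $$ (i, j) = (\<Sum>m<n. G $$ (i, m) * f m j)"
      using ij G(1) by (simp add: scalar_prod_def atLeast0LessThan)
    ultimately show ?thesis using ij by (simp add: G)
  qed
  thus ?thesis by (intro exI[of _ "\<lambda>i j. G $$ (i, j)"]) blast
qed

lemma signof_Ints: "(signof p :: 'b::comm_ring_1) \<in> \<int>"
  by (cases p rule: sign_cases) auto

lemma fdet_Ints:
  fixes f :: "nat \<Rightarrow> nat \<Rightarrow> 'b::comm_ring_1"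
  assumes "\<And>i j. i < n \<Longrightarrow> j < n \<Longrightarrow> f i j \<in> \<int>"
  shows "fdet n f \<in> \<int>"
proof -
  have "f i (p i) \<in> \<int>" if "p permutes {0..<n}" "i \<in> {0..<n}" for p i
    using permutes_in_image[OF that(1), of i] that(2) assms by simp
  thus ?thesis unfolding fdet_leibniz
    by (auto intro!: Ints_sum Ints_mult Ints_prod signof_Ints)
qed

lemma fdet_block:
  fixes f :: "nat \<Rightarrow> nat \<Rightarrow> 'b::idom"
  assumes "\<And>i j. i < n \<Longrightarrow> j < m \<Longrightarrow> f (m + i) j = 0"
  shows "fdet (m + n) f = fdet m f * fdet n (\<lambda>i j. f (m + i) (m + j))"
proof -
  let ?A = "mat m m (\<lambda>(i, j). f i j)" and ?B = "mat m n (\<lambda>(i, j). f i (m + j))"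
    and ?D = "mat n n (\<lambda>(i, j). f (m + i) (m + j))"
  have "mat (m + n) (m + n) (\<lambda>(i, j). f i j) = four_block_mat ?A ?B (0\<^sub>m n m) ?D"
  proof (rule eq_matI)
    fix i j assume "i < dim_row (four_block_mat ?A ?B (0\<^sub>m n m) ?D)"
      "j < dim_col (four_block_mat ?A ?B (0\<^sub>m n m) ?D)"
    hence ij: "i < m + n" "j < m + n" by auto
    show "mat (m + n) (m + n) (\<lambda>(i, j). f i j) $$ (i, j)
        = four_block_mat ?A ?B (0\<^sub>m n m) ?D $$ (i, j)"
      using ij assms[of "i - m" j] by auto
  qed auto
  thus ?thesis unfolding fdet_def
    by (simp add: det_four_block_mat_lower_left_zero[of _ m _ n])
qed

section \<open>Lattices of real-valued functions\<close>

text \<open>Functions on a whole type stand for vectors, so that no enumeration of the places is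
  fixed before a determinant is formed.\<close>

definition add_subgroup :: "('w \<Rightarrow> real) set \<Rightarrow> bool" where
  "add_subgroup A \<longleftrightarrow> (\<lambda>_. 0) \<in> A \<and> (\<forall>f\<in>A. \<forall>g\<in>A. (\<lambda>w. f w - g w) \<in> A)"

definition int_independent :: "nat \<Rightarrow> (nat \<Rightarrow> 'w \<Rightarrow> real) \<Rightarrow> bool" where
  "int_independent n f \<longleftrightarrow>
     (\<forall>e::nat \<Rightarrow> int. (\<forall>w. (\<Sum>i<n. of_int (e i) * f i w) = 0) \<longrightarrow> (\<forall>i<n. e i = 0))"

definition lat_basis :: "('w \<Rightarrow> real) set \<Rightarrow> nat \<Rightarrow> (nat \<Rightarrow> 'w \<Rightarrow> real) \<Rightarrow> bool" where
  "lat_basis A n f \<longleftrightarrow> (\<forall>i<n. f i \<in> A) \<and> int_independent n f \<and>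
     (\<forall>g\<in>A. \<exists>e::nat \<Rightarrow> int. \<forall>w. g w = (\<Sum>i<n. of_int (e i) * f i w))"

lemma int_independentD:
  assumes "int_independent n f" and "\<And>w. (\<Sum>i<n. of_int (e i) * f i w) = 0" and "i < n"
  shows "e i = (0::int)"
  using assms unfolding int_independent_def by simp

context
  fixes A :: "('w \<Rightarrow> real) set"
  assumes A: "add_subgroup A"
begin

lemma add_subgroup_zero: "(\<lambda>_. 0) \<in> A"
  using A by (simp add: add_subgroup_def)

lemma add_subgroup_diff: "f \<in> A \<Longrightarrow> g \<in> A \<Longrightarrow> (\<lambda>w. f w - g w) \<in> A"
  using A by (simp add: add_subgroup_def)

lemma add_subgroup_uminus: "f \<in> A \<Longrightarrow> (\<lambda>w. - f w) \<in> A"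
  using add_subgroup_diff[OF add_subgroup_zero, of f] by simp

lemma add_subgroup_add: "f \<in> A \<Longrightarrow> g \<in> A \<Longrightarrow> (\<lambda>w. f w + g w) \<in> A"
  using add_subgroup_diff[OF _ add_subgroup_uminus, of f g] by simp

lemma add_subgroup_scale: 
  assumes "f \<in> A" shows "(\<lambda>w. of_int e * f w) \<in> A"
proof (induction e rule: int_induct[of _ 0])
  case base show ?case using add_subgroup_zero by simp
next
  case (step1 i) thus ?case using add_subgroup_add[OF step1(2) assms] by (simp add: algebra_simps)
next
  case (step2 i) thus ?case using add_subgroup_diff[OF step2(2) assms] by (simp add: algebra_simps)
qed

lemma add_subgroup_comb:
  assumes "\<And>i. i < (n::nat) \<Longrightarrow> f i \<in> A" shows "(\<lambda>w. \<Sum>i<n. of_int (e i) * f i w) \<in> A"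
  using assms
proof (induction n)
  case 0 show ?case using add_subgroup_zero by simp
next
  case (Suc n)
  show ?case using add_subgroup_add[OF Suc.IH add_subgroup_scale[OF Suc.prems[of n], of "e n"]] Suc.prems
    by simp
qed

end

text \<open>If there are more than \<open>m\<close> coefficient columns of the
  \<open>d * x j\<close> in terms of \<open>y\<close>, they satisfy an integer relation, and it
  carries over to \<open>x\<close>. The factor \<open>d\<close> allows for a family \<open>y\<close>
  that generates only a subgroup of finite index.\<close>

lemma int_independent_length_le:
  fixes x :: "nat \<Rightarrow> 'w \<Rightarrow> real" and y :: "nat \<Rightarrow> 'w \<Rightarrow> real" and d :: int
  assumes x: "int_independent n x" and d: "d \<noteq> 0"
    and xy: "\<And>j. j < n \<Longrightarrow> \<exists>e::nat \<Rightarrow> int. \<forall>w. of_int d * x j w = (\<Sum>i<m. of_int (e i) * y i w)"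
  shows "n \<le> m"
proof (rule ccontr)
  assume "\<not> n \<le> m"
  obtain Q :: "nat \<Rightarrow> nat \<Rightarrow> int" where
    Q: "\<And>j w. j < n \<Longrightarrow> of_int d * x j w = (\<Sum>i<m. of_int (Q i j) * y i w)"
  proof -
    obtain q :: "nat \<Rightarrow> nat \<Rightarrow> int" where 
      "\<forall>j<n. \<forall>w. of_int d * x j w = (\<Sum>i<m. of_int (q j i) * y i w)" using xy by metis
    thus ?thesis by (intro that[of "\<lambda>i j. q j i"]) auto
  qed
  obtain c where c: "\<exists>j<n. c j \<noteq> 0" "\<forall>i<m. (\<Sum>j<n. Q i j * c j) = 0"
    using underdetermined_system[of m n Q] \<open>\<not> n \<le> m\<close> by auto
  have "(\<Sum>j<n. of_int (d * c j) * x j w) = 0" for w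
  proof -
    have "(\<Sum>j<n. of_int (d * c j) * x j w) = (\<Sum>j<n. of_int (c j) * (of_int d * x j w))"
      by (intro sum.cong) auto
    also have "\<dots> = (\<Sum>j<n. \<Sum>i<m. of_int (Q i j * c j) * y i w)"
      by (intro sum.cong) (auto simp: Q sum_distrib_left intro!: sum.cong)
    also have "\<dots> = (\<Sum>i<m. of_int (\<Sum>j<n. Q i j * c j) * y i w)"
      by (subst sum.swap) (simp add: sum_distrib_right)
    also have "\<dots> = 0" using c(2) by simp
    finally show ?thesis .
  qed
  hence "d * c j = 0" if "j < n" for j
    using int_independentD[OF x, of "\<lambda>j. d * c j"] that by simp
  with c(1) d show False by auto
qed

section \<open>Bases of discrete subgroups\<close>

text \<open>The generator is the least positive element, which exists because \<open>1\<close> lies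
  in \<open>V\<close> and (0, 1] meets \<open>V\<close> in a finite set. Division by it leaves a
  remainder in [0, g) that lies in \<open>V\<close>, hence is 0.\<close>

lemma real_subgroup_cyclic:
  fixes V :: "real set"
  assumes "1 \<in> V" and diff: "\<And>s t. s \<in> V \<Longrightarrow> t \<in> V \<Longrightarrow> s - t \<in> V" and fin: "finite (V \<inter> {0<..1})"
  shows "\<exists>g\<in>V. 0 < g \<and> (\<forall>t\<in>V. \<exists>m::int. t = of_int m * g)"
proof -
  define g where "g = Min (V \<inter> {0<..1})"
  have g: "g \<in> V \<inter> {0<..1}" unfolding g_def by (rule Min_in) (use assms in auto)
  have zero: "0 \<in> V" using diff[OF assms(1) assms(1)] by simp
  have add: "s + t \<in> V" if "s \<in> V" "t \<in> V" for s t
    using diff[OF that(1) diff[OF zero that(2)]] by simp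
  have mult: "of_int m * g \<in> V" for m
  proof (induction m rule: int_induct[of _ 0])
    case base show ?case using zero by simp
  next
    case (step1 i) thus ?case using add[OF step1(2), of g] g by (simp add: algebra_simps)
  next
    case (step2 i) thus ?case using diff[OF step2(2), of g] g by (simp add: algebra_simps)
  qed
  have "t = of_int \<lfloor>t / g\<rfloor> * g" if t: "t \<in> V" for t
  proof -
    define r where "r = t - of_int \<lfloor>t / g\<rfloor> * g"
    have r: "r \<in> V" unfolding r_def by (rule diff[OF t mult])
    have "0 \<le> r" "r < g"
      using g floor_divide_lower[of g t] floor_divide_upper[of g t] 
      by (auto simp: r_def algebra_simps)
    moreover have "\<not> 0 < r"
    proof
      assume "0 < r"
      hence "r \<in> V \<inter> {0<..1}" using r \<open>r < g\<close> g by auto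
      hence "g \<le> r" unfolding g_def by (intro Min_le fin)
      thus False using \<open>r < g\<close> by simp
    qed
    ultimately show ?thesis by (simp add: r_def)
  qed
  thus ?thesis using g by (intro bexI[of _ g]) auto
qed

text \<open>Real coordinates with respect to such a family are unique, which independence over the
  integers alone does not give.\<close>

definition real_independent :: "nat \<Rightarrow> (nat \<Rightarrow> 'w \<Rightarrow> real) \<Rightarrow> bool" where
  "real_independent n x \<longleftrightarrow>
     (\<forall>c. (\<forall>w. (\<Sum>i<n. c i * x i w) = 0) \<longrightarrow> (\<forall>i<n. c i = 0))"

lemma real_independentD:
  assumes "real_independent n x" and "\<And>w. (\<Sum>i<n. c i * x i w) = 0" and "i < n"
  shows "c i = 0"
  using assms unfolding real_independent_def by simp

lemma real_independent_eq:
  assumes "real_independent n x" and "\<And>w. (\<Sum>i<n. c i * x i w) = (\<Sum>i<n. d i * x i w)" and "i < n"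
  shows "c i = d i"
proof -
  have "(\<Sum>i<n. (c i - d i) * x i w) = 0" for w
    using assms(2)[of w] by (simp add: algebra_simps sum_subtractf)
  thus ?thesis using real_independentD[OF assms(1), of "\<lambda>i. c i - d i"] assms(3) by simp
qed

text \<open>Induction on the dimension of the span. The possible last coordinates of elements of
  \<open>A\<close> form a subgroup \<open>V\<close> of the reals. Discreteness makes it cyclic, and
  an element whose last coordinate generates \<open>V\<close> extends a basis of the sublattice with
  last coordinate 0.\<close>

lemma discrete_lattice_span_basis:
  fixes A :: "('w \<Rightarrow> real) set"
  assumes A: "add_subgroup A" and "finite W"
    and discrete: "\<And>B. finite {f \<in> A. \<forall>w\<in>W. \<bar>f w\<bar> \<le> B}"
    and "real_independent s x" and "\<And>i. i < s \<Longrightarrow> x i \<in> A"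
  shows "\<exists>n b. lat_basis {f \<in> A. \<exists>c. \<forall>w. f w = (\<Sum>i<s. c i * x i w)} n b"
  using assms(4,5)
proof (induction s)
  case 0
  have "lat_basis {f \<in> A. \<exists>c. \<forall>w. f w = (\<Sum>i<0. c i * x i w)} 0 (\<lambda>_ _. 0)"
    by (auto simp: lat_basis_def int_independent_def)
  thus ?case by blast
next
  case (Suc s)
  let ?S = "\<lambda>s. {f \<in> A. \<exists>c. \<forall>w. f w = (\<Sum>i<s. c i * x i w)}"
  have xs: "real_independent s x"
    unfolding real_independent_def
  proof safe
    fix c i assume c: "\<forall>w. (\<Sum>i<s. c i * x i w) = 0" and i: "i < s"
    let ?c = "\<lambda>i. if i < s then c i else 0"
    have "(\<Sum>i<Suc s. ?c i * x i w) = 0" for w using c by simp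
    hence "?c i = 0" using real_independentD[OF Suc.prems(1), of ?c i] i by simp
    thus "c i = 0" using i by simp
  qed
  obtain n b where b: "lat_basis (?S s) n b" using Suc.IH[OF xs] Suc.prems(2) by auto
  define V where "V = {t. \<exists>f\<in>A. \<exists>c. \<forall>w. f w = (\<Sum>i<s. c i * x i w) + t * x s w}"
  have "1 \<in> V" unfolding V_def using Suc.prems(2)[of s]
    by (auto intro!: bexI[of _ "x s"] exI[of _ "\<lambda>_. 0"])
  moreover have "t - u \<in> V" if tu: "t \<in> V" "u \<in> V" for t u
  proof -
    obtain f c g d where "f \<in> A" "\<forall>w. f w = (\<Sum>i<s. c i * x i w) + t * x s w"
      "g \<in> A" "\<forall>w. g w = (\<Sum>i<s. d i * x i w) + u * x s w" using tu unfolding V_def by blast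
    thus ?thesis unfolding V_def using add_subgroup_diff[OF A, of f g]
      by (auto intro!: bexI[of _ "\<lambda>w. f w - g w"] exI[of _ "\<lambda>i. c i - d i"]
               simp: algebra_simps sum_subtractf)
  qed
  \<comment> \<open>Replacing the first \<open>s\<close> coefficients by their fractional parts
    changes the element by a member of \<open>A\<close> and keeps the last coefficient
    \<open>t\<close>. The new element is bounded by \<open>B\<close> on \<open>W\<close>, so only
    finitely many arise, and \<open>\<kappa>\<close> recovers \<open>t\<close> from it.\<close>
  moreover have "finite (V \<inter> {0<..1})"
  proof -
    define B where "B = (\<Sum>w\<in>W. \<Sum>i<Suc s. \<bar>x i w\<bar>)"
    define F where "F = {f \<in> A. \<forall>w\<in>W. \<bar>f w\<bar> \<le> B}"
    define \<kappa> where "\<kappa> = (\<lambda>f. THE t. \<exists>c. \<forall>w. f w = (\<Sum>i<s. c i * x i w) + t * x s w)"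
    have \<kappa>: "\<kappa> f = t" if f: "\<And>w. f w = (\<Sum>i<s. c i * x i w) + t * x s w" for f t c
      unfolding \<kappa>_def
    proof (rule the_equality)
      show "\<exists>c. \<forall>w. f w = (\<Sum>i<s. c i * x i w) + t * x s w" using f by blast
      fix u assume "\<exists>c. \<forall>w. f w = (\<Sum>i<s. c i * x i w) + u * x s w"
      then obtain d where d: "\<And>w. f w = (\<Sum>i<s. d i * x i w) + u * x s w" by blast
      let ?c = "\<lambda>i. if i < s then c i else t" and ?d = "\<lambda>i. if i < s then d i else u"
      have "(\<Sum>i<Suc s. ?d i * x i w) = (\<Sum>i<Suc s. ?c i * x i w)" for w
        using f[of w] d[of w] by simp
      from real_independent_eq[OF Suc.prems(1) this, of s] show "u = t" by simp
    qed
    have "V \<inter> {0<..1} \<subseteq> \<kappa> ` F"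
    proof
      fix t assume "t \<in> V \<inter> {0<..1}"
      then obtain f c where t: "0 < t" "t \<le> 1" and f: "f \<in> A" 
        and fc: "\<And>w. f w = (\<Sum>i<s. c i * x i w) + t * x s w"
        unfolding V_def by auto
      define h where "h = (\<lambda>w. f w - (\<Sum>i<s. of_int \<lfloor>c i\<rfloor> * x i w))"
      have hA: "h \<in> A" unfolding h_def
        by (intro add_subgroup_diff[OF A] f add_subgroup_comb[OF A]) (use Suc.prems(2) in auto)
      have h: "h w = (\<Sum>i<s. frac (c i) * x i w) + t * x s w" for w
        unfolding h_def fc frac_def by (simp add: algebra_simps sum_subtractf)
      have "\<bar>h w\<bar> \<le> B" if w: "w \<in> W" for w
      proof -
        have "\<bar>h w\<bar> \<le> \<bar>\<Sum>i<s. frac (c i) * x i w\<bar> + \<bar>t * x s w\<bar>" unfolding h by (rule abs_triangle_ineq)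
        also have "\<dots> \<le> (\<Sum>i<s. \<bar>x i w\<bar>) + \<bar>x s w\<bar>"
        proof (intro add_mono order.trans[OF sum_abs] sum_mono)
          fix i show "\<bar>frac (c i) * x i w\<bar> \<le> \<bar>x i w\<bar>"
            using frac_lt_1[of "c i"] by (simp add: abs_mult mult_left_le_one_le)
          show "\<bar>t * x s w\<bar> \<le> \<bar>x s w\<bar>" using t by (simp add: abs_mult mult_left_le_one_le)
        qed
        also have "\<dots> = (\<Sum>i<Suc s. \<bar>x i w\<bar>)" by simp
        also have "\<dots> \<le> B" unfolding B_def
          by (intro member_le_sum w \<open>finite W\<close> sum_nonneg) auto
        finally show ?thesis .
      qed
      hence "h \<in> F" using hA by (simp add: F_def)
      moreover have "\<kappa> h = t" by (rule \<kappa>[OF h])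
      ultimately show "t \<in> \<kappa> ` F" by blast
    qed
    moreover have "finite F" unfolding F_def by (rule discrete)
    ultimately show ?thesis by (meson finite_imageI finite_subset)
  qed
  ultimately obtain g where g: "g \<in> V" "0 < g" "\<And>t. t \<in> V \<Longrightarrow> \<exists>m::int. t = of_int m * g"
    using real_subgroup_cyclic[of V] by blast
  then obtain f0 c0 where f0: "f0 \<in> A" and f0c: "\<And>w. f0 w = (\<Sum>i<s. c0 i * x i w) + g * x s w"
    unfolding V_def by blast
  define b' where "b' = (\<lambda>i. if i < n then b i else f0)"
  have "lat_basis (?S (Suc s)) (Suc n) b'"
    unfolding lat_basis_def
  proof (intro conjI allI impI ballI)
    fix i assume "i < Suc n"
    show "b' i \<in> ?S (Suc s)"
    proof (cases "i < n")
      case True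
      then obtain c where "b i \<in> A" "\<forall>w. b i w = (\<Sum>i<s. c i * x i w)"
        using b unfolding lat_basis_def by blast
      thus ?thesis using True 
        by (auto simp: b'_def intro!: exI[of _ "\<lambda>i. if i < s then c i else 0"])
    next
      case False
      thus ?thesis using f0 f0c
        by (auto simp: b'_def intro!: exI[of _ "\<lambda>i. if i < s then c0 i else g"])
    qed
  next
    have "\<exists>c. \<forall>i<n. \<forall>w. b i w = (\<Sum>j<s. c i j * x j w)"
      using b unfolding lat_basis_def by (intro choice) blast
    then obtain c where c: "\<And>i w. i < n \<Longrightarrow> b i w = (\<Sum>j<s. c i j * x j w)" by blast
    show "int_independent (Suc n) b'"
      unfolding int_independent_def
    proof (intro allI impI)
      fix e :: "nat \<Rightarrow> int" and i
      assume e: "\<forall>w. (\<Sum>i<Suc n. of_int (e i) * b' i w) = 0" and i: "i < Suc n"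
      have e': "(\<Sum>i<n. of_int (e i) * b i w) + of_int (e n) * f0 w = 0" for w
        using e[rule_format, of w] by (simp add: b'_def)
      \<comment> \<open>The same relation in the coordinates of \<open>x\<close>. Among the new
        basis only \<open>f0\<close> has a nonzero last coordinate, so that coordinate is
        \<open>e n * g\<close> and forces \<open>e n = 0\<close>.\<close>
      let ?c = "\<lambda>j. if j < s then (\<Sum>i<n. of_int (e i) * c i j) + of_int (e n) * c0 j else of_int (e n) * g"
      have "(\<Sum>j<Suc s. ?c j * x j w) = 0" for w
      proof -
        have "(\<Sum>j<Suc s. ?c j * x j w) 
            = (\<Sum>j<s. (\<Sum>i<n. of_int (e i) * c i j) * x j w) + of_int (e n) * f0 w"
        proof -
          have "(\<Sum>j<Suc s. ?c j * x j w) = (\<Sum>j<s. (\<Sum>i<n. of_int (e i) * c i j) * x j w + of_int (e n) * (c0 j * x j w))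
              + of_int (e n) * (g * x s w)" by (simp add: distrib_right mult.assoc)
          thus ?thesis unfolding f0c by (simp only: sum.distrib sum_distrib_left distrib_left add.assoc)
        qed
        also have "(\<Sum>j<s. (\<Sum>i<n. of_int (e i) * c i j) * x j w) = (\<Sum>i<n. of_int (e i) * b i w)"
        proof -
          have "(\<Sum>i<n. of_int (e i) * b i w) = (\<Sum>i<n. \<Sum>j<s. of_int (e i) * c i j * x j w)"
            by (intro sum.cong refl) (simp add: c sum_distrib_left mult.assoc)
          also have "\<dots> = (\<Sum>j<s. \<Sum>i<n. of_int (e i) * c i j * x j w)" by (rule sum.swap)
          finally show ?thesis by (simp add: sum_distrib_right)
        qed
        finally show ?thesis using e' by simp
      qed
      hence "?c s = 0" using real_independentD[OF Suc.prems(1), of ?c s] by blast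
      hence en: "e n = 0" using g(2) by simp
      hence "(\<Sum>i<n. of_int (e i) * b i w) = 0" for w using e'[of w] by simp
      moreover have "int_independent n b" using b by (simp add: lat_basis_def)
      ultimately have "\<forall>i<n. e i = 0" using int_independentD[of n b e] by blast
      thus "e i = 0" using en i less_Suc_eq by auto
    qed
  next
    fix f assume "f \<in> ?S (Suc s)"
    then obtain c where f: "f \<in> A" and c: "\<And>w. f w = (\<Sum>i<s. c i * x i w) + c s * x s w" by auto
    hence "c s \<in> V" unfolding V_def by blast
    then obtain m :: int where m: "c s = of_int m * g" using g(3) by blast
    \<comment> \<open>Cancels the last coordinate, so that \<open>h\<close> falls into the
      sublattice covered by the induction hypothesis.\<close>
    define h where "h = (\<lambda>w. f w - of_int m * f0 w)"
    have "h \<in> A" unfolding h_def by (intro add_subgroup_diff[OF A] f add_subgroup_scale[OF A] f0)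
    moreover have "h w = (\<Sum>i<s. (c i - of_int m * c0 i) * x i w)" for w
      unfolding h_def c f0c m by (simp add: algebra_simps sum_subtractf sum_distrib_left)
    ultimately have "h \<in> ?S s" by (intro CollectI conjI exI[of _ "\<lambda>i. c i - of_int m * c0 i"]) auto
    then obtain e :: "nat \<Rightarrow> int" where e: "\<And>w. h w = (\<Sum>i<n. of_int (e i) * b i w)"
      using b unfolding lat_basis_def by blast
    have "f w = (\<Sum>i<Suc n. of_int ((e(n := m)) i) * b' i w)" for w
    proof -
      have "f w = h w + of_int m * f0 w" by (simp add: h_def)
      thus ?thesis unfolding e by (simp add: b'_def)
    qed
    thus "\<exists>e::nat \<Rightarrow> int. \<forall>w. f w = (\<Sum>i<Suc n. of_int (e i) * b' i w)" by blast
  qed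
  thus ?case by blast
qed

text \<open>A maximal family in \<open>A\<close> that is independent over the reals spans all of
  \<open>A\<close> over the reals, though in general not over the integers;
  \<open>discrete_lattice_span_basis\<close> then supplies an integral basis. The size of such
  families is bounded by \<open>card W\<close>, since a relation among functions supported on
  \<open>W\<close> is a system of \<open>card W\<close> equations.\<close>

theorem discrete_lattice_has_basis:
  fixes A :: "('w \<Rightarrow> real) set"
  assumes A: "add_subgroup A" and W: "finite W"
    and supp: "\<And>f w. f \<in> A \<Longrightarrow> w \<notin> W \<Longrightarrow> f w = 0"
    and discrete: "\<And>B. finite {f \<in> A. \<forall>w\<in>W. \<bar>f w\<bar> \<le> B}"
  shows "\<exists>n b. lat_basis A n b"
proof -
  let ?P = "\<lambda>s. \<exists>x. real_independent s x \<and> (\<forall>i<s. x i \<in> A)"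
  have bound: "s \<le> card W" if s: "?P s" for s
  proof (rule ccontr)
    assume "\<not> s \<le> card W"
    obtain x where x: "real_independent s x" "\<forall>i<s. x i \<in> A" using s by blast
    obtain ws where ws: "bij_betw ws {0..<card W} W" using ex_bij_betw_nat_finite[OF W] by blast
    obtain c where c: "\<exists>j<s. c j \<noteq> 0" "\<forall>i<card W. (\<Sum>j<s. x j (ws i) * c j) = 0"
      using underdetermined_system[of "card W" s "\<lambda>i j. x j (ws i)"] \<open>\<not> s \<le> card W\<close> by auto
    have "(\<Sum>j<s. c j * x j w) = 0" for w
    proof (cases "w \<in> W")
      case True
      then obtain i where "i < card W" "w = ws i" using bij_betw_imp_surj_on[OF ws] by fastforce
      thus ?thesis using c(2) by (simp add: mult.commute)
    next
      case False
      hence "x j w = 0" if "j < s" for j using supp x(2) that by blast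
      thus ?thesis by simp
    qed
    thus False using c(1) real_independentD[OF x(1), of c] by blast
  qed
  have "?P 0" by (simp add: real_independent_def)
  define s where "s = (GREATEST s. ?P s)"
  have s: "?P s" unfolding s_def by (rule GreatestI_nat[of _ 0 "card W"]) (use \<open>?P 0\<close> bound in auto)
  then obtain x where x: "real_independent s x" "\<And>i. i < s \<Longrightarrow> x i \<in> A" by blast
  have "\<exists>c. \<forall>w. f w = (\<Sum>i<s. c i * x i w)" if f: "f \<in> A" for f
  proof -
    let ?x = "x(s := f)"
    \<comment> \<open>By maximality of \<open>s\<close>, adjoining \<open>f\<close> creates a real
      relation. The coefficient of \<open>f\<close> in it is nonzero because \<open>x\<close> is
      independent, so the relation can be solved for \<open>f\<close>.\<close>
    have "\<not> ?P (Suc s)" using Greatest_le_nat[of ?P "Suc s" "card W"] bound s_def by force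
    moreover have "\<forall>i<Suc s. ?x i \<in> A" using x(2) f less_Suc_eq by auto
    ultimately have "\<not> real_independent (Suc s) ?x" by blast
    then obtain c i where c: "\<And>w. (\<Sum>i<s. c i * x i w) + c s * f w = 0" and i: "i < Suc s" "c i \<noteq> 0"
      unfolding real_independent_def by auto
    have "c s \<noteq> 0"
    proof
      assume "c s = 0"
      hence "(\<Sum>i<s. c i * x i w) = 0" for w using c[of w] by simp
      hence "\<forall>i<s. c i = 0" using real_independentD[OF x(1), of c] by blast
      thus False using i \<open>c s = 0\<close> less_Suc_eq by auto
    qed
    have "f w = (\<Sum>i<s. (- c i / c s) * x i w)" for w
    proof -
      have "(\<Sum>i<s. (- c i / c s) * x i w) = - (\<Sum>i<s. c i * x i w) / c s"
        by (simp add: sum_divide_distrib sum_negf)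
      also have "\<dots> = f w" using c[of w] \<open>c s \<noteq> 0\<close> by (simp add: field_simps)
      finally show ?thesis by simp
    qed
    thus ?thesis by (intro exI[of _ "\<lambda>i. - c i / c s"]) simp
  qed
  hence "{f \<in> A. \<exists>c. \<forall>w. f w = (\<Sum>i<s. c i * x i w)} = A" by blast
  moreover have "\<exists>n b. lat_basis {f \<in> A. \<exists>c. \<forall>w. f w = (\<Sum>i<s. c i * x i w)} n b"
    by (rule discrete_lattice_span_basis[OF A W]) (fact discrete x)+
  ultimately show ?thesis by simp
qed


section \<open>Integral changes of coordinates on a lattice\<close>

text \<open>The rows of a logarithm matrix are functionals on the lattice. The identity is required
  on \<open>A\<close> only, because relations such as the vanishing of the sum over all places hold
  only there.\<close>

definition int_functional ::
  "('w \<Rightarrow> real) set \<Rightarrow> nat \<Rightarrow> (nat \<Rightarrow> ('w \<Rightarrow> real) \<Rightarrow> real) \<Rightarrow> (('w \<Rightarrow> real) \<Rightarrow> real) \<Rightarrow> bool" where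
  "int_functional A n \<rho> \<phi> \<longleftrightarrow> (\<exists>R::nat \<Rightarrow> int. \<forall>f\<in>A. \<phi> f = (\<Sum>m<n. of_int (R m) * \<rho> m f))"

lemma int_functional_base:
  assumes "m < n" shows "int_functional A n \<rho> (\<rho> m)"
  unfolding int_functional_def
proof (intro exI[of _ "\<lambda>i. if i = m then 1 else 0"] ballI)
  fix f
  have "(\<Sum>i<n. of_int (if i = m then 1 else 0) * \<rho> i f) = (\<Sum>i<n. if i = m then \<rho> i f else 0)"
    by (intro sum.cong) auto
  thus "\<rho> m f = (\<Sum>i<n. of_int (if i = m then 1 else 0) * \<rho> i f)" using assms by simp
qed

lemma int_functional_cong:
  assumes "int_functional A n \<rho> \<phi>" and "\<And>f. f \<in> A \<Longrightarrow> \<phi> f = \<chi> f"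
  shows "int_functional A n \<rho> \<chi>"
  using assms unfolding int_functional_def by simp

lemma int_functional_add:
  assumes "int_functional A n \<rho> \<phi>" and "int_functional A n \<rho> \<chi>"
  shows "int_functional A n \<rho> (\<lambda>f. \<phi> f + \<chi> f)"
proof -
  obtain R S :: "nat \<Rightarrow> int" where
    "\<forall>f\<in>A. \<phi> f = (\<Sum>m<n. of_int (R m) * \<rho> m f)" "\<forall>f\<in>A. \<chi> f = (\<Sum>m<n. of_int (S m) * \<rho> m f)"
    using assms unfolding int_functional_def by blast
  thus ?thesis unfolding int_functional_def
    by (intro exI[of _ "\<lambda>m. R m + S m"]) (simp add: distrib_right sum.distrib)
qed

lemma int_functional_uminus:
  assumes "int_functional A n \<rho> \<phi>"
  shows "int_functional A n \<rho> (\<lambda>f. - \<phi> f)"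
proof -
  obtain R :: "nat \<Rightarrow> int" where "\<forall>f\<in>A. \<phi> f = (\<Sum>m<n. of_int (R m) * \<rho> m f)"
    using assms unfolding int_functional_def by blast
  thus ?thesis unfolding int_functional_def
    by (intro exI[of _ "\<lambda>m. - R m"]) (simp add: sum_negf)
qed

lemma int_functional_sum:
  assumes "finite I" and "\<And>i. i \<in> I \<Longrightarrow> int_functional A n \<rho> (\<phi> i)"
  shows "int_functional A n \<rho> (\<lambda>f. \<Sum>i\<in>I. \<phi> i f)"
  using assms
proof (induction I rule: finite_induct)
  case empty
  show ?case unfolding int_functional_def by (rule exI[of _ "\<lambda>_. 0"]) simp
next
  case (insert i I)
  thus ?case using int_functional_add[of A n \<rho> "\<phi> i" "\<lambda>f. \<Sum>i\<in>I. \<phi> i f"] by simp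
qed

lemma lat_basis_coeffs:
  assumes "lat_basis A n b" and "\<And>j. j < m \<Longrightarrow> f j \<in> A"
  obtains P :: "nat \<Rightarrow> nat \<Rightarrow> int" where "\<And>j w. j < m \<Longrightarrow> f j w = (\<Sum>i<n. of_int (P i j) * b i w)"
proof -
  have "\<forall>j. \<exists>e::nat \<Rightarrow> int. j < m \<longrightarrow> (\<forall>w. f j w = (\<Sum>i<n. of_int (e i) * b i w))"
    using assms unfolding lat_basis_def by blast
  then obtain p :: "nat \<Rightarrow> nat \<Rightarrow> int" where
    "\<forall>j. j < m \<longrightarrow> (\<forall>w. f j w = (\<Sum>i<n. of_int (p j i) * b i w))" by (rule choice[THEN exE])
  thus ?thesis by (intro that[of "\<lambda>i j. p j i"]) auto
qed

lemma lat_basis_length_eq: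
  assumes "lat_basis A n f" and "lat_basis A m g"
  shows "n = m"
proof (rule antisym)
  have *: "n \<le> m" if "lat_basis A n f" "lat_basis A m g" for n m :: nat and f g
    by (rule int_independent_length_le[where x = f and y = g and d = 1]) (use that in \<open>auto simp: lat_basis_def\<close>)
  show "n \<le> m" "m \<le> n" using * assms by blast+
qed

lemma abs_fdet_of_int_ge_1:
  fixes P :: "nat \<Rightarrow> nat \<Rightarrow> int"
  assumes "fdet n (\<lambda>i j. real_of_int (P i j)) \<noteq> 0"
  shows "\<bar>fdet n (\<lambda>i j. real_of_int (P i j))\<bar> \<ge> 1"
  using assms by (intro Ints_nonzero_abs_ge1 fdet_Ints) auto

lemma of_int_fdet: "fdet n (\<lambda>i j. real_of_int (P i j)) = real_of_int (fdet n P)"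
proof -
  have "mat n n (\<lambda>(i, j). real_of_int (P i j)) = map_mat of_int (mat n n (\<lambda>(i, j). P i j))"
    by (rule eq_matI) auto
  thus ?thesis unfolding fdet_def by (simp add: of_int_hom.hom_det)
qed

text \<open>
  If the determinant on the right is nonzero, then so are the integer determinants expressing it
  through the one on the left.
\<close>

lemma abs_fdet_le_of_mutual_integral:
  assumes Al: "lat_basis A n a" "lat_basis A n b"
    and rows: "\<And>i. i < n \<Longrightarrow> int_functional A n \<mu> (\<tau> i)" "\<And>i. i < n \<Longrightarrow> int_functional A n \<tau> (\<mu> i)"
    and lin: "\<And>i c f. i < n \<Longrightarrow> (\<forall>j<n. f j \<in> A) \<Longrightarrow>
      \<tau> i (\<lambda>w. \<Sum>j<n. of_int (c j) * f j w) = (\<Sum>j<n. of_int (c j) * \<tau> i (f j))"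
      "\<And>i c f. i < n \<Longrightarrow> (\<forall>j<n. f j \<in> A) \<Longrightarrow>
      \<mu> i (\<lambda>w. \<Sum>j<n. of_int (c j) * f j w) = (\<Sum>j<n. of_int (c j) * \<mu> i (f j))"
  shows "\<bar>fdet n (\<lambda>i j. \<tau> i (a j))\<bar> \<le> \<bar>fdet n (\<lambda>i j. \<mu> i (b j))\<bar>"
proof -
  \<comment> \<open>The rows are changed by \<open>R\<close> and the basis by \<open>P\<close>. The
    statement is generic in both families because it is used in each direction below.\<close>
  have factor: "\<exists>R P :: nat \<Rightarrow> nat \<Rightarrow> int. fdet n (\<lambda>i j. \<tau> i (a j)) =
      fdet n (\<lambda>i j. real_of_int (R i j)) * fdet n (\<lambda>i j. \<mu> i (b j)) * fdet n (\<lambda>i j. real_of_int (P i j))"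
    if A: "lat_basis A n a" "lat_basis A n b"
      and rows: "\<And>i. i < n \<Longrightarrow> int_functional A n \<mu> (\<tau> i)"
      and lin: "\<And>i c f. i < n \<Longrightarrow> (\<forall>j<n. f j \<in> A) \<Longrightarrow>
        \<mu> i (\<lambda>w. \<Sum>j<n. of_int (c j) * f j w) = (\<Sum>j<n. of_int (c j) * \<mu> i (f j))"
    for a b \<mu> \<tau>
  proof -
    have a: "a j \<in> A" if "j < n" for j using A(1) that by (simp add: lat_basis_def)
    have b: "b j \<in> A" if "j < n" for j using A(2) that by (simp add: lat_basis_def)
    obtain P :: "nat \<Rightarrow> nat \<Rightarrow> int" where P: "\<And>j w. j < n \<Longrightarrow> a j w = (\<Sum>i<n. of_int (P i j) * b i w)"
      using lat_basis_coeffs[OF A(2), of n a] a by blast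
    have "\<forall>i. \<exists>R::nat \<Rightarrow> int. i < n \<longrightarrow> (\<forall>f\<in>A. \<tau> i f = (\<Sum>m<n. of_int (R m) * \<mu> m f))"
      using rows unfolding int_functional_def by blast
    then obtain R :: "nat \<Rightarrow> nat \<Rightarrow> int" where
      R: "\<And>i f. i < n \<Longrightarrow> f \<in> A \<Longrightarrow> \<tau> i f = (\<Sum>m<n. of_int (R i m) * \<mu> m f)"
      using choice[of "\<lambda>i R. i < n \<longrightarrow> (\<forall>f\<in>A. \<tau> i f = (\<Sum>m<n. of_int (R m) * \<mu> m f))"] by blast
    have "fdet n (\<lambda>i j. \<tau> i (a j)) = fdet n (\<lambda>i j. \<Sum>m<n. real_of_int (R i m) * \<mu> m (a j))"
      by (rule fdet_cong) (simp add: R a)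
    also have "\<dots> = fdet n (\<lambda>i j. real_of_int (R i j)) * fdet n (\<lambda>i j. \<mu> i (a j))"
      by (rule fdet_mult)
    also have "fdet n (\<lambda>i j. \<mu> i (a j)) = fdet n (\<lambda>i j. \<Sum>m<n. \<mu> i (b m) * real_of_int (P m j))"
    proof (rule fdet_cong)
      fix i j assume ij: "i < n" "j < n"
      have "a j = (\<lambda>w. \<Sum>i<n. of_int (P i j) * b i w)" using P[OF ij(2)] by blast
      thus "\<mu> i (a j) = (\<Sum>m<n. \<mu> i (b m) * real_of_int (P m j))"
        using lin[OF ij(1), of b "\<lambda>i. P i j"] b by (simp add: mult.commute)
    qed
    also have "\<dots> = fdet n (\<lambda>i j. \<mu> i (b j)) * fdet n (\<lambda>i j. real_of_int (P i j))"
      by (rule fdet_mult)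
    finally show ?thesis by (intro exI[of _ R] exI[of _ P]) (simp add: mult.assoc)
  qed
  obtain R P :: "nat \<Rightarrow> nat \<Rightarrow> int" where 1: "fdet n (\<lambda>i j. \<tau> i (a j)) =
      fdet n (\<lambda>i j. real_of_int (R i j)) * fdet n (\<lambda>i j. \<mu> i (b j)) * fdet n (\<lambda>i j. real_of_int (P i j))"
    using factor[of a b \<mu> \<tau>, OF Al(1) Al(2) _ lin(2)] rows(1) by blast
  obtain R' P' :: "nat \<Rightarrow> nat \<Rightarrow> int" where 2: "fdet n (\<lambda>i j. \<mu> i (b j)) =
      fdet n (\<lambda>i j. real_of_int (R' i j)) * fdet n (\<lambda>i j. \<tau> i (a j)) * fdet n (\<lambda>i j. real_of_int (P' i j))"
    using factor[of b a \<tau> \<mu>, OF Al(2) Al(1) _ lin(1)] rows(2) by blast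
  show ?thesis
  proof (cases "fdet n (\<lambda>i j. \<mu> i (b j)) = 0")
    case True thus ?thesis using 1 by simp
  next
    case False
    hence "fdet n (\<lambda>i j. real_of_int (R' i j)) \<noteq> 0" "fdet n (\<lambda>i j. real_of_int (P' i j)) \<noteq> 0"
      using 2 by auto
    hence "1 \<le> \<bar>fdet n (\<lambda>i j. real_of_int (R' i j))\<bar>" "1 \<le> \<bar>fdet n (\<lambda>i j. real_of_int (P' i j))\<bar>"
      by (simp_all add: abs_fdet_of_int_ge_1)
    hence "1 \<le> \<bar>fdet n (\<lambda>i j. real_of_int (R' i j))\<bar> * \<bar>fdet n (\<lambda>i j. real_of_int (P' i j))\<bar>"
      using mult_mono[of 1 _ 1] by fastforce
    hence "1 * \<bar>fdet n (\<lambda>i j. \<tau> i (a j))\<bar> \<le> 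
      (\<bar>fdet n (\<lambda>i j. real_of_int (R' i j))\<bar> * \<bar>fdet n (\<lambda>i j. real_of_int (P' i j))\<bar>) * \<bar>fdet n (\<lambda>i j. \<tau> i (a j))\<bar>"
      by (intro mult_right_mono) auto
    also have "\<dots> = \<bar>fdet n (\<lambda>i j. \<mu> i (b j))\<bar>" 
      by (subst 2) (simp only: abs_mult mult.assoc mult.commute[of "\<bar>fdet n (\<lambda>i j. \<tau> i (a j))\<bar>"])
    finally show ?thesis by simp
  qed
qed

lemma lat_basis_mem: "lat_basis A n b \<Longrightarrow> i < n \<Longrightarrow> b i \<in> A"
  by (simp add: lat_basis_def)

lemma lat_basis_independent: "lat_basis A n b \<Longrightarrow> int_independent n b"
  by (simp add: lat_basis_def)

lemma lat_basis_generates: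
  assumes "lat_basis A n b" and "g \<in> A"
  obtains e :: "nat \<Rightarrow> int" where "\<And>w. g w = (\<Sum>i<n. of_int (e i) * b i w)"
proof -
  have "\<exists>e::nat \<Rightarrow> int. \<forall>w. g w = (\<Sum>i<n. of_int (e i) * b i w)"
    using assms by (simp add: lat_basis_def)
  thus ?thesis using that by meson
qed

section \<open>Covolumes of a lattice, of its image and of its kernel under the norm\<close>

text \<open>In the application \<open>Wl\<close> and \<open>Wk\<close> are the archimedean places of
  the two fields, \<open>\<pi>\<close> is restriction, \<open>c\<close> picks the omitted place
  above each place of \<open>k\<close>, \<open>Nm\<close> is the norm on logarithms and
  \<open>d\<close> is the degree. The bijections \<open>vk\<close> and \<open>ws\<close> state that
  the matrices for \<open>k\<close> and for the relative units are square. A count of places then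
  makes the matrix for \<open>l\<close> square as well, which is the first conclusion.\<close>

theorem lattice_covolume_le:
  fixes Wl :: "'w set" and Wk :: "'v set" and \<pi> :: "'w \<Rightarrow> 'v" and c :: "'v \<Rightarrow> 'w"
    and Al :: "('w \<Rightarrow> real) set" and Ak :: "('v \<Rightarrow> real) set" and d :: int
    and Nm :: "('w \<Rightarrow> real) \<Rightarrow> 'v \<Rightarrow> real"
  assumes Nm_def: "Nm = (\<lambda>f v. if v \<in> Wk then (\<Sum>w\<in>{w\<in>Wl. \<pi> w = v}. f w) else 0)"
    and fin: "finite Wl" "finite Wk"
    and \<pi>: "\<And>w. w \<in> Wl \<Longrightarrow> \<pi> w \<in> Wk"
    and c: "\<And>v. v \<in> Wk \<Longrightarrow> c v \<in> Wl" "\<And>v. v \<in> Wk \<Longrightarrow> \<pi> (c v) = v"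
    and Al: "add_subgroup Al" "\<And>f. f \<in> Al \<Longrightarrow> (\<Sum>w\<in>Wl. f w) = 0"
    and Ak: "add_subgroup Ak" "\<And>f v. f \<in> Ak \<Longrightarrow> v \<notin> Wk \<Longrightarrow> f v = 0"
      "\<And>B. finite {f \<in> Ak. \<forall>v\<in>Wk. \<bar>f v\<bar> \<le> B}"
    and NmAl: "\<And>f. f \<in> Al \<Longrightarrow> Nm f \<in> Ak"
    and d: "d \<noteq> 0" "\<And>g. g \<in> Ak \<Longrightarrow> \<exists>f\<in>Al. Nm f = (\<lambda>v. of_int d * g v)"
    and fl: "lat_basis Al nl fl" and fk: "lat_basis Ak nk fk"
    and fe: "lat_basis {f \<in> Al. Nm f = (\<lambda>_. 0)} ne fe"
    and wl: "w0 \<in> Wl" "bij_betw wl {..<ml} (Wl - {w0})"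
    and vk: "v0 \<in> Wk" "bij_betw vk {..<nk} (Wk - {v0})"
    and ws: "bij_betw ws {..<ne} (Wl - c ` Wk)"
  shows "nl = ml"
    and "\<bar>fdet nk (\<lambda>i j. fk j (vk i))\<bar> * \<bar>fdet ne (\<lambda>i j. fe j (ws i))\<bar> \<le> \<bar>fdet nl (\<lambda>i j. fl j (wl i))\<bar>"
proof -
  have Nm_diff: "Nm (\<lambda>w. f w - g w) = (\<lambda>v. Nm f v - Nm g v)" for f g
    unfolding Nm_def by (auto simp: sum_subtractf)
  have Nm_comb: "Nm (\<lambda>w. \<Sum>j<n. e j * f j w) v = (\<Sum>j<n. e j * Nm (f j) v)" for n :: nat and e f v
    unfolding Nm_def by (auto simp: sum_distrib_left intro: sum.swap)
  have NAl: "add_subgroup (Nm ` Al)"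
    unfolding add_subgroup_def
  proof (intro conjI ballI)
    have "Nm (\<lambda>_. 0) = (\<lambda>_. 0)" unfolding Nm_def by auto
    thus "(\<lambda>_. 0) \<in> Nm ` Al" using add_subgroup_zero[OF Al(1)] by (metis image_eqI)
    fix f g assume "f \<in> Nm ` Al" "g \<in> Nm ` Al"
    then obtain f' g' where "f' \<in> Al" "g' \<in> Al" "f = Nm f'" "g = Nm g'" by blast
    thus "(\<lambda>w. f w - g w) \<in> Nm ` Al"
      using add_subgroup_diff[OF Al(1), of f' g'] Nm_diff[of f' g'] by (metis image_eqI)
  qed
  have "\<exists>n b. lat_basis (Nm ` Al) n b"
  proof (rule discrete_lattice_has_basis[OF NAl fin(2)])
    show "f w = 0" if "f \<in> Nm ` Al" "w \<notin> Wk" for f w using that by (auto simp: Nm_def)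
    show "finite {f \<in> Nm ` Al. \<forall>w\<in>Wk. \<bar>f w\<bar> \<le> B}" for B
      by (rule finite_subset[OF _ Ak(3)[of B]]) (use NmAl in auto)
  qed
  then obtain nb h where h: "lat_basis (Nm ` Al) nb h" by blast
  have hN: "h i \<in> Nm ` Al" if "i < nb" for i using h that by (simp add: lat_basis_def)
  define f where "f = (\<lambda>i. SOME g. g \<in> Al \<and> Nm g = h i)"
  have f: "f i \<in> Al" "Nm (f i) = h i" if "i < nb" for i
  proof -
    have "\<exists>g. g \<in> Al \<and> Nm g = h i" using hN[OF that] by (auto elim!: imageE)
    thus "f i \<in> Al" "Nm (f i) = h i" unfolding f_def by (metis (mono_tags, lifting) someI_ex)+
  qed
  have hAk: "h i \<in> Ak" if "i < nb" for i using NmAl[OF f(1)[OF that]] f(2)[OF that] by simp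
  have hind: "int_independent nb h" using h by (simp add: lat_basis_def)
  have kind: "int_independent nk fk" using fk by (simp add: lat_basis_def)
  obtain P :: "nat \<Rightarrow> nat \<Rightarrow> int" where P: "\<And>j v. j < nb \<Longrightarrow> h j v = (\<Sum>i<nk. of_int (P i j) * fk i v)"
    using lat_basis_coeffs[where f = h and m = nb, OF fk hAk] by blast
  have nb: "nb = nk"
  proof (rule antisym)
    show "nb \<le> nk"
    proof (rule int_independent_length_le[OF hind, where d = 1 and y = fk])
      fix j assume "j < nb"
      thus "\<exists>e::nat \<Rightarrow> int. \<forall>w. of_int 1 * h j w = (\<Sum>i<nk. of_int (e i) * fk i w)"
        by (intro exI[of _ "\<lambda>i. P i j"]) (simp add: P)
    qed simp
    \<comment> \<open>The image of \<open>Nm\<close> contains \<open>d\<close> times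
      \<open>Ak\<close>, so it has full rank.\<close>
    show "nk \<le> nb"
    proof (rule int_independent_length_le[OF kind d(1), where y = h])
      fix j assume "j < nk"
      hence "fk j \<in> Ak" using fk by (simp add: lat_basis_def)
      from d(2)[OF this] obtain g where "g \<in> Al" "Nm g = (\<lambda>v. of_int d * fk j v)" ..
      hence "(\<lambda>v. of_int d * fk j v) \<in> Nm ` Al" by (metis image_eqI)
      from lat_basis_generates[OF h this] obtain e :: "nat \<Rightarrow> int" 
        where "\<And>w. of_int d * fk j w = (\<Sum>i<nb. of_int (e i) * h i w)" by blast
      thus "\<exists>e::nat \<Rightarrow> int. \<forall>w. of_int d * fk j w = (\<Sum>i<nb. of_int (e i) * h i w)"
        by (intro exI[of _ e]) simp
    qed
  qed
  \<comment> \<open>Up to sign this determinant is the index of the image of \<open>Nm\<close> in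
    \<open>Ak\<close>. A kernel vector would be an integer relation among the
    \<open>h\<close>.\<close>
  have detP: "fdet nk (\<lambda>i j. real_of_int (P i j)) \<noteq> 0"
  proof
    assume "fdet nk (\<lambda>i j. real_of_int (P i j)) = 0"
    hence "fdet nk P = 0" unfolding of_int_fdet by simp
    then obtain e where e: "\<exists>j<nk. e j \<noteq> 0" "\<forall>i<nk. (\<Sum>j<nk. P i j * e j) = 0"
      using fdet_kernel[of nk P] by blast
    have "(\<Sum>j<nb. of_int (e j) * h j v) = 0" for v
    proof -
      have "(\<Sum>j<nb. of_int (e j) * h j v) = (\<Sum>j<nb. \<Sum>i<nk. of_int (P i j * e j) * fk i v)"
        by (intro sum.cong) (auto simp: P sum_distrib_left mult_ac)
      also have "\<dots> = (\<Sum>i<nk. \<Sum>j<nb. of_int (P i j * e j) * fk i v)" by (rule sum.swap)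
      also have "\<dots> = (\<Sum>i<nk. of_int (\<Sum>j<nk. P i j * e j) * fk i v)" 
        by (simp add: sum_distrib_right nb)
      also have "\<dots> = 0" using e(2) by simp
      finally show ?thesis .
    qed
    hence "e j = 0" if "j < nb" for j using int_independentD[OF hind, of e j] that by blast
    thus False using e(1) nb by blast
  qed
  have det_h: "\<bar>fdet nk (\<lambda>i j. fk j (vk i))\<bar> \<le> \<bar>fdet nk (\<lambda>i j. h j (vk i))\<bar>"
  proof -
    have "fdet nk (\<lambda>i j. h j (vk i)) = fdet nk (\<lambda>i j. \<Sum>m<nk. fk m (vk i) * real_of_int (P m j))"
      by (rule fdet_cong) (simp add: P nb mult.commute)
    also have "\<dots> = fdet nk (\<lambda>i j. fk j (vk i)) * fdet nk (\<lambda>i j. real_of_int (P i j))"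
      by (rule fdet_mult)
    finally have "\<bar>fdet nk (\<lambda>i j. h j (vk i))\<bar> = \<bar>fdet nk (\<lambda>i j. fk j (vk i))\<bar> * \<bar>fdet nk (\<lambda>i j. real_of_int (P i j))\<bar>"
      by (simp add: abs_mult)
    thus ?thesis using abs_fdet_of_int_ge_1[OF detP] 
      by (simp add: mult_le_cancel_left1)
  qed
  define n where "n = ne + nk"
  \<comment> \<open>Kernel basis first, lifts of \<open>h\<close> second: \<open>Nm\<close> vanishes
    on the first \<open>ne\<close> columns, which is the zero block required by
    \<open>fdet_block\<close>.\<close>
  define a where "a = (\<lambda>j. if j < ne then fe j else f (j - ne))"
  have feA: "fe j \<in> Al" "Nm (fe j) = (\<lambda>_. 0)" if "j < ne" for j
    using fe that by (simp_all add: lat_basis_def)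
  have split_sum: "(\<Sum>j<n. g j) = (\<Sum>j<ne. g j) + (\<Sum>j<nk. g (ne + j))" for g :: "nat \<Rightarrow> real"
    unfolding n_def by (induction nk) simp_all
  have a: "lat_basis Al n a"
    unfolding lat_basis_def
  proof (intro conjI allI impI ballI)
    show "a i \<in> Al" if "i < n" for i
      using that feA f nb unfolding a_def n_def by (cases "i < ne") auto
    have asum: "(\<Sum>j<n. of_int (e j) * a j w) = 
       (\<Sum>j<ne. of_int (e j) * fe j w) + (\<Sum>j<nk. of_int (e (ne + j)) * f j w)" for e :: "nat \<Rightarrow> int" and w
      unfolding split_sum a_def by simp
    show "int_independent n a"
      unfolding int_independent_def
    proof (intro allI impI)
      fix e :: "nat \<Rightarrow> int" and i
      assume e: "\<forall>w. (\<Sum>j<n. of_int (e j) * a j w) = 0" and i: "i < n"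
      have "(\<Sum>j<nb. of_int (e (ne + j)) * h j v) = 0" for v
      proof -
        have "Nm (\<lambda>w. \<Sum>j<n. of_int (e j) * a j w) v = Nm (\<lambda>_. 0) v" using e by simp
        also have "\<dots> = 0" by (simp add: Nm_def)
        finally have "(\<Sum>j<n. of_int (e j) * Nm (a j) v) = 0" by (simp add: Nm_comb)
        thus ?thesis using feA(2) f(2) unfolding split_sum a_def by (simp add: nb)
      qed
      hence "e (ne + j) = 0" if "j < nk" for j
        using int_independentD[OF hind, of "\<lambda>j. e (ne + j)" j] that nb by blast
      note e2 = this
      have "(\<Sum>j<ne. of_int (e j) * fe j w) = 0" for w
        using e[rule_format, of w] e2 unfolding asum by simp
      moreover have "int_independent ne fe" using fe by (simp add: lat_basis_def)
      ultimately have e1: "e j = 0" if "j < ne" for j using int_independentD[of ne fe e j] that by blast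
      show "e i = 0"
      proof (cases "i < ne")
        case False
        thus ?thesis using e2[of "i - ne"] i by (simp add: n_def)
      qed (use e1 in auto)
    qed
    fix g assume g: "g \<in> Al"
    obtain p :: "nat \<Rightarrow> int" where p: "\<And>v. Nm g v = (\<Sum>i<nb. of_int (p i) * h i v)"
      using lat_basis_generates[OF h imageI[OF g]] by blast
    define g' where "g' = (\<lambda>w. g w - (\<Sum>i<nb. of_int (p i) * f i w))"
    have "g' \<in> Al" unfolding g'_def
      by (intro add_subgroup_diff[OF Al(1) g] add_subgroup_comb[OF Al(1)] f(1))
    moreover have "Nm g' = (\<lambda>_. 0)"
      unfolding g'_def Nm_diff Nm_comb p by (simp add: f(2))
    ultimately have "g' \<in> {f \<in> Al. Nm f = (\<lambda>_. 0)}" by simp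
    from lat_basis_generates[OF fe this] obtain q :: "nat \<Rightarrow> int"
      where q: "\<And>w. g' w = (\<Sum>i<ne. of_int (q i) * fe i w)" by blast
    have "g w = (\<Sum>j<n. of_int (if j < ne then q j else p (j - ne)) * a j w)" for w
    proof -
      have "g w = g' w + (\<Sum>i<nb. of_int (p i) * f i w)" by (simp add: g'_def)
      thus ?thesis unfolding asum q by (simp add: nb)
    qed
    thus "\<exists>e::nat \<Rightarrow> int. \<forall>w. g w = (\<Sum>j<n. of_int (e j) * a j w)"
      by (intro exI[of _ "\<lambda>j. if j < ne then q j else p (j - ne)"]) simp
  qed
  have nl: "nl = n" by (rule lat_basis_length_eq[OF fl a])
  have inj_c: "inj_on c Wk" using c(2) by (metis inj_onI)
  \<comment> \<open>The square shapes give \<open>ne = card Wl - card Wk\<close> and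
    \<open>nk = card Wk - 1\<close>, so \<open>n = card Wl - 1\<close>. Truncated subtraction is
    harmless: \<open>c\<close> is injective and \<open>Wk\<close> contains
    \<open>v0\<close>.\<close>
  have "ne = card Wl - card Wk"
  proof -
    have "ne = card (Wl - c ` Wk)" using bij_betw_same_card[OF ws] by simp
    also have "\<dots> = card Wl - card (c ` Wk)" by (rule card_Diff_subset) (use fin c in auto)
    finally show ?thesis using card_image[OF inj_c] by simp
  qed
  moreover have "card Wk \<le> card Wl" using card_inj_on_le[OF inj_c _ fin(1)] c(1) by blast
  moreover have "nk = card Wk - 1" using bij_betw_same_card[OF vk(2)] vk(1) fin by simp
  moreover have "ml = card Wl - 1" using bij_betw_same_card[OF wl(2)] wl(1) fin by simp
  moreover have "card Wk > 0" using vk(1) fin card_gt_0_iff by blast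
  ultimately have ml: "ml = n" by (simp add: n_def)
  show "nl = ml" using nl ml by simp
  \<comment> \<open>\<open>\<tau>\<close> consists of the values at the places outside the image of
    \<open>c\<close>, followed by the norms at the places other than \<open>v0\<close>;
    \<open>\<mu>\<close> consists of the values at the places other than \<open>w0\<close>. On
    \<open>Al\<close> each family generates the other over the integers.\<close>
  define \<tau> where "\<tau> = (\<lambda>i f. if i < ne then f (ws i) else Nm f (vk (i - ne)))"
  define \<mu> where "\<mu> = (\<lambda>i f. f (wl i) :: real)"
  have wl': "\<exists>i<n. wl i = w" if "w \<in> Wl" "w \<noteq> w0" for w
    using bij_betw_imp_surj_on[OF wl(2)] that ml by (metis (no_types, lifting) DiffI imageE lessThan_iff singletonD)
  have ws': "\<exists>i<ne. ws i = w" if "w \<in> Wl" "w \<notin> c ` Wk" for w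
    using bij_betw_imp_surj_on[OF ws] that by (metis (no_types, lifting) DiffI imageE lessThan_iff)
  have vk': "\<exists>i<nk. vk i = v" if "v \<in> Wk" "v \<noteq> v0" for v
    using bij_betw_imp_surj_on[OF vk(2)] that by (metis (no_types, lifting) DiffI imageE lessThan_iff singletonD)
  have wsW: "ws i \<in> Wl" if "i < ne" for i using bij_betw_apply[OF ws] that by blast
  have vkW: "vk i \<in> Wk" if "i < nk" for i using bij_betw_apply[OF vk(2)] that by blast
  have wlW: "wl i \<in> Wl" if "i < n" for i using bij_betw_apply[OF wl(2)] that ml by blast
  have I1: "int_functional Al n \<mu> (\<lambda>f. f w)" if w: "w \<in> Wl" for w
  proof -
    have *: "int_functional Al n \<mu> (\<lambda>f. f w)" if w: "w \<in> Wl" "w \<noteq> w0" for w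
    proof -
      obtain i where "i < n" "wl i = w" using wl'[OF w] by blast
      thus ?thesis using int_functional_base[of i n Al \<mu>] by (simp add: \<mu>_def)
    qed
    show ?thesis
    proof (cases "w = w0")
      case True
      \<comment> \<open>The values of a function in \<open>Al\<close> sum to zero, so the omitted
        one is minus the sum of the others.\<close>
      have "int_functional Al n \<mu> (\<lambda>f. - (\<Sum>w\<in>Wl - {w0}. f w))"
        by (intro int_functional_uminus int_functional_sum *) (use fin in auto)
      thus ?thesis
      proof (rule int_functional_cong)
        fix f assume "f \<in> Al"
        from Al(2)[OF this] show "- (\<Sum>w\<in>Wl - {w0}. f w) = f w"
          using sum.remove[OF fin(1) wl(1), of f] True by simp
      qed
    qed (use * w in auto)
  qed
  have Nm_I: "int_functional Al n \<rho> (\<lambda>f. Nm f v)" 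
    if "\<And>w. w \<in> Wl \<Longrightarrow> int_functional Al n \<rho> (\<lambda>f. f w)" "v \<in> Wk" for \<rho> v
    unfolding Nm_def using that fin by (auto intro!: int_functional_sum)
  have rows1: "int_functional Al n \<mu> (\<tau> i)" if "i < n" for i
    using that I1 wsW Nm_I[OF I1 vkW] unfolding \<tau>_def n_def by (cases "i < ne") auto
  have J1: "int_functional Al n \<tau> (\<lambda>f. f w)" if w: "w \<in> Wl" "w \<notin> c ` Wk" for w
  proof -
    obtain i where "i < ne" "ws i = w" using ws'[OF w] by blast
    thus ?thesis using int_functional_base[of i n Al \<tau>] by (simp add: \<tau>_def n_def)
  qed
  have J2: "int_functional Al n \<tau> (\<lambda>f. Nm f v)" if v: "v \<in> Wk" for v
  proof -
    have *: "int_functional Al n \<tau> (\<lambda>f. Nm f v)" if v: "v \<in> Wk" "v \<noteq> v0" for v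
    proof -
      obtain i where "i < nk" "vk i = v" using vk'[OF v] by blast
      thus ?thesis using int_functional_base[of "ne + i" n Al \<tau>] by (simp add: \<tau>_def n_def)
    qed
    show ?thesis
    proof (cases "v = v0")
      case True
      have "int_functional Al n \<tau> (\<lambda>f. - (\<Sum>v\<in>Wk - {v0}. Nm f v))"
        by (intro int_functional_uminus int_functional_sum *) (use fin in auto)
      thus ?thesis
      proof (rule int_functional_cong)
        fix f assume f: "f \<in> Al"
        have "(\<Sum>v\<in>Wk. Nm f v) = (\<Sum>v\<in>Wk. \<Sum>w\<in>{w\<in>Wl. \<pi> w = v}. f w)" by (simp add: Nm_def)
        also have "\<dots> = (\<Sum>w\<in>Wl. f w)" by (rule sum.group) (use fin \<pi> in auto)
        also have "\<dots> = 0" by (rule Al(2)[OF f])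
        finally show "- (\<Sum>v\<in>Wk - {v0}. Nm f v) = Nm f v"
          using sum.remove[OF fin(2) vk(1), of "Nm f"] True by simp
      qed
    qed (use * v in auto)
  qed
  have J3: "int_functional Al n \<tau> (\<lambda>f. f w)" if w: "w \<in> Wl" for w
  proof (cases "w \<in> c ` Wk")
    case True
    then obtain v where v: "v \<in> Wk" "w = c v" by blast
    let ?S = "{w\<in>Wl. \<pi> w = v} - {w}"
    \<comment> \<open>The value at \<open>c v\<close> is the norm at \<open>v\<close> minus the
      values at the other places above \<open>v\<close>. None of those is in the image of
      \<open>c\<close>, which contains just one place above each \<open>v\<close>.\<close>
    have "int_functional Al n \<tau> (\<lambda>f. Nm f v + - (\<Sum>w\<in>?S. f w))"
      by (intro int_functional_add int_functional_uminus int_functional_sum J1 J2)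
        (use fin v c in auto)
    thus ?thesis
    proof (rule int_functional_cong)
      fix f :: "'w \<Rightarrow> real"
      have "(\<Sum>w\<in>{w\<in>Wl. \<pi> w = v}. f w) = f w + (\<Sum>w\<in>?S. f w)"
        by (rule sum.remove) (use fin w v c in auto)
      thus "Nm f v + - (\<Sum>w\<in>?S. f w) = f w" using v by (simp add: Nm_def)
    qed
  qed (use J1 w in auto)
  have rows2: "int_functional Al n \<tau> (\<mu> i)" if "i < n" for i
    using J3[OF wlW[OF that]] by (simp add: \<mu>_def)
  have "\<bar>fdet n (\<lambda>i j. \<tau> i (a j))\<bar> \<le> \<bar>fdet n (\<lambda>i j. \<mu> i (fl j))\<bar>"
    by (rule abs_fdet_le_of_mutual_integral[OF a fl[unfolded nl] rows1 rows2])
      (auto simp: \<tau>_def \<mu>_def Nm_comb)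
  also have "fdet n (\<lambda>i j. \<tau> i (a j)) = fdet ne (\<lambda>i j. fe j (ws i)) * fdet nk (\<lambda>i j. h j (vk i))"
  proof -
    have "fdet n (\<lambda>i j. \<tau> i (a j)) = fdet ne (\<lambda>i j. \<tau> i (a j)) * fdet nk (\<lambda>i j. \<tau> (ne + i) (a (ne + j)))"
      unfolding n_def by (rule fdet_block) (simp add: \<tau>_def a_def feA)
    also have "fdet ne (\<lambda>i j. \<tau> i (a j)) = fdet ne (\<lambda>i j. fe j (ws i))"
      by (rule fdet_cong) (simp add: \<tau>_def a_def)
    also have "fdet nk (\<lambda>i j. \<tau> (ne + i) (a (ne + j))) = fdet nk (\<lambda>i j. h j (vk i))"
      by (rule fdet_cong) (simp add: \<tau>_def a_def f(2) nb)
    finally show ?thesis .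
  qed
  finally have "\<bar>fdet ne (\<lambda>i j. fe j (ws i))\<bar> * \<bar>fdet nk (\<lambda>i j. h j (vk i))\<bar> \<le> \<bar>fdet n (\<lambda>i j. fl j (wl i))\<bar>"
    by (simp add: abs_mult \<mu>_def)
  moreover have "\<bar>fdet nk (\<lambda>i j. fk j (vk i))\<bar> * \<bar>fdet ne (\<lambda>i j. fe j (ws i))\<bar> 
      \<le> \<bar>fdet ne (\<lambda>i j. fe j (ws i))\<bar> * \<bar>fdet nk (\<lambda>i j. h j (vk i))\<bar>"
    using mult_left_mono[OF det_h, of "\<bar>fdet ne (\<lambda>i j. fe j (ws i))\<bar>"] by (simp add: mult.commute)
  ultimately show "\<bar>fdet nk (\<lambda>i j. fk j (vk i))\<bar> * \<bar>fdet ne (\<lambda>i j. fe j (ws i))\<bar> \<le> \<bar>fdet nl (\<lambda>i j. fl j (wl i))\<bar>"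
    unfolding nl by linarith
qed

section \<open>Algebraic integers form a ring\<close>

definition int_span :: "'a::field_char_0 set \<Rightarrow> 'a set" where
  "int_span S = {\<Sum>s\<in>S. of_int (c s) * s | c :: 'a \<Rightarrow> int. True}"

lemma int_span_base:
  assumes "finite S" "s \<in> S" shows "s \<in> int_span S"
proof -
  have "(\<Sum>t\<in>S. of_int (if t = s then 1 else 0) * t) = (\<Sum>t\<in>S. if t = s then t else 0)"
    by (intro sum.cong) auto
  hence "s = (\<Sum>t\<in>S. of_int (if t = s then 1 else 0) * t)" using assms by simp
  thus ?thesis unfolding int_span_def by (intro CollectI exI[of _ "\<lambda>t. if t = s then 1 else 0"]) simp
qed

lemma int_span_zero: "0 \<in> int_span S"
  unfolding int_span_def by (auto intro!: exI[of _ "\<lambda>_. 0"])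

lemma int_span_add:
  assumes "x \<in> int_span S" "y \<in> int_span S" shows "x + y \<in> int_span S"
proof -
  obtain c d :: "'a \<Rightarrow> int" where "x = (\<Sum>s\<in>S. of_int (c s) * s)" "y = (\<Sum>s\<in>S. of_int (d s) * s)"
    using assms unfolding int_span_def by blast
  hence "x + y = (\<Sum>s\<in>S. of_int (c s + d s) * s)" by (simp add: sum.distrib algebra_simps)
  thus ?thesis unfolding int_span_def by (intro CollectI exI[of _ "\<lambda>s. c s + d s"]) simp
qed

lemma int_span_scale:
  assumes "x \<in> int_span S" shows "of_int e * x \<in> int_span S"
proof -
  obtain c :: "'a \<Rightarrow> int" where "x = (\<Sum>s\<in>S. of_int (c s) * s)"
    using assms unfolding int_span_def by blast
  hence "of_int e * x = (\<Sum>s\<in>S. of_int (e * c s) * s)" by (simp add: sum_distrib_left mult.assoc)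
  thus ?thesis unfolding int_span_def by (intro CollectI exI[of _ "\<lambda>s. e * c s"]) simp
qed

lemma int_span_sum:
  assumes "\<And>i. i \<in> I \<Longrightarrow> f i \<in> int_span S" shows "(\<Sum>i\<in>I. of_int (e i) * f i) \<in> int_span S"
  using assms
  by (induction I rule: infinite_finite_induct) (auto intro: int_span_zero int_span_add int_span_scale)

lemma int_span_mult_closed:
  assumes "\<And>s. s \<in> S \<Longrightarrow> z * s \<in> int_span S" and "x \<in> int_span S"
  shows "z * x \<in> int_span S"
proof -
  obtain c :: "'a \<Rightarrow> int" where "x = (\<Sum>s\<in>S. of_int (c s) * s)"
    using assms unfolding int_span_def by blast
  hence "z * x = (\<Sum>s\<in>S. of_int (c s) * (z * s))" by (simp add: sum_distrib_left mult_ac)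
  thus ?thesis using int_span_sum[of S "\<lambda>s. z * s" S c] assms(1) by simp
qed

text \<open>The characteristic polynomial of multiplication by \<open>z\<close> is monic with integer coefficients.\<close>

lemma algebraic_int_if_int_span_closed:
  fixes z :: "'a::field_char_0"
  assumes S: "finite S" "s0 \<in> S" "s0 \<noteq> 0" and z: "\<And>s. s \<in> S \<Longrightarrow> z * s \<in> int_span S"
  shows "algebraic_int z"
proof -
  define n where "n = card S"
  obtain b where b: "bij_betw b {0..<n} S" using ex_bij_betw_nat_finite[OF S(1)] n_def by blast
  have "\<forall>i. \<exists>c::'a \<Rightarrow> int. i < n \<longrightarrow> z * b i = (\<Sum>s\<in>S. of_int (c s) * s)"
    using z bij_betw_apply[OF b] unfolding int_span_def by fastforce
  then obtain c :: "nat \<Rightarrow> 'a \<Rightarrow> int" where c: "\<And>i. i < n \<Longrightarrow> z * b i = (\<Sum>s\<in>S. of_int (c i s) * s)"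
    by metis
  define A where "A = mat n n (\<lambda>(i, j). c i (b j))"
  define v where "v = vec n b"
  have A: "A \<in> carrier_mat n n" by (simp add: A_def)
  have "eigenvector (map_mat of_int A) v z"
    unfolding eigenvector_def
  proof (intro conjI)
    show "v \<in> carrier_vec (dim_row (map_mat of_int A))" by (simp add: A_def v_def)
    obtain i where "i < n" "b i = s0" using bij_betw_imp_surj_on[OF b] S(2) by fastforce
    hence "v $ i \<noteq> 0" using S(3) by (simp add: v_def)
    thus "v \<noteq> 0\<^sub>v (dim_row (map_mat of_int A))" using \<open>i < n\<close> by (auto simp: A_def)
    show "map_mat of_int A *\<^sub>v v = z \<cdot>\<^sub>v v"
    proof (rule eq_vecI)
      fix i assume "i < dim_vec (z \<cdot>\<^sub>v v)"
      hence i: "i < n" by (simp add: v_def)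
      have "(map_mat of_int A *\<^sub>v v) $ i = (\<Sum>j\<in>{0..<n}. of_int (c i (b j)) * b j)"
        using i by (simp add: A_def v_def scalar_prod_def)
      also have "\<dots> = (\<Sum>s\<in>S. of_int (c i s) * s)" by (rule sum.reindex_bij_betw[OF b])
      also have "\<dots> = (z \<cdot>\<^sub>v v) $ i" using i c[OF i] by (simp add: v_def)
      finally show "(map_mat of_int A *\<^sub>v v) $ i = (z \<cdot>\<^sub>v v) $ i" .
    qed (simp add: A_def v_def)
  qed
  hence "eigenvalue (map_mat of_int A) z" unfolding eigenvalue_def by blast
  hence "poly (char_poly (map_mat of_int A)) z = 0"
    using eigenvalue_root_char_poly[of "map_mat of_int A" n z] A by simp
  hence "poly (map_poly of_int (char_poly A)) z = 0" by (simp add: of_int_hom.char_poly_hom[OF A])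
  moreover have "Polynomial.lead_coeff (char_poly A) = 1" using degree_monic_char_poly[OF A] by simp
  ultimately show ?thesis unfolding algebraic_int_altdef_ipoly by blast
qed

lemma algebraic_int_power_relation:
  fixes x :: "'a::field_char_0"
  assumes "algebraic_int x"
  obtains n c where "n > 0" "x ^ n = (\<Sum>i<n. of_int (c i) * x ^ i)"
proof -
  obtain p where p: "poly (map_poly of_int p) x = 0" "Polynomial.lead_coeff p = 1"
    using assms unfolding algebraic_int_altdef_ipoly by blast
  let ?n = "Polynomial.degree p"
  have "poly (map_poly of_int p) x = (\<Sum>i\<le>?n. of_int (poly.coeff p i) * x ^ i)"
    by (simp add: poly_altdef degree_map_poly coeff_map_poly)
  also have "\<dots> = x ^ ?n + (\<Sum>i<?n. of_int (poly.coeff p i) * x ^ i)"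
    using p(2) by (simp add: lessThan_Suc_atMost[symmetric])
  finally have *: "x ^ ?n = (\<Sum>i<?n. of_int (- poly.coeff p i) * x ^ i)"
    using p(1) by (simp add: sum_negf eq_neg_iff_add_eq_0)
  have "?n > 0" using * by (cases "?n = 0") auto
  thus ?thesis using that[of ?n "\<lambda>i. - poly.coeff p i"] * by blast
qed

text \<open>The products \<open>x ^ i * y ^ j\<close> with exponents below the degrees of the two
  monic relations generate a module stable under both elements, hence under their sum and
  product.\<close>

lemma algebraic_int_common_module:
  fixes x y :: "'a::field_char_0"
  assumes "algebraic_int x" "algebraic_int y"
  obtains S where "finite S" "1 \<in> S" "\<And>s. s \<in> S \<Longrightarrow> x * s \<in> int_span S" "\<And>s. s \<in> S \<Longrightarrow> y * s \<in> int_span S"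
proof -
  obtain m c where m: "m > 0" "x ^ m = (\<Sum>i<m. of_int (c i) * x ^ i)"
    using algebraic_int_power_relation[OF assms(1)] by blast
  obtain n d where n: "n > 0" "y ^ n = (\<Sum>i<n. of_int (d i) * y ^ i)"
    using algebraic_int_power_relation[OF assms(2)] by blast
  define S where "S = (\<lambda>(i, j). x ^ i * y ^ j) ` ({..<m} \<times> {..<n})"
  have fin: "finite S" by (simp add: S_def)
  have S: "x ^ i * y ^ j \<in> int_span S" if "i < m" "j < n" for i j
    by (rule int_span_base[OF fin]) (use that in \<open>auto simp: S_def\<close>)
  have "x * s \<in> int_span S" if s: "s \<in> S" for s
  proof -
    obtain i j where ij: "i < m" "j < n" "s = x ^ i * y ^ j" using s by (auto simp: S_def)
    show ?thesis
    proof (cases "Suc i = m")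
      case True
      have "x * s = x ^ Suc i * y ^ j" using ij by simp
      also have "\<dots> = (\<Sum>i<m. of_int (c i) * x ^ i) * y ^ j" unfolding True m(2) ..
      also have "\<dots> = (\<Sum>i<m. of_int (c i) * (x ^ i * y ^ j))" by (simp add: sum_distrib_right mult.assoc)
      also have "\<dots> \<in> int_span S" by (rule int_span_sum) (use S ij in auto)
      finally show ?thesis .
    next
      case False
      thus ?thesis using S[of "Suc i" j] ij by (simp add: mult.assoc)
    qed
  qed
  moreover have "y * s \<in> int_span S" if s: "s \<in> S" for s
  proof -
    obtain i j where ij: "i < m" "j < n" "s = x ^ i * y ^ j" using s by (auto simp: S_def)
    show ?thesis
    proof (cases "Suc j = n")
      case True
      have "y * s = x ^ i * y ^ Suc j" using ij by simp
      also have "\<dots> = x ^ i * (\<Sum>i<n. of_int (d i) * y ^ i)" unfolding True n(2) ..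
      also have "\<dots> = (\<Sum>j<n. of_int (d j) * (x ^ i * y ^ j))" by (simp add: sum_distrib_left mult_ac)
      also have "\<dots> \<in> int_span S" by (rule int_span_sum) (use S ij in auto)
      finally show ?thesis .
    next
      case False
      thus ?thesis using S[of i "Suc j"] ij by (simp add: mult_ac)
    qed
  qed
  moreover have "1 \<in> S" unfolding S_def using m(1) n(1) by (intro image_eqI[of _ _ "(0, 0)"]) auto
  ultimately show ?thesis using that fin by blast
qed

lemma algebraic_int_mult:
  fixes x y :: "'a::field_char_0"
  assumes "algebraic_int x" "algebraic_int y"
  shows "algebraic_int (x * y)"
proof -
  obtain S where S: "finite S" "1 \<in> S" "\<And>s. s \<in> S \<Longrightarrow> x * s \<in> int_span S" "\<And>s. s \<in> S \<Longrightarrow> y * s \<in> int_span S"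
    using algebraic_int_common_module[OF assms] by metis
  show ?thesis
  proof (rule algebraic_int_if_int_span_closed[OF S(1,2)])
    fix s assume "s \<in> S"
    have "x * (y * s) \<in> int_span S" by (rule int_span_mult_closed[OF S(3) S(4)[OF \<open>s \<in> S\<close>]])
    thus "x * y * s \<in> int_span S" by (simp add: mult.assoc)
  qed simp
qed

lemma algebraic_int_add:
  fixes x y :: "'a::field_char_0"
  assumes "algebraic_int x" "algebraic_int y"
  shows "algebraic_int (x + y)"
proof -
  obtain S where S: "finite S" "1 \<in> S" "\<And>s. s \<in> S \<Longrightarrow> x * s \<in> int_span S" "\<And>s. s \<in> S \<Longrightarrow> y * s \<in> int_span S"
    using algebraic_int_common_module[OF assms] by metis
  show ?thesis
  proof (rule algebraic_int_if_int_span_closed[OF S(1,2)])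
    fix s assume "s \<in> S"
    thus "(x + y) * s \<in> int_span S" using int_span_add[OF S(3,4)] by (simp add: distrib_right)
  qed simp
qed

lemma algebraic_int_prod:
  fixes f :: "'i \<Rightarrow> 'a::field_char_0"
  assumes "\<And>i. i \<in> I \<Longrightarrow> algebraic_int (f i)" shows "algebraic_int (\<Prod>i\<in>I. f i)"
  using assms by (induction I rule: infinite_finite_induct) (auto intro: algebraic_int_mult)

lemma algebraic_int_sum:
  fixes f :: "'i \<Rightarrow> 'a::field_char_0"
  assumes "\<And>i. i \<in> I \<Longrightarrow> algebraic_int (f i)" shows "algebraic_int (\<Sum>i\<in>I. f i)"
  using assms by (induction I rule: infinite_finite_induct) (auto intro: algebraic_int_add)

section \<open>Subfields and bases\<close>

interpretation amb: domain "ambient :: 'a::field_char_0 ring"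
  by (rule field.axioms(1)[OF field_from_type_algebra])

lemma ambient_simps [simp]:
  "carrier (ambient :: 'a::field_char_0 ring) = UNIV"
  "x \<otimes>\<^bsub>ambient\<^esub> y = x * (y::'a)"
  "x \<oplus>\<^bsub>ambient\<^esub> y = x + (y::'a)"
  "\<one>\<^bsub>ambient\<^esub> = (1::'a)" "\<zero>\<^bsub>ambient\<^esub> = (0::'a)"
  by (simp_all add: ring_of_type_algebra_def)

lemma ambient_a_inv [simp]: "\<ominus>\<^bsub>ambient\<^esub> x = - (x :: 'a::field_char_0)"
  using amb.minus_equality[of "- x" x] by simp

lemma ambient_m_inv: "x \<noteq> 0 \<Longrightarrow> inv\<^bsub>ambient\<^esub> x = inverse (x :: 'a::field_char_0)"
  using amb.inv_char[of x "inverse x"] by simp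

lemma ambient_pow [simp]: "x [^]\<^bsub>ambient\<^esub> (n::nat) = (x :: 'a::field_char_0) ^ n"
  by (induction n) (simp_all add: mult.commute)

context
  fixes K :: "'a::field_char_0 set"
  assumes K: "subfield K ambient"
begin

lemma subfield_zero: "0 \<in> K" and subfield_one: "1 \<in> K"
  and subfield_add: "x \<in> K \<Longrightarrow> y \<in> K \<Longrightarrow> x + y \<in> K"
  and subfield_mult: "x \<in> K \<Longrightarrow> y \<in> K \<Longrightarrow> x * y \<in> K"
  and subfield_uminus: "x \<in> K \<Longrightarrow> - x \<in> K"
  using subringE[OF subfieldE(1)[OF K]] by auto

lemma subfield_diff: "x \<in> K \<Longrightarrow> y \<in> K \<Longrightarrow> x - y \<in> K"
  using subfield_add[OF _ subfield_uminus, of x y] by simp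

lemma subfield_inverse:
  assumes "x \<in> K" shows "inverse x \<in> K"
proof (cases "x = 0")
  case False
  thus ?thesis using amb.subfield_m_inv(1)[OF K, of x] assms by (simp add: ambient_m_inv)
qed (simp add: subfield_zero)

lemma subfield_divide: "x \<in> K \<Longrightarrow> y \<in> K \<Longrightarrow> x / y \<in> K"
  using subfield_mult[OF _ subfield_inverse, of x y] by (simp add: divide_inverse)

lemma subfield_power: "x \<in> K \<Longrightarrow> x ^ n \<in> K"
  by (induction n) (auto intro: subfield_one subfield_mult)

lemma subfield_sum: "(\<And>i. i \<in> I \<Longrightarrow> f i \<in> K) \<Longrightarrow> (\<Sum>i\<in>I. f i) \<in> K"
  by (induction I rule: infinite_finite_induct) (auto intro: subfield_zero subfield_add)

lemma subfield_prod: "(\<And>i. i \<in> I \<Longrightarrow> f i \<in> K) \<Longrightarrow> (\<Prod>i\<in>I. f i) \<in> K"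
  by (induction I rule: infinite_finite_induct) (auto intro: subfield_one subfield_mult)

lemma subfield_of_nat: "of_nat n \<in> K"
  by (induction n) (auto intro: subfield_zero subfield_add subfield_one)

lemma subfield_of_int: "of_int n \<in> K"
  by (cases n) (auto intro!: subfield_of_nat subfield_uminus subfield_diff subfield_one simp del: of_nat_Suc)

lemma subfield_of_rat: "of_rat q \<in> K"
  by (cases q) (auto simp: of_rat_rat intro: subfield_divide subfield_of_int)

lemma Rats_subset_subfield: "\<rat> \<subseteq> K"
  by (auto simp: Rats_def subfield_of_rat)

end

lemma subfieldI_type:
  fixes K :: "'a::field_char_0 set"
  assumes "1 \<in> K" "\<And>x y. x \<in> K \<Longrightarrow> y \<in> K \<Longrightarrow> x - y \<in> K" "\<And>x y. x \<in> K \<Longrightarrow> y \<in> K \<Longrightarrow> x * y \<in> K"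
    "\<And>x. x \<in> K \<Longrightarrow> inverse x \<in> K"
  shows "subfield K ambient"
proof -
  have 0: "0 \<in> K" using assms(1) assms(2)[of 1 1] by simp
  have uminus: "- x \<in> K" if "x \<in> K" for x using assms(2)[OF 0 that] by simp
  have add: "x + y \<in> K" if "x \<in> K" "y \<in> K" for x y using assms(2)[OF that(1) uminus[OF that(2)]] by simp
  show ?thesis
  proof (rule field.subfieldI'[OF field_from_type_algebra])
    show "subring K ambient" by (intro amb.subringI) (use assms 0 uminus add in auto)
    show "inv\<^bsub>ambient\<^esub> x \<in> K" if "x \<in> K - {\<zero>\<^bsub>ambient\<^esub>}" for x
      using that assms(4)[of x] by (simp add: ambient_m_inv)
  qed
qed

lemma subfield_Rats: "subfield (\<rat> :: 'a::field_char_0 set) ambient"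
  by (rule subfieldI_type) auto

lemma ambient_combine:
  "length Ks = length Us \<Longrightarrow> 
    ring.combine (ambient :: 'a::field_char_0 ring) Ks Us = (\<Sum>i<length Us. Ks ! i * Us ! i)"
  by (induction Ks Us rule: list_induct2) (simp_all add: sum.lessThan_Suc_shift del: sum.lessThan_Suc)

text \<open>The library notion of a basis with coefficient functions and indexed sums in place of
  coefficient lists, the form in which matrices can be used.\<close>

definition field_basis :: "'a::field_char_0 set \<Rightarrow> 'a set \<Rightarrow> 'a list \<Rightarrow> bool" where
  "field_basis k l bs \<longleftrightarrow> set bs \<subseteq> l \<and>
     (\<forall>c. (\<forall>i<length bs. c i \<in> k) \<and> (\<Sum>i<length bs. c i * bs ! i) = 0 \<longrightarrow> (\<forall>i<length bs. c i = 0)) \<and>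
     (\<forall>x\<in>l. \<exists>c. (\<forall>i<length bs. c i \<in> k) \<and> x = (\<Sum>i<length bs. c i * bs ! i))"

lemma field_basis_mem: "field_basis k l bs \<Longrightarrow> i < length bs \<Longrightarrow> bs ! i \<in> l"
  unfolding field_basis_def by auto

lemma field_basis_independent:
  assumes "field_basis k l bs" "\<And>i. i < length bs \<Longrightarrow> c i \<in> k" "(\<Sum>i<length bs. c i * bs ! i) = 0"
    and "i < length bs"
  shows "c i = 0"
  using assms unfolding field_basis_def by blast

lemma field_basis_spans:
  assumes "field_basis k l bs" "x \<in> l"
  obtains c where "\<And>i. i < length bs \<Longrightarrow> c i \<in> k" "x = (\<Sum>i<length bs. c i * bs ! i)"
  using assms unfolding field_basis_def by blast

lemma field_basis_if_independent_Span:
  fixes k l :: "'a::field_char_0 set"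
  assumes k: "subfield k ambient"
    and bs: "ring.independent ambient k bs" "ring.Span ambient k bs = l"
  shows "field_basis k l bs"
  unfolding field_basis_def
proof (intro conjI allI impI ballI)
  show "set bs \<subseteq> l" using amb.Span_base_incl[OF k, of bs] bs(2) by simp
  fix c i assume c: "(\<forall>i<length bs. c i \<in> k) \<and> (\<Sum>i<length bs. c i * bs ! i) = 0" and i: "i < length bs"
  let ?Ks = "map c [0..<length bs]"
  have "amb.combine ?Ks bs = \<zero>\<^bsub>ambient\<^esub>" using c by (simp add: ambient_combine)
  moreover have "set ?Ks \<subseteq> k" using c by auto
  ultimately have "set (take (length bs) ?Ks) \<subseteq> {\<zero>\<^bsub>ambient\<^esub>}"
    using amb.independent_imp_trivial_combine[OF k bs(1)] by blast
  thus "c i = 0" using i by (auto simp: image_subset_iff)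
next
  fix x assume "x \<in> l"
  then obtain Ks where Ks: "set Ks \<subseteq> k" "length Ks = length bs" "x = amb.combine Ks bs"
    using amb.Span_mem_iff_length_version[OF k, of bs x] bs(2) by auto
  thus "\<exists>c. (\<forall>i<length bs. c i \<in> k) \<and> x = (\<Sum>i<length bs. c i * bs ! i)"
    by (intro exI[of _ "\<lambda>i. Ks ! i"]) (auto simp: ambient_combine)
qed

section \<open>Complex embeddings\<close>

text \<open>Extensional functions, so that embeddings agreeing on \<open>K\<close> are equal and can
  be counted.\<close>

definition embs :: "'a::field_char_0 set \<Rightarrow> ('a \<Rightarrow> complex) set" where
  "embs K = {\<sigma> \<in> extensional K. \<sigma> 1 = 1 \<and>
     (\<forall>x\<in>K. \<forall>y\<in>K. \<sigma> (x + y) = \<sigma> x + \<sigma> y \<and> \<sigma> (x * y) = \<sigma> x * \<sigma> y)}"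

definition ext_embs :: "'a::field_char_0 set \<Rightarrow> 'a set \<Rightarrow> ('a \<Rightarrow> complex) \<Rightarrow> ('a \<Rightarrow> complex) set" where
  "ext_embs l k \<sigma> = {\<tau> \<in> embs l. \<forall>x\<in>k. \<tau> x = \<sigma> x}"

lemma embs_eqI:
  assumes "\<sigma> \<in> embs K" "\<tau> \<in> embs K" "\<And>x. x \<in> K \<Longrightarrow> \<sigma> x = \<tau> x"
  shows "\<sigma> = \<tau>"
  using assms by (auto simp: embs_def intro: extensionalityI)

context
  fixes K :: "'a::field_char_0 set" and \<sigma> :: "'a \<Rightarrow> complex"
  assumes K: "subfield K ambient" and \<sigma>: "\<sigma> \<in> embs K"
begin

lemma emb_one: "\<sigma> 1 = 1"
  and emb_add: "x \<in> K \<Longrightarrow> y \<in> K \<Longrightarrow> \<sigma> (x + y) = \<sigma> x + \<sigma> y"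
  and emb_mult: "x \<in> K \<Longrightarrow> y \<in> K \<Longrightarrow> \<sigma> (x * y) = \<sigma> x * \<sigma> y"
  using \<sigma> by (auto simp: embs_def)

lemma emb_zero: "\<sigma> 0 = 0"
  using emb_add[of 0 0] subfield_zero[OF K] by simp

lemma emb_uminus: "x \<in> K \<Longrightarrow> \<sigma> (- x) = - \<sigma> x"
  using emb_add[of x "- x"] subfield_uminus[OF K] emb_zero by (simp add: add_eq_0_iff)

lemma emb_diff: "x \<in> K \<Longrightarrow> y \<in> K \<Longrightarrow> \<sigma> (x - y) = \<sigma> x - \<sigma> y"
  using emb_add[of x "- y"] emb_uminus[of y] subfield_uminus[OF K] by simp

lemma emb_sum: "(\<And>i. i \<in> I \<Longrightarrow> f i \<in> K) \<Longrightarrow> \<sigma> (\<Sum>i\<in>I. f i) = (\<Sum>i\<in>I. \<sigma> (f i))"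
  by (induction I rule: infinite_finite_induct) (simp_all add: emb_zero emb_add subfield_sum[OF K])

lemma emb_prod: "(\<And>i. i \<in> I \<Longrightarrow> f i \<in> K) \<Longrightarrow> \<sigma> (\<Prod>i\<in>I. f i) = (\<Prod>i\<in>I. \<sigma> (f i))"
  by (induction I rule: infinite_finite_induct) (simp_all add: emb_one emb_mult subfield_prod[OF K])

lemma emb_power: "x \<in> K \<Longrightarrow> \<sigma> (x ^ n) = \<sigma> x ^ n"
  by (induction n) (simp_all add: emb_one emb_mult subfield_power[OF K])

lemma emb_eq_0_iff:
  assumes "x \<in> K" shows "\<sigma> x = 0 \<longleftrightarrow> x = 0"
proof
  assume 0: "\<sigma> x = 0"
  show "x = 0"
  proof (rule ccontr)
    assume "x \<noteq> 0"
    hence "1 = \<sigma> (x * inverse x)" by (simp add: emb_one)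
    also have "\<dots> = 0" using 0 assms by (simp add: emb_mult subfield_inverse[OF K])
    finally show False by simp
  qed
qed (simp add: emb_zero)

lemma emb_inverse:
  assumes "x \<in> K" shows "\<sigma> (inverse x) = inverse (\<sigma> x)"
proof (cases "x = 0")
  case False
  hence "\<sigma> x * \<sigma> (inverse x) = 1"
    using emb_mult[OF assms subfield_inverse[OF K assms]] by (simp add: emb_one)
  thus ?thesis by (simp add: inverse_unique)
qed (simp add: emb_zero)

lemma emb_eq_iff: "x \<in> K \<Longrightarrow> y \<in> K \<Longrightarrow> \<sigma> x = \<sigma> y \<longleftrightarrow> x = y"
  using emb_eq_0_iff[of "x - y"] by (simp add: emb_diff subfield_diff[OF K])

lemma emb_of_nat: "\<sigma> (of_nat n) = of_nat n"
  by (induction n) (simp_all add: emb_zero emb_one emb_add subfield_of_nat[OF K] subfield_one[OF K])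

lemma emb_of_int: "\<sigma> (of_int n) = of_int n"
proof (cases n rule: int_cases2)
  case (nonpos m)
  thus ?thesis by (simp add: emb_uminus emb_of_nat subfield_of_nat[OF K])
qed (simp add: emb_of_nat)

lemma emb_of_rat: "\<sigma> (of_rat q) = of_rat q"
proof (cases q)
  case (Fract a b)
  have "\<sigma> (of_int a * inverse (of_int b)) = of_int a * inverse (of_int b)"
    by (simp add: emb_mult emb_inverse emb_of_int subfield_of_int[OF K] subfield_inverse[OF K])
  thus ?thesis using Fract by (simp add: of_rat_rat divide_inverse)
qed

lemma emb_fdet:
  assumes "\<And>i j. i < n \<Longrightarrow> j < n \<Longrightarrow> f i j \<in> K"
  shows "fdet n f \<in> K" and "\<sigma> (fdet n f) = fdet n (\<lambda>i j. \<sigma> (f i j))"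
proof -
  have p: "f i (p i) \<in> K" if "p permutes {0..<n}" "i \<in> {0..<n}" for p i
    using permutes_in_image[OF that(1), of i] that(2) assms by simp
  show "fdet n f \<in> K" unfolding fdet_leibniz
    by (intro subfield_sum[OF K] subfield_mult[OF K] subfield_prod[OF K] subfield_of_int[OF K]) (use p in auto)
  show "\<sigma> (fdet n f) = fdet n (\<lambda>i j. \<sigma> (f i j))" unfolding fdet_leibniz
  proof (subst emb_sum)
    show "of_int (sign i) * (\<Prod>ia = 0..<n. f ia (i ia)) \<in> K" if "i \<in> {p. p permutes {0..<n}}" for i
      using that by (intro subfield_mult[OF K] subfield_prod[OF K] subfield_of_int[OF K]) (use p in auto)
    show "(\<Sum>i | i permutes {0..<n}. \<sigma> (of_int (sign i) * (\<Prod>ia = 0..<n. f ia (i ia)))) 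
        = (\<Sum>p | p permutes {0..<n}. of_int (sign p) * (\<Prod>i = 0..<n. \<sigma> (f i (p i))))"
    proof (intro sum.cong refl)
      fix q assume "q \<in> {p. p permutes {0..<n}}"
      hence q: "f i (q i) \<in> K" if "i \<in> {0..<n}" for i using that p by blast
      have "\<sigma> (of_int (sign q) * (\<Prod>i = 0..<n. f i (q i))) = \<sigma> (of_int (sign q)) * \<sigma> (\<Prod>i = 0..<n. f i (q i))"
        by (intro emb_mult subfield_of_int[OF K] subfield_prod[OF K] q)
      also have "\<sigma> (\<Prod>i = 0..<n. f i (q i)) = (\<Prod>i = 0..<n. \<sigma> (f i (q i)))" by (rule emb_prod[OF q])
      finally show "\<sigma> (of_int (sign q) * (\<Prod>i = 0..<n. f i (q i))) = of_int (sign q) * (\<Prod>i = 0..<n. \<sigma> (f i (q i)))"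
        by (simp add: emb_of_int)
    qed
  qed
qed

end

lemma restrict_emb:
  assumes "k \<subseteq> l" "subfield k ambient" "\<tau> \<in> embs l"
  shows "restrict \<tau> k \<in> embs k"
  using assms subfield_add[OF assms(2)] subfield_mult[OF assms(2)] subfield_one[OF assms(2)]
  by (auto simp: embs_def subset_iff)

text \<open>Artin's independence of characters. Subtracting \<open>\<sigma> y\<close> times the
  relation at \<open>x\<close> from the relation at \<open>y * x\<close> removes
  \<open>\<sigma>\<close>, and \<open>y\<close> is chosen such that the term of a given
  \<open>\<tau>\<close> survives.\<close>

lemma embs_independent:
  assumes K: "subfield K ambient" and "finite T" and "T \<subseteq> embs K"
    and "\<And>x. x \<in> K \<Longrightarrow> (\<Sum>\<tau>\<in>T. c \<tau> * \<tau> x) = 0" and "\<tau> \<in> T"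
  shows "c \<tau> = 0"
  using assms(2-)
proof (induction T arbitrary: c \<tau> rule: finite_induct)
  case (insert \<sigma> T)
  have \<sigma>: "\<sigma> \<in> embs K" and T: "T \<subseteq> embs K" using insert.prems(1) by auto
  have rel: "c \<sigma> * \<sigma> x + (\<Sum>\<tau>\<in>T. c \<tau> * \<tau> x) = 0" if "x \<in> K" for x
    using insert.prems(2)[OF that] insert.hyps by simp
  have T0: "c \<tau> = 0" if \<tau>: "\<tau> \<in> T" for \<tau>
  proof -
    have "\<tau> \<in> embs K" "\<tau> \<noteq> \<sigma>" using \<tau> T insert.hyps by auto
    then obtain y where y: "y \<in> K" "\<tau> y \<noteq> \<sigma> y" using embs_eqI[OF _ \<sigma>, of \<tau>] by blast
    have "(\<Sum>\<tau>\<in>T. (c \<tau> * (\<tau> y - \<sigma> y)) * \<tau> x) = 0" if x: "x \<in> K" for x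
    proof -
      define A where "A = (\<Sum>\<tau>\<in>T. c \<tau> * \<tau> y * \<tau> x)"
      define B where "B = (\<Sum>\<tau>\<in>T. c \<tau> * \<tau> x)"
      have "(\<Sum>\<tau>\<in>T. c \<tau> * \<tau> (y * x)) = A" unfolding A_def
        by (intro sum.cong refl) (use T in \<open>auto simp: emb_mult[OF K _ y(1) x]\<close>)
      hence 1: "c \<sigma> * (\<sigma> y * \<sigma> x) + A = 0"
        using rel[OF subfield_mult[OF K y(1) x]] by (simp add: emb_mult[OF K \<sigma> y(1) x])
      have 2: "c \<sigma> * \<sigma> x + B = 0" using rel[OF x] by (simp add: B_def)
      have "(\<Sum>\<tau>\<in>T. (c \<tau> * (\<tau> y - \<sigma> y)) * \<tau> x) = (\<Sum>\<tau>\<in>T. c \<tau> * \<tau> y * \<tau> x - \<sigma> y * (c \<tau> * \<tau> x))"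
        by (intro sum.cong) (auto simp: algebra_simps)
      also have "\<dots> = A - \<sigma> y * B" by (simp add: A_def B_def sum_subtractf sum_distrib_left)
      also have "\<dots> = (c \<sigma> * (\<sigma> y * \<sigma> x) + A) - \<sigma> y * (c \<sigma> * \<sigma> x + B)" by (simp add: algebra_simps)
      also have "\<dots> = 0" unfolding 1 2 by simp
      finally show ?thesis .
    qed
    from insert.IH[OF T this \<tau>] show ?thesis using y(2) by simp
  qed
  hence "c \<sigma> * \<sigma> 1 = 0" using rel[OF subfield_one[OF K]] by simp
  hence "c \<sigma> = 0" using emb_one[OF K \<sigma>] by simp
  thus ?case using T0 insert.prems(3) by auto
qed simp

lemma ext_emb_of_basis_comb:
  assumes k: "subfield k ambient" and l: "subfield l ambient" and kl: "k \<subseteq> l"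
    and bs: "field_basis k l bs" and \<tau>: "\<tau> \<in> ext_embs l k \<sigma>"
    and c: "\<And>i. i < length bs \<Longrightarrow> c i \<in> k"
  shows "\<tau> (\<Sum>i<length bs. c i * bs ! i) = (\<Sum>i<length bs. \<sigma> (c i) * \<tau> (bs ! i))"
proof -
  have \<tau>': "\<tau> \<in> embs l" "\<And>x. x \<in> k \<Longrightarrow> \<tau> x = \<sigma> x" using \<tau> by (auto simp: ext_embs_def)
  have cl: "c i \<in> l" "bs ! i \<in> l" if "i < length bs" for i
    using c[OF that] kl field_basis_mem[OF bs that] by auto
  have "\<tau> (\<Sum>i<length bs. c i * bs ! i) = (\<Sum>i<length bs. \<tau> (c i * bs ! i))"
    by (rule emb_sum[OF l \<tau>'(1)]) (use cl subfield_mult[OF l] in auto)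
  also have "\<dots> = (\<Sum>i<length bs. \<sigma> (c i) * \<tau> (bs ! i))"
    by (intro sum.cong refl) (use cl c \<tau>'(2) in \<open>auto simp: emb_mult[OF l \<tau>'(1)]\<close>)
  finally show ?thesis .
qed

text \<open>All \<open>t i\<close> agree with \<open>\<sigma>\<close> on \<open>k\<close>, so a
  relation that holds on a \<open>k\<close>-basis extends to all of \<open>l\<close>, where
  independence of embeddings applies. This is what makes the matrix of conjugates of a basis
  nonsingular.\<close>

lemma ext_embs_vanish:
  fixes m :: nat
  assumes k: "subfield k ambient" and l: "subfield l ambient" and kl: "k \<subseteq> l"
    and bs: "field_basis k l bs" and t: "\<And>i. i < m \<Longrightarrow> t i \<in> ext_embs l k \<sigma>"
    and inj: "inj_on t {..<m}"
    and c: "\<And>j. j < length bs \<Longrightarrow> (\<Sum>i<m. t i (bs ! j) * c i) = 0" and "i < m"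
  shows "c i = 0"
proof -
  define d where "d = (\<lambda>\<tau>. c (the_inv_into {..<m} t \<tau>))"
  have d: "d (t i) = c i" if "i < m" for i
    using the_inv_into_f_f[OF inj] that by (simp add: d_def)
  have "(\<Sum>\<tau>\<in>t ` {..<m}. d \<tau> * \<tau> x) = 0" if x: "x \<in> l" for x
  proof -
    obtain a where a: "\<And>i. i < length bs \<Longrightarrow> a i \<in> k" "x = (\<Sum>i<length bs. a i * bs ! i)"
      using field_basis_spans[OF bs x] by blast
    have "(\<Sum>\<tau>\<in>t ` {..<m}. d \<tau> * \<tau> x) = (\<Sum>i<m. c i * t i x)"
      by (simp add: sum.reindex[OF inj] d)
    also have "\<dots> = (\<Sum>i<m. \<Sum>j<length bs. \<sigma> (a j) * (t i (bs ! j) * c i))"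
    proof (intro sum.cong refl)
      fix i assume "i \<in> {..<m}"
      hence "t i \<in> ext_embs l k \<sigma>" using t by simp
      thus "c i * t i x = (\<Sum>j<length bs. \<sigma> (a j) * (t i (bs ! j) * c i))"
        unfolding a(2) using ext_emb_of_basis_comb[OF k l kl bs, of "t i" \<sigma> a] a(1)
        by (simp add: sum_distrib_left mult_ac)
    qed
    also have "\<dots> = (\<Sum>j<length bs. \<Sum>i<m. \<sigma> (a j) * (t i (bs ! j) * c i))" by (rule sum.swap)
    also have "\<dots> = (\<Sum>j<length bs. \<sigma> (a j) * (\<Sum>i<m. t i (bs ! j) * c i))"
      by (simp add: sum_distrib_left)
    also have "\<dots> = 0" using c by simp
    finally show ?thesis .
  qed
  moreover have "t ` {..<m} \<subseteq> embs l" using t by (auto simp: ext_embs_def)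
  moreover have "finite (t ` {..<m})" "t i \<in> t ` {..<m}" using \<open>i < m\<close> by simp_all
  ultimately have "d (t i) = 0" by (intro embs_independent[OF l, of "t ` {..<m}" d "t i"])
  thus ?thesis using d \<open>i < m\<close> by simp
qed

text \<open>With more embeddings than basis elements the system on the basis is underdetermined, and
  a nontrivial solution contradicts \<open>ext_embs_vanish\<close>. Applied to finite subsets, the
  same bound gives finiteness.\<close>

lemma card_ext_embs_le:
  assumes k: "subfield k ambient" and l: "subfield l ambient" and kl: "k \<subseteq> l"
    and bs: "field_basis k l bs"
  shows "finite (ext_embs l k \<sigma>)" and "card (ext_embs l k \<sigma>) \<le> length bs"
proof -
  have *: "card T \<le> length bs" if T: "finite T" "T \<subseteq> ext_embs l k \<sigma>" for T
  proof (rule ccontr)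
    assume "\<not> card T \<le> length bs"
    obtain t where t: "bij_betw t {0..<card T} T" using ex_bij_betw_nat_finite[OF T(1)] by blast
    obtain c where c: "\<exists>j<card T. c j \<noteq> 0" "\<forall>j<length bs. (\<Sum>i<card T. t i (bs ! j) * c i) = 0"
      using underdetermined_system[of "length bs" "card T" "\<lambda>j i. t i (bs ! j)"] \<open>\<not> card T \<le> length bs\<close> by auto
    have "c i = 0" if "i < card T" for i
    proof (rule ext_embs_vanish[OF k l kl bs, of "card T" t \<sigma> c])
      show "t i \<in> ext_embs l k \<sigma>" if "i < card T" for i using bij_betw_apply[OF t] T(2) that by auto
      show "inj_on t {..<card T}" using t by (simp add: bij_betw_def atLeast0LessThan)
    qed (use c that in auto)
    thus False using c(1) by blast
  qed
  show fin: "finite (ext_embs l k \<sigma>)"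
  proof (rule ccontr)
    assume "infinite (ext_embs l k \<sigma>)"
    then obtain T where "finite T" "card T = Suc (length bs)" "T \<subseteq> ext_embs l k \<sigma>"
      using infinite_arbitrarily_large by blast
    thus False using *[of T] by simp
  qed
  show "card (ext_embs l k \<sigma>) \<le> length bs" by (rule *[OF fin]) simp
qed

section \<open>Extending embeddings\<close>

lemma card_simple_roots:
  fixes q :: "complex poly"
  assumes "\<And>z. poly q z = 0 \<Longrightarrow> poly (pderiv q) z \<noteq> 0"
  shows "card {z. poly q z = 0} = Polynomial.degree q"
proof -
  have "rsquarefree q" using assms by (auto simp: rsquarefree_roots)
  hence q: "smult (Polynomial.lead_coeff q) (\<Prod>z | poly q z = 0. [:- z, 1:]) = q" "q \<noteq> 0"
    using complex_poly_decompose_rsquarefree[of q] by (auto simp: rsquarefree_def)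
  have "Polynomial.degree q = Polynomial.degree (\<Prod>z | poly q z = 0. [:- z, 1:])"
    using q by (metis degree_smult_eq leading_coeff_0_iff)
  also have "\<dots> = (\<Sum>z | poly q z = 0. Polynomial.degree [:- z, 1:])"
    by (rule degree_prod_eq_sum_degree) auto
  finally show ?thesis by simp
qed

text \<open>Describes F = k(a) by its power basis and the reduction rule for \<open>a ^ n\<close>.
  The coefficients \<open>r\<close> encode the minimal polynomial, so that no polynomials over the
  subfield \<open>k\<close> appear.\<close>

locale power_basis =
  fixes k F :: "'a::field_char_0 set" and a :: 'a and n :: nat and r :: "nat \<Rightarrow> 'a"
  assumes k: "subfield k ambient" and F: "subfield F ambient" and kF: "k \<subseteq> F" and aF: "a \<in> F"
    and n: "n > 0"
    and indep: "\<And>c i. (\<And>i. i < n \<Longrightarrow> c i \<in> k) \<Longrightarrow> (\<Sum>i<n. c i * a ^ i) = 0 \<Longrightarrow> i < n \<Longrightarrow> c i = 0"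
    and span: "\<And>x. x \<in> F \<Longrightarrow> \<exists>c. (\<forall>i<n. c i \<in> k) \<and> x = (\<Sum>i<n. c i * a ^ i)"
    and r: "\<And>i. i < n \<Longrightarrow> r i \<in> k" and an: "a ^ n = (\<Sum>i<n. r i * a ^ i)"
begin

definition coord :: "'a \<Rightarrow> nat \<Rightarrow> 'a" where
  "coord x = (SOME c. (\<forall>i<n. c i \<in> k) \<and> x = (\<Sum>i<n. c i * a ^ i))"

lemma coord:
  assumes "x \<in> F"
  shows "\<And>i. i < n \<Longrightarrow> coord x i \<in> k" and "x = (\<Sum>i<n. coord x i * a ^ i)"
  using someI_ex[OF span[OF assms]] unfolding coord_def by auto

lemma comb_in_F: "(\<And>i. i < n \<Longrightarrow> c i \<in> k) \<Longrightarrow> (\<Sum>i<n. c i * a ^ i) \<in> F"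
  by (intro subfield_sum[OF F] subfield_mult[OF F] subfield_power[OF F] aF) (use kF in auto)

lemma coord_unique:
  assumes "\<And>i. i < n \<Longrightarrow> c i \<in> k" "x = (\<Sum>i<n. c i * a ^ i)" "i < n"
  shows "coord x i = c i"
proof -
  have x: "x \<in> F" using assms(2) comb_in_F[OF assms(1)] by simp
  have "(\<Sum>i<n. (coord x i - c i) * a ^ i) = (\<Sum>i<n. coord x i * a ^ i) - (\<Sum>i<n. c i * a ^ i)"
    by (simp add: left_diff_distrib sum_subtractf)
  also have "\<dots> = 0" using assms(2) coord(2)[OF x] by simp
  finally have "(\<Sum>i<n. (coord x i - c i) * a ^ i) = 0" .
  hence "coord x i - c i = 0"
    using indep[of "\<lambda>i. coord x i - c i" i] coord(1)[OF x] assms subfield_diff[OF k] by simp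
  thus ?thesis by simp
qed

lemma coord_add:
  assumes "x \<in> F" "y \<in> F" "i < n" shows "coord (x + y) i = coord x i + coord y i"
proof (rule coord_unique[of "\<lambda>i. coord x i + coord y i"])
  show "x + y = (\<Sum>i<n. (coord x i + coord y i) * a ^ i)"
    using coord(2)[OF assms(1)] coord(2)[OF assms(2)] by (simp add: distrib_right sum.distrib)
qed (use coord(1) assms subfield_add[OF k] in auto)

lemma coord_scale:
  assumes "u \<in> k" "x \<in> F" "i < n" shows "coord (u * x) i = u * coord x i"
proof (rule coord_unique[of "\<lambda>i. u * coord x i"])
  have "u * x = u * (\<Sum>i<n. coord x i * a ^ i)" using coord(2)[OF assms(2)] by simp
  thus "u * x = (\<Sum>i<n. (u * coord x i) * a ^ i)" by (simp add: sum_distrib_left mult.assoc)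
qed (use coord(1) assms subfield_mult[OF k] in auto)

text \<open>Replaces \<open>a\<close> by \<open>z\<close> in the power-basis expansion and applies
  \<open>\<sigma>\<close> to the coefficients. This is the extension of \<open>\<sigma>\<close> with
  \<open>a\<close> sent to \<open>z\<close> whenever \<open>z\<close> is a root of the image of the
  minimal polynomial.\<close>

definition emb_at :: "('a \<Rightarrow> complex) \<Rightarrow> complex \<Rightarrow> 'a \<Rightarrow> complex" where
  "emb_at \<sigma> z = restrict (\<lambda>x. \<Sum>i<n. \<sigma> (coord x i) * z ^ i) F"

lemma sum_shift:
  fixes g :: "nat \<Rightarrow> 'b::comm_monoid_add"
  shows "(\<Sum>i<n. if i = 0 then 0 else g (i - 1)) + g (n - 1) = (\<Sum>i<n. g i)"
proof -
  obtain m where m: "n = Suc m" using n by (cases n) auto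
  show ?thesis unfolding m by (subst sum.lessThan_Suc_shift) simp
qed

context
  fixes \<sigma> :: "'a \<Rightarrow> complex" and z :: complex
  assumes \<sigma>: "\<sigma> \<in> embs k" and z: "z ^ n = (\<Sum>i<n. \<sigma> (r i) * z ^ i)"
begin

lemma emb_at_comb:
  assumes "\<And>i. i < n \<Longrightarrow> c i \<in> k"
  shows "emb_at \<sigma> z (\<Sum>i<n. c i * a ^ i) = (\<Sum>i<n. \<sigma> (c i) * z ^ i)"
  using comb_in_F[OF assms] coord_unique[OF assms refl] by (simp add: emb_at_def)

lemma emb_at_add: "x \<in> F \<Longrightarrow> y \<in> F \<Longrightarrow> emb_at \<sigma> z (x + y) = emb_at \<sigma> z x + emb_at \<sigma> z y"
  by (simp add: emb_at_def subfield_add[OF F] coord_add emb_add[OF k \<sigma>] coord(1) distrib_right sum.distrib)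

lemma emb_at_scale: "u \<in> k \<Longrightarrow> x \<in> F \<Longrightarrow> emb_at \<sigma> z (u * x) = \<sigma> u * emb_at \<sigma> z x"
  using kF by (auto simp: emb_at_def subfield_mult[OF F] subset_iff coord_scale emb_mult[OF k \<sigma>] coord(1) 
      sum_distrib_left mult.assoc)

text \<open>Multiplication by \<open>a\<close> shifts the coordinates and feeds the top one back
  through \<open>r\<close>, which gives the coordinates \<open>e\<close>; the root equation for
  \<open>z\<close> performs the same step in \<complex>. General multiplicativity follows by
  expanding one factor in powers of \<open>a\<close>.\<close>

lemma emb_at_gen_mult:
  assumes x: "x \<in> F" shows "emb_at \<sigma> z (a * x) = z * emb_at \<sigma> z x"
proof -
  define c where "c = coord x"
  have c: "c i \<in> k" if "i < n" for i using coord(1)[OF x that] by (simp add: c_def)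
  define e where "e = (\<lambda>i. (if i = 0 then 0 else c (i - 1)) + c (n - 1) * r i)"
  have e: "e i \<in> k" if "i < n" for i
    unfolding e_def using that c r n subfield_zero[OF k]
    by (intro subfield_add[OF k] subfield_mult[OF k]) auto
  have gen: "(\<Sum>i<n. (if i = 0 then 0 else u (i - 1)) * y ^ i) + u (n - 1) * y ^ n = y * (\<Sum>i<n. u i * y ^ i)"
    for u :: "nat \<Rightarrow> 'b::comm_ring_1" and y
  proof -
    have "(\<Sum>i<n. (if i = 0 then 0 else u (i - 1)) * y ^ i) = (\<Sum>i<n. if i = 0 then 0 else u (i - 1) * y ^ Suc (i - 1))"
      by (intro sum.cong) auto
    moreover have "u (n - 1) * y ^ n = u (n - 1) * y ^ Suc (n - 1)" using n by simp
    ultimately have "(\<Sum>i<n. (if i = 0 then 0 else u (i - 1)) * y ^ i) + u (n - 1) * y ^ n = (\<Sum>i<n. u i * y ^ Suc i)"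
      using sum_shift[of "\<lambda>i. u i * y ^ Suc i"] by simp
    also have "\<dots> = y * (\<Sum>i<n. u i * y ^ i)" by (simp add: sum_distrib_left mult_ac)
    finally show ?thesis .
  qed
  have "a * x = a * (\<Sum>i<n. c i * a ^ i)" using coord(2)[OF x] by (simp add: c_def)
  also have "\<dots> = (\<Sum>i<n. (if i = 0 then 0 else c (i - 1)) * a ^ i) + c (n - 1) * (\<Sum>i<n. r i * a ^ i)"
    unfolding an[symmetric] by (rule gen[symmetric])
  also have "\<dots> = (\<Sum>i<n. e i * a ^ i)"
    by (simp add: e_def distrib_right sum.distrib sum_distrib_left mult.assoc)
  finally have "emb_at \<sigma> z (a * x) = (\<Sum>i<n. \<sigma> (e i) * z ^ i)" using emb_at_comb[OF e] by simp
  also have "\<dots> = (\<Sum>i<n. (if i = 0 then 0 else \<sigma> (c (i - 1))) * z ^ i + \<sigma> (c (n - 1)) * (\<sigma> (r i) * z ^ i))"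
  proof (intro sum.cong refl)
    fix i assume "i \<in> {..<n}"
    hence i: "i < n" by simp
    have "\<sigma> (e i) = (if i = 0 then 0 else \<sigma> (c (i - 1))) + \<sigma> (c (n - 1)) * \<sigma> (r i)"
      unfolding e_def using i n c r subfield_zero[OF k] subfield_mult[OF k]
      by (auto simp: emb_add[OF k \<sigma>] emb_mult[OF k \<sigma>] emb_zero[OF k \<sigma>])
    thus "\<sigma> (e i) * z ^ i = (if i = 0 then 0 else \<sigma> (c (i - 1))) * z ^ i + \<sigma> (c (n - 1)) * (\<sigma> (r i) * z ^ i)"
      by (simp add: distrib_right mult.assoc)
  qed
  also have "\<dots> = (\<Sum>i<n. (if i = 0 then 0 else \<sigma> (c (i - 1))) * z ^ i) + \<sigma> (c (n - 1)) * z ^ n"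
    unfolding z by (simp add: sum.distrib sum_distrib_left)
  also have "\<dots> = z * (\<Sum>i<n. \<sigma> (c i) * z ^ i)" using gen[of "\<lambda>i. \<sigma> (c i)" z] by simp
  finally show ?thesis using x by (simp add: emb_at_def c_def)
qed

lemma emb_at_power_mult: "x \<in> F \<Longrightarrow> emb_at \<sigma> z (a ^ i * x) = z ^ i * emb_at \<sigma> z x"
  by (induction i) (simp_all add: mult.assoc emb_at_gen_mult subfield_mult[OF F] subfield_power[OF F] aF)

lemma emb_at_sum:
  assumes "\<And>i. i \<in> I \<Longrightarrow> f i \<in> F" shows "emb_at \<sigma> z (\<Sum>i\<in>I. f i) = (\<Sum>i\<in>I. emb_at \<sigma> z (f i))"
proof -
  have "emb_at \<sigma> z 0 = 0" using emb_at_add[of 0 0] subfield_zero[OF F] by simp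
  thus ?thesis using assms
    by (induction I rule: infinite_finite_induct) (simp_all add: emb_at_add subfield_sum[OF F])
qed

lemma emb_at_mult:
  assumes x: "x \<in> F" and y: "y \<in> F" shows "emb_at \<sigma> z (x * y) = emb_at \<sigma> z x * emb_at \<sigma> z y"
proof -
  have "x * y = (\<Sum>i<n. coord x i * a ^ i) * y" using coord(2)[OF x] by simp
  also have "\<dots> = (\<Sum>i<n. coord x i * (a ^ i * y))" by (simp add: sum_distrib_right mult.assoc)
  finally have "emb_at \<sigma> z (x * y) = (\<Sum>i<n. emb_at \<sigma> z (coord x i * (a ^ i * y)))"
    using emb_at_sum[of "{..<n}" "\<lambda>i. coord x i * (a ^ i * y)"] coord(1)[OF x] kF y aF
    by (auto simp: subfield_mult[OF F] subfield_power[OF F] subset_iff)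
  also have "\<dots> = (\<Sum>i<n. \<sigma> (coord x i) * (z ^ i * emb_at \<sigma> z y))"
    by (intro sum.cong refl) 
      (use coord(1)[OF x] y aF in \<open>auto simp: emb_at_scale emb_at_power_mult subfield_mult[OF F] subfield_power[OF F]\<close>)
  also have "\<dots> = emb_at \<sigma> z x * emb_at \<sigma> z y"
    using x by (simp add: emb_at_def sum_distrib_right mult.assoc)
  finally show ?thesis .
qed

lemma emb_at_base: assumes u: "u \<in> k" shows "emb_at \<sigma> z u = \<sigma> u"
proof -
  have eq: "(\<Sum>i<n. (if i = 0 then u else 0) * y i) = u * y 0" for u :: "'b::comm_ring_1" and y :: "nat \<Rightarrow> 'b"
  proof -
    have "(\<Sum>i<n. (if i = 0 then u else 0) * y i) = (\<Sum>i<n. if i = 0 then u * y i else 0)"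
      by (intro sum.cong) auto
    thus ?thesis using n by simp
  qed
  have "u = (\<Sum>i<n. (if i = 0 then u else 0) * a ^ i)" using eq[of u "\<lambda>i. a ^ i"] by simp
  hence "emb_at \<sigma> z u = (\<Sum>i<n. \<sigma> (if i = 0 then u else 0) * z ^ i)"
    using emb_at_comb[of "\<lambda>i. if i = 0 then u else 0"] u subfield_zero[OF k] by simp
  also have "\<dots> = (\<Sum>i<n. (if i = 0 then \<sigma> u else 0) * z ^ i)"
    by (intro sum.cong) (auto simp: emb_zero[OF k \<sigma>])
  also have "\<dots> = \<sigma> u" using eq[of "\<sigma> u" "\<lambda>i. z ^ i"] by simp
  finally show ?thesis .
qed

lemma emb_at_ext_embs: "emb_at \<sigma> z \<in> ext_embs F k \<sigma>"
  unfolding ext_embs_def embs_def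
  using emb_at_base emb_at_add emb_at_mult emb_one[OF k \<sigma>] subfield_one[OF k]
  by (auto simp: emb_at_def)

lemma emb_at_gen: "emb_at \<sigma> z a = z"
  using emb_at_gen_mult[of 1] emb_at_base[of 1] emb_one[OF k \<sigma>] subfield_one[OF k] subfield_one[OF F] by simp

text \<open>
  The roots of the minimal polynomial \<open>p\<close> are simple: \<open>p'(z)\<close> is the image of \<open>p'(a)\<close>, which is
  nonzero because it has degree \<open>n - 1\<close> in \<open>a\<close>.
\<close>

lemma derivative_nonzero: "of_nat n * z ^ (n - 1) \<noteq> (\<Sum>i<n. of_nat i * \<sigma> (r i) * z ^ (i - 1))"
proof
  assume eq: "of_nat n * z ^ (n - 1) = (\<Sum>i<n. of_nat i * \<sigma> (r i) * z ^ (i - 1))"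
  obtain m where m: "n = Suc m" using n by (cases n) auto
  \<comment> \<open>Coefficients of p'(a) in the power basis; the top one is \<open>n\<close>,
    nonzero in characteristic 0.\<close>
  define c where "c = (\<lambda>i. if i = m then of_nat n else - (of_nat (Suc i) * r (Suc i)))"
  have c: "c i \<in> k" if "i < n" for i
    unfolding c_def using that r m
    by (auto intro!: subfield_of_nat[OF k] subfield_uminus[OF k] subfield_mult[OF k] simp del: of_nat_Suc)
  have "(\<Sum>i<n. \<sigma> (c i) * z ^ i) = of_nat n * z ^ m - (\<Sum>i<m. of_nat (Suc i) * \<sigma> (r (Suc i)) * z ^ i)"
  proof -
    have "\<sigma> (c i) = - (of_nat (Suc i) * \<sigma> (r (Suc i)))" if "i < m" for i
      using that r[of "Suc i"] m unfolding c_def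
      by (simp add: emb_uminus[OF k \<sigma>] emb_mult[OF k \<sigma>] emb_of_nat[OF k \<sigma>] subfield_of_nat[OF k] subfield_mult[OF k] del: of_nat_Suc)
    moreover have "\<sigma> (c m) = of_nat n" by (simp add: c_def emb_of_nat[OF k \<sigma>])
    ultimately show ?thesis unfolding m by (simp add: sum_negf del: of_nat_Suc)
  qed
  also have "(\<Sum>i<m. of_nat (Suc i) * \<sigma> (r (Suc i)) * z ^ i) = (\<Sum>i<n. of_nat i * \<sigma> (r i) * z ^ (i - 1))"
    unfolding m by (subst sum.lessThan_Suc_shift) simp
  also have "of_nat n * z ^ m - \<dots> = 0" using eq m by simp
  finally have "emb_at \<sigma> z (\<Sum>i<n. c i * a ^ i) = 0" using emb_at_comb[OF c] by simp
  hence "(\<Sum>i<n. c i * a ^ i) = 0"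
    using emb_eq_0_iff[OF F, of "emb_at \<sigma> z"] emb_at_ext_embs comb_in_F[OF c] by (simp add: ext_embs_def)
  hence "c m = 0" using indep[of c m] c m by simp
  thus False using m by (simp add: c_def del: of_nat_Suc)
qed

end

text \<open>Distinct roots \<open>z\<close> give distinct embeddings, because
  \<open>emb_at \<sigma> z\<close> takes \<open>a\<close> to \<open>z\<close>. The image of the
  minimal polynomial has only simple roots, hence \<open>n\<close> of them.\<close>

lemma card_ext_embs_ge:
  assumes \<sigma>: "\<sigma> \<in> embs k" and fin: "finite (ext_embs F k \<sigma>)"
  shows "n \<le> card (ext_embs F k \<sigma>)"
proof -
  define q where "q = Polynomial.monom 1 n - (\<Sum>i<n. Polynomial.monom (\<sigma> (r i)) i)"
  have root: "poly q z = 0 \<longleftrightarrow> z ^ n = (\<Sum>i<n. \<sigma> (r i) * z ^ i)" for z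
    by (simp add: q_def poly_monom poly_sum)
  have "poly (pderiv q) z \<noteq> 0" if "poly q z = 0" for z
    using derivative_nonzero[OF \<sigma> that[unfolded root]]
    by (simp add: q_def pderiv_diff pderiv_sum pderiv_monom poly_monom poly_sum)
  hence "card {z. poly q z = 0} = Polynomial.degree q" by (rule card_simple_roots)
  moreover have "Polynomial.degree q = n"
  proof -
    have "Polynomial.degree (\<Sum>i<n. Polynomial.monom (\<sigma> (r i)) i) \<le> n - 1"
      by (rule degree_sum_le) (auto intro: order.trans[OF degree_monom_le])
    hence "Polynomial.degree (- (\<Sum>i<n. Polynomial.monom (\<sigma> (r i)) i)) < Polynomial.degree (Polynomial.monom (1::complex) n)"
      using n by (simp add: degree_monom_eq)
    thus ?thesis unfolding q_def using degree_add_eq_left[of "- (\<Sum>i<n. Polynomial.monom (\<sigma> (r i)) i)" "Polynomial.monom 1 n"]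
      by (simp add: degree_monom_eq)
  qed
  ultimately have "n = card {z. poly q z = 0}" by simp
  also have "\<dots> \<le> card (ext_embs F k \<sigma>)"
  proof (rule card_inj_on_le[OF _ _ fin])
    show "inj_on (emb_at \<sigma>) {z. poly q z = 0}"
    proof (rule inj_onI)
      fix x y assume "x \<in> {z. poly q z = 0}" "y \<in> {z. poly q z = 0}" and eq: "emb_at \<sigma> x = emb_at \<sigma> y"
      hence xy: "poly q x = 0" "poly q y = 0" by simp_all
      show "x = y" using emb_at_gen[OF \<sigma> iffD1[OF root xy(1)]] emb_at_gen[OF \<sigma> iffD1[OF root xy(2)]] eq
        by metis
    qed
    show "emb_at \<sigma> ` {z. poly q z = 0} \<subseteq> ext_embs F k \<sigma>"
    proof safe
      fix x assume "poly q x = 0"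
      thus "emb_at \<sigma> x \<in> ext_embs F k \<sigma>" by (rule emb_at_ext_embs[OF \<sigma> iffD1[OF root]])
    qed
  qed
  finally show ?thesis .
qed

end

lemma simple_extension_power_basis:
  fixes k l :: "'a::field_char_0 set"
  assumes k: "subfield k ambient" and l: "subfield l ambient" and kl: "k \<subseteq> l"
    and fin: "ring.finite_dimension ambient k l" and a: "a \<in> l"
  obtains n r where "power_basis k (ring.simple_extension ambient k a) a n r"
    "ring.dimension ambient n k (ring.simple_extension ambient k a)"
    "subfield (ring.simple_extension ambient k a) ambient"
    "ring.simple_extension ambient k a \<subseteq> l"
proof -
  let ?F = "amb.simple_extension k a"
  have alg: "(amb.algebraic over k) a"
    by (rule amb.finite_dimension_imp_algebraic[OF k subfieldE(1)[OF l] fin a])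
  have F: "subfield ?F ambient" using amb.simple_extension_is_subfield[OF k, of a] alg by simp
  define n where "n = Polynomials.degree (amb.Irr k a)"
  have dim: "amb.dimension n k ?F"
    unfolding n_def by (rule amb.dimension_simple_extension[OF k _ alg]) simp
  have kF: "k \<subseteq> ?F" by (rule amb.simple_extension_incl) auto
  have aF: "a \<in> ?F" by (rule amb.simple_extension_mem[OF subfieldE(1)[OF k]]) simp
  have Fl: "?F \<subseteq> l" by (rule amb.simple_extension_subring_incl[OF subfieldE(1)[OF l] kl a])
  let ?bs = "amb.exp_base a n"
  have fb: "field_basis k ?F ?bs"
  proof (rule field_basis_if_independent_Span[OF k])
    show "amb.independent k ?bs" unfolding n_def by (rule amb.exp_base_independent[OF k _ alg]) simp
    show "amb.Span k ?bs = ?F" unfolding n_def by (rule amb.Span_exp_base[OF k _ alg]) simp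
  qed
  have len: "length ?bs = n" by (simp add: amb.exp_base_def)
  have nth: "?bs ! i = a ^ (n - Suc i)" if "i < n" for i
    using that by (simp add: amb.exp_base_def rev_nth)
  \<comment> \<open>\<open>exp_base\<close> lists the powers of \<open>a\<close> in descending
    order, so the coefficients have to be reversed.\<close>
  have reindex: "(\<Sum>i<n. c i * ?bs ! i) = (\<Sum>i<n. c (n - Suc i) * a ^ i)" for c
  proof -
    have "(\<Sum>i<n. c i * ?bs ! i) = (\<Sum>i<n. c (n - Suc (n - Suc i)) * a ^ (n - Suc i))"
      by (intro sum.cong) (auto simp: nth Suc_diff_Suc)
    also have "\<dots> = (\<Sum>i<n. c (n - Suc i) * a ^ i)" by (rule sum.nat_diff_reindex)
    finally show ?thesis .
  qed
  have indep: "c i = 0" if c: "\<And>i. i < n \<Longrightarrow> c i \<in> k" "(\<Sum>i<n. c i * a ^ i) = 0" "i < n" for c i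
  proof -
    let ?c = "\<lambda>i. c (n - Suc i)"
    have "(\<Sum>i<n. ?c i * ?bs ! i) = (\<Sum>i<n. c i * a ^ i)"
      unfolding reindex by (intro sum.cong) (auto simp: Suc_diff_Suc)
    hence "?c (n - Suc i) = 0"
      using field_basis_independent[OF fb, of ?c "n - Suc i"] c len by simp
    thus ?thesis using c(3) by (simp add: Suc_diff_Suc)
  qed
  have span: "\<exists>c. (\<forall>i<n. c i \<in> k) \<and> x = (\<Sum>i<n. c i * a ^ i)" if x: "x \<in> ?F" for x
  proof -
    obtain c where c: "\<And>i. i < length ?bs \<Longrightarrow> c i \<in> k" "x = (\<Sum>i<length ?bs. c i * ?bs ! i)"
      using field_basis_spans[OF fb x] by blast
    show ?thesis using c reindex[of c] len by (intro exI[of _ "\<lambda>i. c (n - Suc i)"]) simp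
  qed
  have n: "n > 0"
  proof (rule ccontr)
    assume "\<not> n > 0"
    hence "1 = (0::'a)" using span[OF subfield_one[OF F]] by simp
    thus False by simp
  qed
  obtain r where r: "\<forall>i<n. r i \<in> k" "a ^ n = (\<Sum>i<n. r i * a ^ i)"
    using span[OF subfield_power[OF F aF, of n]] by blast
  have "power_basis k ?F a n r"
    by (rule power_basis.intro[OF k F kF aF n]) (use indep span r in blast)+
  thus ?thesis using that dim F Fl by blast
qed

text \<open>A list that spans \<open>l\<close> over \<open>k\<close> also spans it over the larger
  field \<open>F\<close>, and can be thinned to a basis.\<close>

lemma intermediate_field_basis:
  fixes k F l :: "'a::field_char_0 set"
  assumes k: "subfield k ambient" and F: "subfield F ambient" and l: "subfield l ambient"
    and kF: "k \<subseteq> F" and Fl: "F \<subseteq> l" and bs: "ring.Span ambient k bs = l"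
  obtains Vs where "ring.independent ambient F Vs" "ring.Span ambient F Vs = l"
proof -
  have bsl: "set bs \<subseteq> l" using amb.Span_base_incl[OF k, of bs] unfolding bs by simp
  have "amb.Span F bs = l"
  proof (rule antisym)
    have sub: "subgroup l (add_monoid ambient)" by (rule subring.axioms(1)[OF subfieldE(1)[OF l]])
    have "F <#>\<^bsub>ambient\<^esub> set bs \<subseteq> l"
      using Fl bsl subfield_mult[OF l] by (auto simp: set_mult_def subset_iff)
    thus "amb.Span F bs \<subseteq> l" by (intro amb.Span_min[OF F _ sub]) auto
    show "l \<subseteq> amb.Span F bs"
    proof
      fix x assume "x \<in> l"
      then obtain Ks where "set Ks \<subseteq> k" "length Ks = length bs" "x = amb.combine Ks bs"
        using amb.Span_mem_iff_length_version[OF k, of bs x] unfolding bs by auto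
      thus "x \<in> amb.Span F bs"
        using kF by (intro amb.Span_mem_iff_length_version[OF F, THEN iffD2] exI[of _ Ks]) auto
    qed
  qed
  moreover obtain Vs where "amb.independent F Vs" "amb.Span F Vs = amb.Span F bs"
    using amb.filter_base[OF F, of bs] by auto
  ultimately show ?thesis using that by simp
qed

text \<open>
  An embedding extends to \<open>k(a)\<close> in as many ways as the minimal polynomial of \<open>a\<close> has roots;
  the remaining extension has smaller degree.
\<close>

lemma dimension_le_card_ext_embs:
  fixes k l :: "'a::field_char_0 set"
  assumes "subfield k ambient" "subfield l ambient" "k \<subseteq> l" "ring.dimension ambient n k l" "\<sigma> \<in> embs k"
  shows "n \<le> card (ext_embs l k \<sigma>)"
  using assms
proof (induction n arbitrary: k \<sigma> rule: less_induct)
  case (less n)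
  note k = less.prems(1) and l = less.prems(2) and kl = less.prems(3) and dim = less.prems(4)
  note \<sigma> = less.prems(5)
  obtain bs where bs: "amb.independent k bs" "length bs = n" "amb.Span k bs = l"
    using amb.exists_base[OF k dim] by blast
  have fb: "field_basis k l bs" by (rule field_basis_if_independent_Span[OF k bs(1,3)])
  show ?case
  proof (cases "l = k")
    case True
    have "amb.dimension 1 k l" using amb.dimension_one[OF k] True by simp
    hence "n = 1" using amb.dimension_is_inj[OF k dim] by blast
    moreover have "ext_embs l k \<sigma> = {\<sigma>}"
      using \<sigma> True by (auto simp: ext_embs_def intro: embs_eqI)
    ultimately show ?thesis by simp
  next
    case False
    then obtain a where a: "a \<in> l" "a \<notin> k" using kl by blast
    have fin: "amb.finite_dimension k l" by (rule amb.finite_dimensionI[OF dim])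
    define F where "F = amb.simple_extension k a"
    obtain m r where pb: "power_basis k F a m r" and dimF: "amb.dimension m k F"
      and F: "subfield F ambient" "F \<subseteq> l"
      using simple_extension_power_basis[OF k l kl fin a(1)] unfolding F_def by blast
    interpret pb: power_basis k F a m r by (rule pb)
    obtain Vs where Vs: "amb.independent F Vs" "amb.Span F Vs = l"
      using intermediate_field_basis[OF k F(1) l pb.kF F(2) bs(3)] .
    have dimV: "amb.dimension (length Vs) F l" using amb.dimensionI[OF F(1) Vs] .
    have "amb.dimension (m * length Vs) k l" by (rule amb.telescopic_base[OF k F(1) dimF dimV])
    hence n: "n = m * length Vs" using amb.dimension_is_inj[OF k dim] by blast
    \<comment> \<open>The degree over \<open>F\<close> drops properly because \<open>a\<close> is
      not in \<open>k\<close>; the induction hypothesis then applies to \<open>F\<close>.\<close>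
    have "m \<noteq> 1"
    proof
      assume "m = 1"
      hence "a \<in> k" using pb.span[OF pb.aF] by auto
      thus False using a(2) by simp
    qed
    hence m: "m > 1" using pb.n by linarith
    have "length Vs > 0"
    proof (rule ccontr)
      assume "\<not> length Vs > 0"
      hence "l = {0}" using Vs(2) by simp
      thus False using subfield_one[OF l] by simp
    qed
    hence lt: "length Vs < n" using m n by simp
    obtain cs where cs: "amb.independent k cs" "amb.Span k cs = F"
      using amb.exists_base[OF k dimF] by blast
    have finF: "finite (ext_embs F k \<sigma>)"
      by (rule card_ext_embs_le(1)[OF k F(1) pb.kF field_basis_if_independent_Span[OF k cs]])
    have finl: "finite (ext_embs l k \<sigma>)" by (rule card_ext_embs_le(1)[OF k l kl fb])
    have IH: "length Vs \<le> card (ext_embs l F \<rho>)" if "\<rho> \<in> ext_embs F k \<sigma>" for \<rho>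
      using less.IH[OF lt F(1) l F(2) dimV, of \<rho>] that by (simp add: ext_embs_def)
    have sub: "(\<Union>\<rho>\<in>ext_embs F k \<sigma>. ext_embs l F \<rho>) \<subseteq> ext_embs l k \<sigma>"
      using pb.kF by (fastforce simp: ext_embs_def)
    have "n \<le> card (ext_embs F k \<sigma>) * length Vs"
      using pb.card_ext_embs_ge[OF \<sigma> finF] n by simp
    also have "\<dots> = (\<Sum>\<rho>\<in>ext_embs F k \<sigma>. length Vs)" by simp
    also have "\<dots> \<le> (\<Sum>\<rho>\<in>ext_embs F k \<sigma>. card (ext_embs l F \<rho>))" by (intro sum_mono IH)
    \<comment> \<open>Embeddings of \<open>l\<close> with different restrictions to \<open>F\<close>
      are different, so the counts over the extensions to \<open>F\<close> add up.\<close>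
    also have "\<dots> = card (\<Union>\<rho>\<in>ext_embs F k \<sigma>. ext_embs l F \<rho>)"
    proof (rule card_UN_disjoint[symmetric, OF finF])
      show "\<forall>\<rho>\<in>ext_embs F k \<sigma>. finite (ext_embs l F \<rho>)"
      proof
        fix \<rho> assume "\<rho> \<in> ext_embs F k \<sigma>"
        hence "ext_embs l F \<rho> \<subseteq> ext_embs l k \<sigma>" using sub by blast
        thus "finite (ext_embs l F \<rho>)" by (rule finite_subset[OF _ finl])
      qed
      show "\<forall>\<rho>\<in>ext_embs F k \<sigma>. \<forall>\<rho>'\<in>ext_embs F k \<sigma>. \<rho> \<noteq> \<rho>' \<longrightarrow> ext_embs l F \<rho> \<inter> ext_embs l F \<rho>' = {}"
      proof (intro ballI impI)
        fix \<rho> \<rho>' assume \<rho>: "\<rho> \<in> ext_embs F k \<sigma>" "\<rho>' \<in> ext_embs F k \<sigma>" "\<rho> \<noteq> \<rho>'"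
        then obtain x where "x \<in> F" "\<rho> x \<noteq> \<rho>' x"
          using embs_eqI[of \<rho> F \<rho>'] by (auto simp: ext_embs_def)
        thus "ext_embs l F \<rho> \<inter> ext_embs l F \<rho>' = {}" by (auto simp: ext_embs_def)
      qed
    qed
    also have "\<dots> \<le> card (ext_embs l k \<sigma>)" by (rule card_mono[OF finl sub])
    finally show ?thesis .
  qed
qed

lemma card_ext_embs:
  fixes k l :: "'a::field_char_0 set"
  assumes k: "subfield k ambient" and l: "subfield l ambient" and kl: "k \<subseteq> l"
    and bs: "ring.independent ambient k bs" "ring.Span ambient k bs = l" and \<sigma>: "\<sigma> \<in> embs k"
  shows "card (ext_embs l k \<sigma>) = length bs"
  by (rule le_antisym[OF card_ext_embs_le(2)[OF k l kl field_basis_if_independent_Span[OF k bs]]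
        dimension_le_card_ext_embs[OF k l kl amb.dimensionI[OF k bs] \<sigma>]])

section \<open>Norm and trace\<close>

lemma fdet_scale_rows: "fdet n (\<lambda>i j. d i * f i j) = (\<Prod>i<n. d i) * fdet n f"
  unfolding fdet_leibniz by (simp add: prod.distrib sum_distrib_left atLeast0LessThan mult_ac)

locale emb_basis =
  fixes k l :: "'a::field_char_0 set" and bs :: "'a list" and \<sigma> :: "'a \<Rightarrow> complex"
  assumes k: "subfield k ambient" and l: "subfield l ambient" and kl: "k \<subseteq> l"
    and bs: "ring.independent ambient k bs" "ring.Span ambient k bs = l" and \<sigma>: "\<sigma> \<in> embs k"
begin

lemma fb: "field_basis k l bs"
  by (rule field_basis_if_independent_Span[OF k bs])

lemma obtain_enum:
  obtains t where "bij_betw t {..<length bs} (ext_embs l k \<sigma>)"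
  using ex_bij_betw_nat_finite[OF card_ext_embs_le(1)[OF k l kl fb, of \<sigma>]] card_ext_embs[OF k l kl bs \<sigma>]
  by (auto simp: atLeast0LessThan)

context
  fixes t assumes t: "bij_betw t {..<length bs} (ext_embs l k \<sigma>)"
begin

lemma t_ext: "i < length bs \<Longrightarrow> t i \<in> ext_embs l k \<sigma>"
  using bij_betw_apply[OF t] by simp

text \<open>The square of this determinant is the image under \<open>\<sigma>\<close> of the
  discriminant of the basis. A kernel vector of the transpose would be a relation among distinct
  embeddings.\<close>

lemma emb_matrix_det: "fdet (length bs) (\<lambda>i j. t i (bs ! j)) \<noteq> 0"
proof
  assume "fdet (length bs) (\<lambda>i j. t i (bs ! j)) = 0"
  hence "fdet (length bs) (\<lambda>j i. t i (bs ! j)) = 0"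
    using fdet_transpose[of "length bs" "\<lambda>i j. t i (bs ! j)"] by simp
  then obtain c where c: "\<exists>i<length bs. c i \<noteq> 0" "\<forall>j<length bs. (\<Sum>i<length bs. t i (bs ! j) * c i) = 0"
    using fdet_kernel[of "length bs" "\<lambda>j i. t i (bs ! j)"] by blast
  have "c i = 0" if "i < length bs" for i
    by (rule ext_embs_vanish[OF k l kl fb, where m = "length bs" and t = t and c = c and \<sigma> = \<sigma>])
      (use t_ext c that t in \<open>auto simp: bij_betw_def\<close>)
  thus False using c(1) by blast
qed

end

end

locale mult_matrix = emb_basis k l bs \<sigma> for k l :: "'a::field_char_0 set" and bs \<sigma> +
  fixes x :: 'a and A :: "nat \<Rightarrow> nat \<Rightarrow> 'a"
  assumes x: "x \<in> l"
    and A: "\<And>i j. i < length bs \<Longrightarrow> j < length bs \<Longrightarrow> A i j \<in> k"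
    and xA: "\<And>j. j < length bs \<Longrightarrow> x * bs ! j = (\<Sum>i<length bs. A i j * bs ! i)"
begin

text \<open>With V the matrix of conjugates of the basis and D the diagonal matrix of the conjugates
  of \<open>x\<close>, this reads V \<sigma>(A) = D V. Hence determinant and trace of \<sigma>(A)
  are the product and the sum of the conjugates.\<close>

lemma diagonalize:
  assumes t: "bij_betw t {..<length bs} (ext_embs l k \<sigma>)"
    and ij: "i < length bs" "j < length bs"
  shows "(\<Sum>m<length bs. t i (bs ! m) * \<sigma> (A m j)) = t i x * t i (bs ! j)"
proof -
  have "t i (x * bs ! j) = (\<Sum>m<length bs. \<sigma> (A m j) * t i (bs ! m))"
    unfolding xA[OF ij(2)]
    by (rule ext_emb_of_basis_comb[OF k l kl fb t_ext[OF t ij(1)]]) (use A ij in auto)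
  moreover have "t i (x * bs ! j) = t i x * t i (bs ! j)"
    by (rule emb_mult[OF l]) (use t_ext[OF t ij(1)] x field_basis_mem[OF fb ij(2)] in \<open>auto simp: ext_embs_def\<close>)
  ultimately show ?thesis by (simp add: mult.commute)
qed

lemma emb_det: "\<sigma> (fdet (length bs) A) = (\<Prod>\<tau>\<in>ext_embs l k \<sigma>. \<tau> x)"
proof -
  let ?n = "length bs"
  obtain t where t: "bij_betw t {..<?n} (ext_embs l k \<sigma>)" using obtain_enum .
  have "fdet ?n (\<lambda>i j. t i (bs ! j)) * fdet ?n (\<lambda>i j. \<sigma> (A i j)) 
      = fdet ?n (\<lambda>i j. \<Sum>m<?n. t i (bs ! m) * \<sigma> (A m j))" by (rule fdet_mult[symmetric])
  also have "\<dots> = fdet ?n (\<lambda>i j. t i x * t i (bs ! j))"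
    by (rule fdet_cong) (rule diagonalize[OF t])
  also have "\<dots> = (\<Prod>i<?n. t i x) * fdet ?n (\<lambda>i j. t i (bs ! j))" by (rule fdet_scale_rows)
  finally have "fdet ?n (\<lambda>i j. \<sigma> (A i j)) = (\<Prod>i<?n. t i x)" using emb_matrix_det[OF t] by simp
  also have "\<dots> = (\<Prod>\<tau>\<in>ext_embs l k \<sigma>. \<tau> x)" by (rule prod.reindex_bij_betw[OF t])
  finally show ?thesis using emb_fdet(2)[OF k \<sigma>, of ?n A] A by simp
qed

text \<open>By \<open>diagonalize\<close> the matrix is conjugate to a diagonal one. The invariance
  of the trace is written out with the inverse \<open>G\<close> of the matrix of conjugates.\<close>

lemma emb_trace: "\<sigma> (\<Sum>j<length bs. A j j) = (\<Sum>\<tau>\<in>ext_embs l k \<sigma>. \<tau> x)"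
proof -
  let ?n = "length bs"
  obtain t where t: "bij_betw t {..<?n} (ext_embs l k \<sigma>)" using obtain_enum .
  let ?V = "\<lambda>i j. t i (bs ! j)"
  obtain G where G: "\<forall>i<?n. \<forall>j<?n. (\<Sum>m<?n. ?V i m * G m j) = (if i = j then 1 else 0)
      \<and> (\<Sum>m<?n. G i m * ?V m j) = (if i = j then 1 else 0)"
    using fdet_inverse[OF emb_matrix_det[OF t]] by blast
  have "\<sigma> (\<Sum>j<?n. A j j) = (\<Sum>j<?n. \<sigma> (A j j))" by (rule emb_sum[OF k \<sigma>]) (use A in auto)
  also have "\<dots> = (\<Sum>j<?n. \<Sum>i<?n. G j i * (t i x * ?V i j))"
  proof (intro sum.cong refl)
    fix j assume "j \<in> {..<?n}"
    hence j: "j < ?n" by simp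
    have "(\<Sum>i<?n. G j i * (t i x * ?V i j)) = (\<Sum>i<?n. G j i * (\<Sum>m<?n. ?V i m * \<sigma> (A m j)))"
      by (intro sum.cong refl) (use j in \<open>simp add: diagonalize[OF t]\<close>)
    also have "\<dots> = (\<Sum>i<?n. \<Sum>m<?n. G j i * ?V i m * \<sigma> (A m j))"
      by (simp add: sum_distrib_left mult.assoc)
    also have "\<dots> = (\<Sum>m<?n. \<Sum>i<?n. G j i * ?V i m * \<sigma> (A m j))" by (rule sum.swap)
    also have "\<dots> = (\<Sum>m<?n. (\<Sum>i<?n. G j i * ?V i m) * \<sigma> (A m j))" by (simp add: sum_distrib_right)
    also have "\<dots> = (\<Sum>m<?n. if j = m then \<sigma> (A m j) else 0)"
      by (intro sum.cong refl) (use G j in auto)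
    also have "\<dots> = \<sigma> (A j j)" using j by simp
    finally show "\<sigma> (A j j) = (\<Sum>i<?n. G j i * (t i x * ?V i j))" by simp
  qed
  also have "\<dots> = (\<Sum>i<?n. \<Sum>j<?n. G j i * (t i x * ?V i j))" by (rule sum.swap)
  also have "\<dots> = (\<Sum>i<?n. t i x * (\<Sum>j<?n. ?V i j * G j i))"
    by (simp add: sum_distrib_left mult_ac)
  also have "\<dots> = (\<Sum>i<?n. t i x)" by (intro sum.cong refl) (use G in simp)
  also have "\<dots> = (\<Sum>\<tau>\<in>ext_embs l k \<sigma>. \<tau> x)" by (rule sum.reindex_bij_betw[OF t])
  finally show ?thesis .
qed

end

lemma mult_matrix_exists:
  fixes k l :: "'a::field_char_0 set"
  assumes k: "subfield k ambient" and l: "subfield l ambient"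
    and fb: "field_basis k l bs" and x: "x \<in> l"
  obtains A where "\<And>i j. i < length bs \<Longrightarrow> j < length bs \<Longrightarrow> A i j \<in> k"
    "\<And>j. j < length bs \<Longrightarrow> x * bs ! j = (\<Sum>i<length bs. A i j * bs ! i)"
proof -
  have "\<forall>j. \<exists>c. j < length bs \<longrightarrow> (\<forall>i<length bs. c i \<in> k) \<and> x * bs ! j = (\<Sum>i<length bs. c i * bs ! i)"
  proof
    fix j
    show "\<exists>c. j < length bs \<longrightarrow> (\<forall>i<length bs. c i \<in> k) \<and> x * bs ! j = (\<Sum>i<length bs. c i * bs ! i)"
    proof (cases "j < length bs")
      case True
      have "x * bs ! j \<in> l" using subfield_mult[OF l x field_basis_mem[OF fb True]] .
      thus ?thesis using fb unfolding field_basis_def by blast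
    qed simp
  qed
  then obtain c where "\<forall>j. j < length bs \<longrightarrow> (\<forall>i<length bs. c j i \<in> k) \<and> x * bs ! j = (\<Sum>i<length bs. c j i * bs ! i)"
    by (rule choice[THEN exE])
  thus ?thesis by (intro that[of "\<lambda>i j. c j i"]) auto
qed

text \<open>Whatever basis \<open>SOME\<close> picks, the determinant is sent to the same product of
  conjugates. As embeddings are injective, this formula determines the norm, and the later
  properties of the norm are derived from it.\<close>

lemma field_norm_emb:
  fixes k l :: "'a::field_char_0 set"
  assumes k: "subfield k ambient" and l: "subfield l ambient" and kl: "k \<subseteq> l"
    and fin: "ring.finite_dimension ambient k l" and x: "x \<in> l" and \<sigma>: "\<sigma> \<in> embs k"
  shows "field_norm l k x \<in> k" and "\<sigma> (field_norm l k x) = (\<Prod>\<tau>\<in>ext_embs l k \<sigma>. \<tau> x)"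
proof -
  let ?P = "\<lambda>d. \<exists>bs A. amb.independent k bs \<and> amb.Span k bs = l \<and>
     A \<in> carrier_mat (length bs) (length bs) \<and>
     (\<forall>i<length bs. \<forall>j<length bs. A $$ (i, j) \<in> k) \<and>
     (\<forall>j<length bs. x * bs ! j = (\<Sum>i<length bs. A $$ (i, j) * bs ! i)) \<and>
     d = Determinant.det A"
  have "\<exists>d. ?P d"
  proof -
    obtain bs where bs: "amb.independent k bs" "amb.Span k bs = l"
      using amb.exists_base[OF k] fin unfolding amb.finite_dimension_def by metis
    obtain A where A: "\<And>i j. i < length bs \<Longrightarrow> j < length bs \<Longrightarrow> A i j \<in> k"
      "\<And>j. j < length bs \<Longrightarrow> x * bs ! j = (\<Sum>i<length bs. A i j * bs ! i)"
      using mult_matrix_exists[OF k l field_basis_if_independent_Span[OF k bs] x] by blast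
    let ?A = "mat (length bs) (length bs) (\<lambda>(i, j). A i j)"
    show ?thesis
      by (intro exI[of _ "Determinant.det ?A"] exI[of _ bs] exI[of _ ?A]) (use bs A in auto)
  qed
  hence "?P (field_norm l k x)" unfolding field_norm_def by (rule someI_ex)
  then obtain bs A where bs: "amb.independent k bs" "amb.Span k bs = l"
    and A: "A \<in> carrier_mat (length bs) (length bs)" "\<forall>i<length bs. \<forall>j<length bs. A $$ (i, j) \<in> k"
      "\<forall>j<length bs. x * bs ! j = (\<Sum>i<length bs. A $$ (i, j) * bs ! i)"
    and d: "field_norm l k x = Determinant.det A" by blast
  interpret mm: mult_matrix k l bs \<sigma> x "\<lambda>i j. A $$ (i, j)"
    by (intro mult_matrix.intro[OF emb_basis.intro[OF k l kl bs \<sigma>]] mult_matrix_axioms.intro x) (use A in blast)+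
  have "A = mat (length bs) (length bs) (\<lambda>(i, j). A $$ (i, j))" by (rule eq_matI) (use A(1) in auto)
  hence d': "field_norm l k x = fdet (length bs) (\<lambda>i j. A $$ (i, j))" unfolding d fdet_def by simp
  show "field_norm l k x \<in> k" unfolding d' by (rule emb_fdet(1)[OF k \<sigma>]) (use A in auto)
  show "\<sigma> (field_norm l k x) = (\<Prod>\<tau>\<in>ext_embs l k \<sigma>. \<tau> x)" unfolding d' by (rule mm.emb_det)
qed

lemma emb_trace_exists:
  fixes k l :: "'a::field_char_0 set"
  assumes k: "subfield k ambient" and l: "subfield l ambient" and kl: "k \<subseteq> l"
    and fin: "ring.finite_dimension ambient k l" and x: "x \<in> l" and \<sigma>: "\<sigma> \<in> embs k"
  shows "\<exists>y\<in>k. \<sigma> y = (\<Sum>\<tau>\<in>ext_embs l k \<sigma>. \<tau> x)"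
proof -
  obtain bs where bs: "amb.independent k bs" "amb.Span k bs = l"
    using amb.exists_base[OF k] fin unfolding amb.finite_dimension_def by metis
  obtain A where A: "\<And>i j. i < length bs \<Longrightarrow> j < length bs \<Longrightarrow> A i j \<in> k"
    "\<And>j. j < length bs \<Longrightarrow> x * bs ! j = (\<Sum>i<length bs. A i j * bs ! i)"
    using mult_matrix_exists[OF k l field_basis_if_independent_Span[OF k bs] x] by blast
  interpret mm: mult_matrix k l bs \<sigma> x A
    by (intro mult_matrix.intro[OF emb_basis.intro[OF k l kl bs \<sigma>]] mult_matrix_axioms.intro x) (use A in blast)+
  show ?thesis using mm.emb_trace by (intro bexI[of _ "\<Sum>j<length bs. A j j"] subfield_sum[OF k]) (auto simp: A)
qed

section \<open>Archimedean places\<close>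

lemma number_field_subfield: "number_field L \<Longrightarrow> subfield L ambient"
  by (simp add: number_field_def)

definition aval :: "'a set \<Rightarrow> ('a \<Rightarrow> complex) \<Rightarrow> 'a \<Rightarrow> real" where
  "aval L \<sigma> = restrict (\<lambda>x. cmod (\<sigma> x)) L"

lemma aval_apply [simp]: "x \<in> L \<Longrightarrow> aval L \<sigma> x = cmod (\<sigma> x)"
  by (simp add: aval_def)

text \<open>The only embedding of \<rat>. It turns the absolute embeddings of a number field into
  the case of extensions of one embedding of the base field.\<close>

definition rat_emb :: "'a::field_char_0 \<Rightarrow> complex" where
  "rat_emb = restrict (\<lambda>x. of_rat (inv_into UNIV of_rat x)) \<rat>"

lemma rat_emb_of_rat: "rat_emb (of_rat q :: 'a::field_char_0) = of_rat q"
proof -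
  have "inj (of_rat :: rat \<Rightarrow> 'a)" by (simp add: inj_def)
  thus ?thesis by (simp add: rat_emb_def)
qed

lemma rat_emb_in_embs: "(rat_emb :: 'a::field_char_0 \<Rightarrow> complex) \<in> embs \<rat>"
proof -
  have "rat_emb (1::'a) = 1" using rat_emb_of_rat[of 1, where 'a = 'a] by simp
  moreover have "rat_emb (x + y) = rat_emb x + rat_emb y \<and> rat_emb (x * y) = rat_emb x * rat_emb y"
    if "x \<in> \<rat>" "y \<in> \<rat>" for x y :: 'a
  proof -
    obtain p q where "x = of_rat p" "y = of_rat q" using \<open>x \<in> \<rat>\<close> \<open>y \<in> \<rat>\<close> by (auto elim!: Rats_cases)
    thus ?thesis by (simp add: rat_emb_of_rat of_rat_add of_rat_mult flip: of_rat_add of_rat_mult)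
  qed
  ultimately show ?thesis by (auto simp: embs_def rat_emb_def)
qed

lemma embs_eq_ext_embs_Rats:
  fixes L :: "'a::field_char_0 set"
  assumes L: "subfield L ambient"
  shows "embs L = ext_embs L \<rat> rat_emb"
  unfolding ext_embs_def by (auto simp: emb_of_rat[OF L] rat_emb_of_rat elim!: Rats_cases)

lemma number_field_extension_basis:
  fixes k l :: "'a::field_char_0 set"
  assumes k: "subfield k ambient" and l: "number_field l" and kl: "k \<subseteq> l"
  obtains bs where "ring.independent ambient k bs" "ring.Span ambient k bs = l" "length bs > 0"
proof -
  have l': "subfield l ambient" by (rule number_field_subfield[OF l])
  obtain cs where cs: "amb.Span \<rat> cs = l"
    using amb.exists_base[OF subfield_Rats] l unfolding number_field_def amb.finite_dimension_def by metis
  obtain bs where bs: "amb.independent k bs" "amb.Span k bs = l"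
    using intermediate_field_basis[OF subfield_Rats k l' Rats_subset_subfield[OF k] kl cs] .
  have "length bs > 0"
  proof (rule ccontr)
    assume "\<not> length bs > 0"
    hence "l = {0}" using bs(2) by simp
    thus False using subfield_one[OF l'] by simp
  qed
  thus ?thesis using that bs by blast
qed

lemma number_field_finite_dimension:
  fixes k l :: "'a::field_char_0 set"
  assumes k: "subfield k ambient" and l: "number_field l" and kl: "k \<subseteq> l"
  shows "ring.finite_dimension ambient k l"
proof -
  obtain bs where "amb.independent k bs" "amb.Span k bs = l"
    using number_field_extension_basis[OF assms] .
  from amb.dimensionI[OF k this] show ?thesis by (rule amb.finite_dimensionI)
qed

lemma finite_ext_embs:
  fixes k l :: "'a::field_char_0 set"
  assumes k: "subfield k ambient" and l: "number_field l" and kl: "k \<subseteq> l"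
  shows "finite (ext_embs l k \<sigma>)"
proof -
  obtain bs where "amb.independent k bs" "amb.Span k bs = l"
    using number_field_extension_basis[OF assms] .
  from field_basis_if_independent_Span[OF k this] show ?thesis
    by (rule card_ext_embs_le(1)[OF k number_field_subfield[OF l] kl])
qed

lemma card_ext_embs_const:
  fixes k l :: "'a::field_char_0 set"
  assumes k: "subfield k ambient" and l: "number_field l" and kl: "k \<subseteq> l"
  obtains d where "d > 0" "\<And>\<sigma>. \<sigma> \<in> embs k \<Longrightarrow> card (ext_embs l k \<sigma>) = d"
proof -
  obtain bs where bs: "amb.independent k bs" "amb.Span k bs = l" "length bs > 0"
    using number_field_extension_basis[OF assms] .
  show ?thesis
    by (rule that[OF bs(3)]) (rule card_ext_embs[OF k number_field_subfield[OF l] kl bs(1,2)])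
qed

lemma finite_embs: "number_field L \<Longrightarrow> finite (embs L)"
  using finite_ext_embs[OF subfield_Rats _ Rats_subset_subfield] embs_eq_ext_embs_Rats number_field_subfield
  by metis

lemma ext_embs_nonempty:
  fixes k l :: "'a::field_char_0 set"
  assumes "subfield k ambient" "number_field l" "k \<subseteq> l" "\<sigma> \<in> embs k"
  shows "ext_embs l k \<sigma> \<noteq> {}"
proof -
  obtain d where "d > 0" "card (ext_embs l k \<sigma>) = d"
    using card_ext_embs_const[OF assms(1-3)] assms(4) by metis
  thus ?thesis by auto
qed

lemma embs_nonempty:
  fixes L :: "'a::field_char_0 set"
  assumes "number_field L" shows "embs L \<noteq> {}"
  using ext_embs_nonempty[OF subfield_Rats assms Rats_subset_subfield rat_emb_in_embs]
    number_field_subfield[OF assms] embs_eq_ext_embs_Rats by metis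

section \<open>Absolute values and weak approximation\<close>

context
  fixes L :: "'a::field_char_0 set" and w :: "'a \<Rightarrow> real"
  assumes L: "subfield L ambient" and w: "absolute_value L w"
begin

lemma absval_nonneg: "x \<in> L \<Longrightarrow> w x \<ge> 0"
  and absval_eq_0: "x \<in> L \<Longrightarrow> w x = 0 \<longleftrightarrow> x = 0"
  and absval_mult: "x \<in> L \<Longrightarrow> y \<in> L \<Longrightarrow> w (x * y) = w x * w y"
  and absval_add: "x \<in> L \<Longrightarrow> y \<in> L \<Longrightarrow> w (x + y) \<le> w x + w y"
  using w by (auto simp: absolute_value_def)

lemma absval_one: "w 1 = 1"
  using absval_mult[of 1 1] absval_eq_0[of 1] subfield_one[OF L] by simp

lemma absval_power: "x \<in> L \<Longrightarrow> w (x ^ n) = w x ^ n"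
  by (induction n) (simp_all add: absval_one absval_mult subfield_power[OF L])

lemma absval_minus_one: "w (- 1) = 1"
proof -
  have m: "- 1 \<in> L" by (rule subfield_uminus[OF L subfield_one[OF L]])
  have "w (- 1) ^ 2 = 1" using absval_power[OF m, of 2] absval_one by simp
  thus ?thesis using absval_nonneg[OF m] power2_eq_1_iff by fastforce
qed

lemma absval_uminus: "x \<in> L \<Longrightarrow> w (- x) = w x"
  using absval_mult[of "- 1" x] subfield_uminus[OF L subfield_one[OF L]] absval_minus_one by simp

lemma absval_diff_ge: "x \<in> L \<Longrightarrow> y \<in> L \<Longrightarrow> w (x + y) \<ge> w x - w y"
  using absval_add[of "x + y" "- y"] absval_uminus[of y] subfield_add[OF L] subfield_uminus[OF L] by simp

lemma absval_inverse:
  assumes "x \<in> L" shows "w (inverse x) = inverse (w x)"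
proof (cases "x = 0")
  case False
  hence "w x * w (inverse x) = 1"
    using absval_mult[OF assms subfield_inverse[OF L assms]] absval_one by simp
  thus ?thesis by (simp add: inverse_unique)
qed (use absval_eq_0[of 0] subfield_zero[OF L] in simp)

lemma absval_divide: "x \<in> L \<Longrightarrow> y \<in> L \<Longrightarrow> w (x / y) = w x / w y"
  by (simp add: divide_inverse absval_mult absval_inverse subfield_inverse[OF L])

lemma absval_sum: "(\<And>i. i \<in> I \<Longrightarrow> f i \<in> L) \<Longrightarrow> w (\<Sum>i\<in>I. f i) \<le> (\<Sum>i\<in>I. w (f i))"
proof (induction I rule: infinite_finite_induct)
  case (insert i I)
  thus ?case using absval_add[of "f i" "\<Sum>i\<in>I. f i"] subfield_sum[OF L, of I f] by force
qed (use absval_eq_0[of 0] subfield_zero[OF L] in auto)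

end

lemma arch_place_absval: "w \<in> arch_places L \<Longrightarrow> absolute_value L w"
  and arch_place_of_rat: "w \<in> arch_places L \<Longrightarrow> w (of_rat q) = \<bar>of_rat q\<bar>"
  by (simp_all add: arch_places_def)

lemma absolute_value_eqI:
  assumes "absolute_value L v" "absolute_value L w" "\<And>x. x \<in> L \<Longrightarrow> v x = w x"
  shows "v = w"
  using assms by (auto simp: absolute_value_def intro: extensionalityI)

text \<open>The places differ at some element; after inverting it if necessary,
  \<open>v x < w x\<close>. Dividing by a rational strictly between the two values moves them to
  either side of 1, because both places restrict to the usual absolute value on \<rat>.\<close>

lemma separate_two_places:
  fixes L :: "'a::field_char_0 set"
  assumes L: "subfield L ambient" and v: "v \<in> arch_places L" and w: "w \<in> arch_places L" and "v \<noteq> w"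
  obtains x where "x \<in> L" "v x < 1" "1 < w x"
proof -
  note v' = arch_place_absval[OF v] and w' = arch_place_absval[OF w]
  obtain x where x: "x \<in> L" "v x < w x"
  proof -
    obtain x where x: "x \<in> L" "v x \<noteq> w x" using absolute_value_eqI[OF v' w'] \<open>v \<noteq> w\<close> by blast
    show ?thesis
    proof (cases "v x < w x")
      case False
      hence lt: "w x < v x" using x(2) by simp
      have "x \<noteq> 0" using x absval_eq_0[OF L v' x(1)] absval_eq_0[OF L w' x(1)] by auto
      hence "w x > 0" using absval_nonneg[OF L w' x(1)] absval_eq_0[OF L w' x(1)] by simp
      hence "v (inverse x) < w (inverse x)"
        unfolding absval_inverse[OF L v' x(1)] absval_inverse[OF L w' x(1)] using lt by simp
      thus ?thesis using that subfield_inverse[OF L x(1)] by blast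
    qed (use that x(1) in blast)
  qed
  obtain q where q: "v x < of_rat q" "of_rat q < w x" using of_rat_dense[OF x(2)] by blast
  have q0: "(of_rat q :: real) > 0" using q(1) absval_nonneg[OF L v' x(1)] by linarith
  show ?thesis
  proof (rule that[of "x / of_rat q"])
    show "x / of_rat q \<in> L" by (rule subfield_divide[OF L x(1) subfield_of_rat[OF L]])
    show "v (x / of_rat q) < 1" using q(1) q0
      by (simp add: absval_divide[OF L v' x(1) subfield_of_rat[OF L]] arch_place_of_rat[OF v])
    show "1 < w (x / of_rat q)" using q(2) q0
      by (simp add: absval_divide[OF L w' x(1) subfield_of_rat[OF L]] arch_place_of_rat[OF w])
  qed
qed

text \<open>
  The inductive step of the weak approximation theorem: according to the size of \<open>x\<close> at the new
  place, the element \<open>x\<^sup>m y\<close> or \<open>x\<^sup>m y / (1 + x\<^sup>m)\<close> works for large \<open>m\<close>.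
\<close>

lemma separate_place:
  fixes L :: "'a::field_char_0 set"
  assumes L: "subfield L ambient" and w: "w \<in> arch_places L" and "finite S" "S \<subseteq> arch_places L" "w \<notin> S"
  shows "\<exists>x\<in>L. 1 < w x \<and> (\<forall>v\<in>S. v x < 1)"
  using assms(3-)
proof (induction S rule: finite_induct)
  case empty
  have "w (of_rat 2) = 2" using arch_place_of_rat[OF w, of 2] by simp
  thus ?case using subfield_of_rat[OF L, of 2] by (intro bexI[of _ "of_rat 2"]) auto
next
  case (insert v S)
  have v: "v \<in> arch_places L" "v \<noteq> w" using insert.prems by auto
  note v' = arch_place_absval[OF v(1)] and w' = arch_place_absval[OF w]
  obtain x where x: "x \<in> L" "1 < w x" "\<And>u. u \<in> S \<Longrightarrow> u x < 1" using insert by auto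
  obtain y where y: "y \<in> L" "v y < 1" "1 < w y" using separate_two_places[OF L v(1) w v(2)] .
  have u': "absolute_value L u" if "u \<in> S" for u using that insert.prems arch_place_absval by blast
  have xm: "x ^ m \<in> L" for m by (rule subfield_power[OF L x(1)])
  have upow: "(\<lambda>m. u x ^ m) \<longlonglongrightarrow> 0" if u: "u \<in> S" for u
    using x(3)[OF u] absval_nonneg[OF L u'[OF u] x(1)] by (intro LIMSEQ_realpow_zero)
  consider "v x \<le> 1" | "v x > 1" by linarith
  thus ?case
  proof cases
    case 1
    have "eventually (\<lambda>m. \<forall>u\<in>S. u (x ^ m * y) < 1) sequentially"
    proof (rule eventually_ball_finite[OF insert.hyps(1)], rule ballI)
      fix u assume u: "u \<in> S"
      have "(\<lambda>m. u x ^ m * u y) \<longlonglongrightarrow> 0 * u y" by (intro tendsto_intros upow u)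
      hence "eventually (\<lambda>m. u x ^ m * u y < 1) sequentially" by (rule order_tendstoD) simp
      thus "eventually (\<lambda>m. u (x ^ m * y) < 1) sequentially"
        by (simp add: absval_mult[OF L u'[OF u] xm y(1)] absval_power[OF L u'[OF u] x(1)])
    qed
    then obtain m where m: "\<forall>u\<in>S. u (x ^ m * y) < 1" unfolding eventually_sequentially by blast
    have "v (x ^ m * y) = v x ^ m * v y"
      by (simp add: absval_mult[OF L v' xm y(1)] absval_power[OF L v' x(1)])
    also have "\<dots> \<le> 1 * v y"
      using 1 absval_nonneg[OF L v' x(1)] absval_nonneg[OF L v' y(1)] by (intro mult_right_mono power_le_one)
    finally have "v (x ^ m * y) < 1" using y(2) by simp
    moreover have "1 < w (x ^ m * y)"
    proof -
      have "1 \<le> w x ^ m" using x(2) by (simp add: one_le_power)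
      hence "1 * w y \<le> w x ^ m * w y" using y(3) by (intro mult_right_mono) auto
      hence "1 < w x ^ m * w y" using y(3) by linarith
      thus ?thesis by (simp add: absval_mult[OF L w' xm y(1)] absval_power[OF L w' x(1)])
    qed
    ultimately show ?thesis using m by (intro bexI[of _ "x ^ m * y"] subfield_mult[OF L xm y(1)]) auto
  next
    case 2
    \<comment> \<open>The value of \<open>x ^ m / (1 + x ^ m)\<close> tends to 0 at the places in
      \<open>S\<close> and to 1 at \<open>v\<close> and \<open>w\<close>, so that for large
      \<open>m\<close> only \<open>y\<close> matters at \<open>v\<close> and
      \<open>w\<close>.\<close>
    define z where "z = (\<lambda>m. x ^ m * y / (1 + x ^ m))"
    have den: "1 + x ^ m \<in> L" for m by (intro subfield_add[OF L] subfield_one[OF L] xm)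
    have zL: "z m \<in> L" for m
      unfolding z_def by (intro subfield_divide[OF L] subfield_mult[OF L] den xm y(1))
    have uz: "u (z m) = u x ^ m * u y / u (1 + x ^ m)" if "absolute_value L u" for u m
      unfolding z_def
      by (simp add: absval_divide[OF L that subfield_mult[OF L xm y(1)] den] absval_mult[OF L that xm y(1)] 
          absval_power[OF L that x(1)])
    have u1: "u (1 + x ^ m) \<ge> 1 - u x ^ m" if "absolute_value L u" for u m
      using absval_diff_ge[OF L that subfield_one[OF L] xm, of m] 
      by (simp add: absval_one[OF L that] absval_power[OF L that x(1)])
    have u2: "u (1 + x ^ m) \<ge> u x ^ m - 1" if "absolute_value L u" for u m
      using absval_diff_ge[OF L that xm subfield_one[OF L], of m] 
      by (simp add: absval_one[OF L that] absval_power[OF L that x(1)] add.commute)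
    have u3: "u (1 + x ^ m) \<le> 1 + u x ^ m" if "absolute_value L u" for u m
      using absval_add[OF L that subfield_one[OF L] xm, of m] 
      by (simp add: absval_one[OF L that] absval_power[OF L that x(1)])
    have "eventually (\<lambda>m. \<forall>u\<in>S. u (z m) < 1) sequentially"
    proof (rule eventually_ball_finite[OF insert.hyps(1)], rule ballI)
      fix u assume u: "u \<in> S"
      have "(\<lambda>m. u x ^ m * u y / (1 - u x ^ m)) \<longlonglongrightarrow> 0 * u y / (1 - 0)"
        by (intro tendsto_intros upow u) simp
      hence "eventually (\<lambda>m. u x ^ m * u y / (1 - u x ^ m) < 1) sequentially"
        by (rule order_tendstoD) simp
      moreover have "eventually (\<lambda>m. u x ^ m < 1) sequentially"
        by (rule order_tendstoD(2)[OF upow[OF u]]) simp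
      ultimately show "eventually (\<lambda>m. u (z m) < 1) sequentially"
      proof eventually_elim
        case (elim m)
        have "u (z m) \<le> u x ^ m * u y / (1 - u x ^ m)"
          unfolding uz[OF u'[OF u]] using elim u1[OF u'[OF u], of m] 
            absval_nonneg[OF L u'[OF u] x(1)] absval_nonneg[OF L u'[OF u] y(1)]
          by (intro divide_left_mono mult_nonneg_nonneg mult_pos_pos) auto
        thus ?case using elim by linarith
      qed
    qed
    moreover have "eventually (\<lambda>m. v (z m) < 1) sequentially"
    proof -
      have lim: "(\<lambda>m. inverse (v x) ^ m) \<longlonglongrightarrow> 0"
        using 2 by (intro LIMSEQ_realpow_zero) (auto simp: inverse_less_1_iff)
      have "(\<lambda>m. v y / (1 - inverse (v x) ^ m)) \<longlonglongrightarrow> v y / (1 - 0)"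
        by (intro tendsto_intros lim) simp
      hence "eventually (\<lambda>m. v y / (1 - inverse (v x) ^ m) < 1) sequentially"
        by (rule order_tendstoD) (use y(2) in simp)
      moreover have "eventually (\<lambda>m::nat. m > 0) sequentially" by (rule eventually_gt_at_top)
      ultimately show ?thesis
      proof eventually_elim
        case (elim m)
        have gt: "v x ^ m > 1" using 2 elim(2) by (simp add: one_less_power)
        have "v (z m) \<le> v x ^ m * v y / (v x ^ m - 1)"
          unfolding uz[OF v'] using gt u2[OF v', of m] absval_nonneg[OF L v' x(1)] absval_nonneg[OF L v' y(1)]
          by (intro divide_left_mono mult_nonneg_nonneg mult_pos_pos) auto
        also have "\<dots> = v y / (1 - inverse (v x) ^ m)"
          using gt 2 by (simp add: field_simps power_inverse)
        finally show ?case using elim(1) by linarith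
      qed
    qed
    moreover have "eventually (\<lambda>m. 1 < w (z m)) sequentially"
    proof -
      have lim: "(\<lambda>m. inverse (w x) ^ m) \<longlonglongrightarrow> 0"
        using x(2) by (intro LIMSEQ_realpow_zero) (auto simp: inverse_less_1_iff)
      have "(\<lambda>m. w y / (1 + inverse (w x) ^ m)) \<longlonglongrightarrow> w y / (1 + 0)"
        by (intro tendsto_intros lim) simp
      hence "eventually (\<lambda>m. 1 < w y / (1 + inverse (w x) ^ m)) sequentially"
        by (rule order_tendstoD) (use y(3) in simp)
      moreover have "eventually (\<lambda>m::nat. m > 0) sequentially" by (rule eventually_gt_at_top)
      ultimately show ?thesis
      proof eventually_elim
        case (elim m)
        have gt: "w x ^ m > 1" using x(2) elim(2) by (simp add: one_less_power)
        have "w y / (1 + inverse (w x) ^ m) = w x ^ m * w y / (1 + w x ^ m)"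
          using gt x(2) by (simp add: field_simps power_inverse)
        also have "\<dots> \<le> w (z m)"
          unfolding uz[OF w'] using gt u2[OF w', of m] u3[OF w', of m] absval_nonneg[OF L w' x(1)] y(3)
          by (intro divide_left_mono mult_nonneg_nonneg mult_pos_pos) auto
        finally show ?case using elim(1) by linarith
      qed
    qed
    ultimately have "eventually (\<lambda>m. (\<forall>u\<in>S. u (z m) < 1) \<and> v (z m) < 1 \<and> 1 < w (z m)) sequentially"
      by (intro eventually_conj)
    then obtain m where "\<forall>u\<in>S. u (z m) < 1" "v (z m) < 1" "1 < w (z m)"
      unfolding eventually_sequentially by blast
    thus ?thesis using zL by blast
  qed
qed

lemma aval_arch_place:
  fixes L :: "'a::field_char_0 set"
  assumes L: "subfield L ambient" and \<sigma>: "\<sigma> \<in> embs L"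
  shows "aval L \<sigma> \<in> arch_places L"
proof -
  have "absolute_value L (aval L \<sigma>)"
    unfolding absolute_value_def
    using emb_eq_0_iff[OF L \<sigma>] emb_add[OF L \<sigma>] emb_mult[OF L \<sigma>] subfield_add[OF L] subfield_mult[OF L]
    by (auto simp: norm_mult norm_triangle_ineq aval_def)
  moreover have "aval L \<sigma> (of_rat q) = \<bar>of_rat q\<bar>" for q
  proof -
    have "cmod (of_rat q) = \<bar>of_rat q :: real\<bar>"
      by (cases q) (simp add: of_rat_rat norm_divide)
    thus ?thesis by (simp add: subfield_of_rat[OF L] emb_of_rat[OF L \<sigma>])
  qed
  ultimately show ?thesis by (simp add: arch_places_def)
qed

text \<open>The coordinates in a basis over \<rat> are rational, so \<open>w\<close> measures them
  by the usual absolute value. Inverting the matrix of conjugates of the basis bounds them by the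
  conjugates of \<open>x\<close>.\<close>

lemma arch_place_bounded:
  fixes L :: "'a::field_char_0 set"
  assumes L: "number_field L" and w: "w \<in> arch_places L"
  obtains C where "\<And>x. x \<in> L \<Longrightarrow> w x \<le> C * (\<Sum>\<sigma>\<in>embs L. cmod (\<sigma> x))"
proof -
  have L': "subfield L ambient" by (rule number_field_subfield[OF L])
  note w' = arch_place_absval[OF w]
  have QL: "\<rat> \<subseteq> L" by (rule Rats_subset_subfield[OF L'])
  obtain bs where bs: "amb.independent \<rat> bs" "amb.Span \<rat> bs = L"
    using number_field_extension_basis[OF subfield_Rats L QL] .
  interpret eb: emb_basis \<rat> L bs rat_emb
    by (rule emb_basis.intro[OF subfield_Rats L' QL bs rat_emb_in_embs])
  let ?n = "length bs"
  obtain t where t: "bij_betw t {..<?n} (ext_embs L \<rat> rat_emb)" using eb.obtain_enum .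
  let ?V = "\<lambda>i j. t i (bs ! j)"
  obtain G where G: "\<forall>i<?n. \<forall>j<?n. (\<Sum>m<?n. ?V i m * G m j) = (if i = j then 1 else 0)
      \<and> (\<Sum>m<?n. G i m * ?V m j) = (if i = j then 1 else 0)"
    using fdet_inverse[OF eb.emb_matrix_det[OF t]] by blast
  define M where "M = (\<Sum>j<?n. \<Sum>i<?n. cmod (G j i))"
  define C where "C = (\<Sum>j<?n. M * w (bs ! j))"
  have "w x \<le> C * (\<Sum>\<sigma>\<in>embs L. cmod (\<sigma> x))" if x: "x \<in> L" for x
  proof -
    define N where "N = (\<Sum>\<sigma>\<in>embs L. cmod (\<sigma> x))"
    have N: "N = (\<Sum>i<?n. cmod (t i x))" unfolding N_def embs_eq_ext_embs_Rats[OF L']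
      by (rule sum.reindex_bij_betw[OF t, symmetric])
    have N0: "N \<ge> 0" unfolding N_def by (intro sum_nonneg) auto
    obtain c where c: "\<And>i. i < ?n \<Longrightarrow> c i \<in> \<rat>" and xc: "x = (\<Sum>i<?n. c i * bs ! i)"
      using field_basis_spans[OF eb.fb x] by blast
    have bsL: "bs ! j \<in> L" if "j < ?n" for j using field_basis_mem[OF eb.fb that] .
    have tx: "t i x = (\<Sum>j<?n. rat_emb (c j) * ?V i j)" if "i < ?n" for i
      unfolding xc by (rule ext_emb_of_basis_comb[OF subfield_Rats L' QL eb.fb eb.t_ext[OF t that] c])
    have wc: "w (c j) \<le> M * N" if j: "j < ?n" for j
    proof -
      have "(\<Sum>i<?n. G j i * t i x) = (\<Sum>i<?n. \<Sum>m<?n. G j i * ?V i m * rat_emb (c m))"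
        by (intro sum.cong refl) (simp add: tx sum_distrib_left mult_ac)
      also have "\<dots> = (\<Sum>m<?n. \<Sum>i<?n. G j i * ?V i m * rat_emb (c m))" by (rule sum.swap)
      also have "\<dots> = (\<Sum>m<?n. (\<Sum>i<?n. G j i * ?V i m) * rat_emb (c m))" by (simp add: sum_distrib_right)
      also have "\<dots> = (\<Sum>m<?n. if j = m then rat_emb (c m) else 0)"
        by (intro sum.cong refl) (use G j in auto)
      also have "\<dots> = rat_emb (c j)" using j by simp
      finally have eq: "rat_emb (c j) = (\<Sum>i<?n. G j i * t i x)" by simp
      obtain q where q: "c j = of_rat q" using c[OF j] by (auto elim!: Rats_cases)
      have "w (c j) = \<bar>of_rat q\<bar>" unfolding q by (rule arch_place_of_rat[OF w])
      also have "\<dots> = cmod (rat_emb (c j))"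
        unfolding q rat_emb_of_rat by (cases q) (simp add: of_rat_rat norm_divide)
      also have "\<dots> \<le> (\<Sum>i<?n. cmod (G j i) * cmod (t i x))"
        unfolding eq by (rule order.trans[OF norm_sum]) (simp add: norm_mult)
      also have "\<dots> \<le> (\<Sum>i<?n. cmod (G j i) * N)"
      proof (intro sum_mono mult_left_mono)
        fix i assume "i \<in> {..<?n}"
        thus "cmod (t i x) \<le> N" unfolding N by (intro member_le_sum) auto
      qed auto
      also have "\<dots> = (\<Sum>i<?n. cmod (G j i)) * N" by (simp add: sum_distrib_right)
      also have "\<dots> \<le> M * N"
        unfolding M_def using j N0 
        by (intro mult_right_mono member_le_sum[of j "{..<?n}" "\<lambda>j. \<Sum>i<?n. cmod (G j i)"]) (auto intro: sum_nonneg)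
      finally show ?thesis .
    qed
    have cL: "c i \<in> L" if "i < ?n" for i using c[OF that] QL by blast
    have "w x \<le> (\<Sum>j<?n. w (c j * bs ! j))"
      unfolding xc by (rule absval_sum[OF L' w']) (use cL bsL subfield_mult[OF L'] in auto)
    also have "\<dots> = (\<Sum>j<?n. w (c j) * w (bs ! j))"
      by (intro sum.cong refl) (use cL bsL in \<open>simp add: absval_mult[OF L' w']\<close>)
    also have "\<dots> \<le> (\<Sum>j<?n. (M * N) * w (bs ! j))"
      by (intro sum_mono mult_right_mono) (use wc bsL absval_nonneg[OF L' w'] in auto)
    also have "\<dots> = C * N" unfolding C_def by (simp add: sum_distrib_right sum_distrib_left mult_ac)
    finally show ?thesis by (simp add: N_def)
  qed
  thus ?thesis by (rule that)
qed

text \<open>A place not induced by an embedding could be separated from the finitely many induced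
  ones: some \<open>x\<close> has \<open>w x > 1\<close> and all conjugates of modulus below 1. The
  powers of \<open>x\<close> then contradict \<open>arch_place_bounded\<close>.\<close>

theorem arch_places_eq:
  fixes L :: "'a::field_char_0 set"
  assumes L: "number_field L"
  shows "arch_places L = aval L ` embs L"
proof (intro equalityI subsetI)
  have L': "subfield L ambient" by (rule number_field_subfield[OF L])
  show "w \<in> arch_places L" if "w \<in> aval L ` embs L" for w using that aval_arch_place[OF L'] by auto
  fix w assume w: "w \<in> arch_places L"
  note w' = arch_place_absval[OF w]
  show "w \<in> aval L ` embs L"
  proof (rule ccontr)
    assume "w \<notin> aval L ` embs L"
    hence "\<exists>x\<in>L. 1 < w x \<and> (\<forall>v\<in>aval L ` embs L. v x < 1)"
      by (intro separate_place[OF L' w] finite_imageI finite_embs[OF L]) (use aval_arch_place[OF L'] in auto)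
    then obtain x where x: "x \<in> L" "1 < w x" "\<And>\<sigma>. \<sigma> \<in> embs L \<Longrightarrow> cmod (\<sigma> x) < 1" by auto
    obtain C where C: "\<And>x. x \<in> L \<Longrightarrow> w x \<le> C * (\<Sum>\<sigma>\<in>embs L. cmod (\<sigma> x))"
      using arch_place_bounded[OF L w] by blast
    have bound: "w x ^ m \<le> \<bar>C\<bar> * card (embs L)" for m
    proof -
      have "w x ^ m = w (x ^ m)" by (simp add: absval_power[OF L' w' x(1)])
      also have "\<dots> \<le> C * (\<Sum>\<sigma>\<in>embs L. cmod (\<sigma> (x ^ m)))" by (rule C[OF subfield_power[OF L' x(1)]])
      also have "\<dots> \<le> \<bar>C\<bar> * (\<Sum>\<sigma>\<in>embs L. cmod (\<sigma> (x ^ m)))" by (intro mult_right_mono sum_nonneg) auto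
      also have "\<dots> \<le> \<bar>C\<bar> * (\<Sum>\<sigma>\<in>embs L. 1)"
      proof (intro mult_left_mono sum_mono)
        fix \<sigma> assume \<sigma>: "\<sigma> \<in> embs L"
        have "cmod (\<sigma> (x ^ m)) = cmod (\<sigma> x) ^ m" by (simp add: emb_power[OF L' \<sigma> x(1)] norm_power)
        also have "\<dots> \<le> 1" using x(3)[OF \<sigma>] by (intro power_le_one) auto
        finally show "cmod (\<sigma> (x ^ m)) \<le> 1" .
      qed auto
      finally show ?thesis by simp
    qed
    obtain m where "\<bar>C\<bar> * card (embs L) < w x ^ m" using real_arch_pow[OF x(2)] by blast
    thus False using bound[of m] by linarith
  qed
qed

lemma finite_arch_places: "number_field L \<Longrightarrow> finite (arch_places L)"
  by (simp add: arch_places_eq finite_embs)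

lemma arch_places_nonempty: "number_field L \<Longrightarrow> arch_places L \<noteq> {}"
  by (simp add: arch_places_eq embs_nonempty)

section \<open>Embeddings that induce the same place\<close>

definition emb_cnj :: "'a set \<Rightarrow> ('a \<Rightarrow> complex) \<Rightarrow> 'a \<Rightarrow> complex" where
  "emb_cnj L \<sigma> = restrict (\<lambda>x. cnj (\<sigma> x)) L"

lemma emb_cnj_in_embs:
  fixes L :: "'a::field_char_0 set"
  assumes L: "subfield L ambient" and \<sigma>: "\<sigma> \<in> embs L"
  shows "emb_cnj L \<sigma> \<in> embs L"
  using \<sigma> subfield_add[OF L] subfield_mult[OF L] subfield_one[OF L] by (auto simp: embs_def emb_cnj_def)

lemma aval_emb_cnj: "aval L (emb_cnj L \<sigma>) = aval L \<sigma>"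
  by (auto simp: aval_def emb_cnj_def)

text \<open>Comparing the moduli at \<open>x\<close> and at \<open>x + 1\<close> fixes the real
  part, and then the imaginary part up to sign. So \<open>\<tau>\<close> agrees pointwise with
  \<open>\<sigma>\<close> or its conjugate. The choice is uniform because an additive group is not
  the union of two proper subgroups, which is the argument with \<open>x + y\<close>.\<close>

lemma aval_eq_cases:
  fixes L :: "'a::field_char_0 set"
  assumes L: "subfield L ambient" and \<sigma>: "\<sigma> \<in> embs L" and \<tau>: "\<tau> \<in> embs L" and eq: "aval L \<tau> = aval L \<sigma>"
  shows "\<tau> = \<sigma> \<or> \<tau> = emb_cnj L \<sigma>"
proof -
  have norm_eq: "cmod (\<tau> x) = cmod (\<sigma> x)" if "x \<in> L" for x
    using fun_cong[OF eq, of x] that by simp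
  have pointwise: "\<tau> x = \<sigma> x \<or> \<tau> x = cnj (\<sigma> x)" if x: "x \<in> L" for x
  proof -
    have "cmod (\<tau> x + 1) = cmod (\<sigma> x + 1)"
      using norm_eq[OF subfield_add[OF L x subfield_one[OF L]]]
      by (simp add: emb_add[OF L \<sigma> x subfield_one[OF L]] emb_add[OF L \<tau> x subfield_one[OF L]] 
          emb_one[OF L \<sigma>] emb_one[OF L \<tau>])
    hence 1: "(cmod (\<tau> x + 1))\<^sup>2 = (cmod (\<sigma> x + 1))\<^sup>2" by simp
    have 2: "(cmod (\<tau> x))\<^sup>2 = (cmod (\<sigma> x))\<^sup>2" using norm_eq[OF x] by simp
    have "(cmod (z + 1))\<^sup>2 = (cmod z)\<^sup>2 + 2 * Re z + 1" for z
      unfolding cmod_power2 by (simp add: power2_eq_square algebra_simps)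
    hence Re: "Re (\<tau> x) = Re (\<sigma> x)" using 1 2 by simp
    hence "(Im (\<tau> x))\<^sup>2 = (Im (\<sigma> x))\<^sup>2" using 2 by (simp add: cmod_power2)
    thus ?thesis using Re by (auto simp: power2_eq_iff complex_eq_iff)
  qed
  show ?thesis
  proof (rule ccontr)
    assume neg: "\<not> (\<tau> = \<sigma> \<or> \<tau> = emb_cnj L \<sigma>)"
    obtain x where x: "x \<in> L" "\<tau> x \<noteq> \<sigma> x" using neg embs_eqI[OF \<tau> \<sigma>] by blast
    obtain y where y: "y \<in> L" "\<tau> y \<noteq> cnj (\<sigma> y)"
      using neg embs_eqI[OF \<tau> emb_cnj_in_embs[OF L \<sigma>]] by (auto simp: emb_cnj_def)
    have x': "\<tau> x = cnj (\<sigma> x)" using pointwise[OF x(1)] x(2) by blast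
    have y': "\<tau> y = \<sigma> y" using pointwise[OF y(1)] y(2) by blast
    have "\<tau> (x + y) = \<sigma> (x + y) \<or> \<tau> (x + y) = cnj (\<sigma> (x + y))"
      by (rule pointwise[OF subfield_add[OF L x(1) y(1)]])
    thus False using x y x' y' by (simp add: emb_add[OF L \<sigma> x(1) y(1)] emb_add[OF L \<tau> x(1) y(1)])
  qed
qed

definition place_embs :: "'a::field_char_0 set \<Rightarrow> ('a \<Rightarrow> real) \<Rightarrow> ('a \<Rightarrow> complex) set" where
  "place_embs L w = {\<sigma> \<in> embs L. aval L \<sigma> = w}"

lemma place_embs_aval:
  fixes L :: "'a::field_char_0 set"
  assumes L: "subfield L ambient" and \<sigma>: "\<sigma> \<in> embs L"
  shows "place_embs L (aval L \<sigma>) = {\<sigma>, emb_cnj L \<sigma>}"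
  using aval_eq_cases[OF L \<sigma>] \<sigma> emb_cnj_in_embs[OF L \<sigma>] aval_emb_cnj[of L \<sigma>]
  by (auto simp: place_embs_def)

section \<open>Local degrees\<close>

lemma rational_sequence_tendsto:
  fixes r :: real
  obtains q :: "nat \<Rightarrow> rat" where "(\<lambda>n. of_rat (q n)) \<longlonglongrightarrow> r"
proof -
  have "\<forall>n. \<exists>q. r < of_rat q \<and> of_rat q < r + inverse (real (Suc n))"
  proof
    fix n
    have "r < r + inverse (real (Suc n))" by simp
    thus "\<exists>q. r < of_rat q \<and> of_rat q < r + inverse (real (Suc n))" using of_rat_dense by blast
  qed
  then obtain q where q: "\<And>n. r < of_rat (q n) \<and> of_rat (q n) < r + inverse (real (Suc n))" by metis
  have "(\<lambda>n. r + inverse (real (Suc n))) \<longlonglongrightarrow> r + 0"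
    by (intro tendsto_intros LIMSEQ_inverse_real_of_nat)
  hence "(\<lambda>n. of_rat (q n)) \<longlonglongrightarrow> r"
    by (intro tendsto_sandwich[of "\<lambda>_. r" "\<lambda>n. of_rat (q n)" sequentially "\<lambda>n. r + inverse (real (Suc n))" r])
      (use q in \<open>auto intro!: always_eventually less_imp_le\<close>)
  thus ?thesis by (rule that)
qed

lemma complex_of_rat: "complex_of_real (of_rat q) = of_rat q"
  by (cases q) (simp add: of_rat_rat)

lemma Reals_LIMSEQ:
  fixes f :: "nat \<Rightarrow> complex"
  assumes "\<And>n. f n \<in> \<real>" "f \<longlonglongrightarrow> z" shows "z \<in> \<real>"
proof -
  have "(\<lambda>n. Im (f n)) \<longlonglongrightarrow> Im z" by (rule tendsto_Im[OF assms(2)])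
  moreover have "Im (f n) = 0" for n using assms(1)[of n] by (simp add: complex_is_Real_iff)
  ultimately have "Im z = 0" by (simp add: LIMSEQ_const_iff)
  thus ?thesis by (simp add: complex_is_Real_iff)
qed

lemma subfield_Reals: "subfield (\<real> :: complex set) ambient"
  by (rule subfieldI_type) auto

lemma complex_dimension_Reals: "ring.dimension (ambient :: complex ring) 2 \<real> UNIV"
proof -
  have "amb.dimension 1 \<real> (\<real> :: complex set)" by (rule amb.dimension_one[OF subfield_Reals])
  moreover have "\<i> \<notin> \<real>" by (simp add: complex_is_Real_iff)
  ultimately have "amb.dimension (Suc 1) \<real> (amb.line_extension \<real> \<i> \<real>)" by (intro amb.Suc_dim) auto
  moreover have "amb.line_extension \<real> \<i> \<real> = UNIV"
  proof -
    have "z \<in> amb.line_extension \<real> \<i> \<real>" for z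
      unfolding amb.line_extension_mem_iff
      by (intro bexI[of _ "of_real (Im z)"] bexI[of _ "of_real (Re z)"]) (auto simp: complex_eq_iff)
    thus ?thesis by blast
  qed
  ultimately show ?thesis by (simp add: numeral_2_eq_2)
qed

text \<open>Taking limits of the images under \<open>\<sigma>\<close> maps Cauchy sequences to
  \<complex>, with kernel the null sequences. The completion is thereby identified with the closure
  of the image of \<open>L\<close>, which is \<real> or \<complex>.\<close>

locale emb_completion =
  fixes L :: "'a::field_char_0 set" and \<sigma> :: "'a \<Rightarrow> complex"
  assumes L: "subfield L ambient" and \<sigma>: "\<sigma> \<in> embs L"
begin

abbreviation "w \<equiv> aval L \<sigma>"
abbreviation "R \<equiv> cauchy_ring L w"
abbreviation "S \<equiv> (ambient :: complex ring)"

definition limit_emb :: "(nat \<Rightarrow> 'a) \<Rightarrow> complex" where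
  "limit_emb s = lim (\<lambda>n. \<sigma> (s n))"

lemma mem_R: "s \<in> carrier R \<longleftrightarrow> (\<forall>n. s n \<in> L) \<and> Cauchy (\<lambda>n. \<sigma> (s n))"
proof -
  have "w (s m - s n) = dist (\<sigma> (s m)) (\<sigma> (s n))" if "\<forall>n. s n \<in> L" for m n
    using that by (simp add: subfield_diff[OF L] emb_diff[OF L \<sigma>] dist_norm)
  thus ?thesis unfolding cauchy_ring_def Cauchy_def by auto
qed

lemma R_limit:
  assumes "s \<in> carrier R" shows "(\<lambda>n. \<sigma> (s n)) \<longlonglongrightarrow> limit_emb s"
  using assms unfolding mem_R limit_emb_def by (auto dest!: Cauchy_convergent simp: convergent_LIMSEQ_iff)

lemma mem_RI:
  assumes "\<And>n. s n \<in> L" "(\<lambda>n. \<sigma> (s n)) \<longlonglongrightarrow> z"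
  shows "s \<in> carrier R" and "limit_emb s = z"
  using assms by (auto simp: mem_R limit_emb_def limI intro: LIMSEQ_imp_Cauchy)

lemma R_L: "s \<in> carrier R \<Longrightarrow> s n \<in> L"
  by (simp add: mem_R)

lemma R_ops:
  shows "s \<in> carrier R \<Longrightarrow> t \<in> carrier R \<Longrightarrow>
      (\<lambda>n. s n + t n) \<in> carrier R \<and> limit_emb (\<lambda>n. s n + t n) = limit_emb s + limit_emb t"
    and "s \<in> carrier R \<Longrightarrow> t \<in> carrier R \<Longrightarrow>
      (\<lambda>n. s n * t n) \<in> carrier R \<and> limit_emb (\<lambda>n. s n * t n) = limit_emb s * limit_emb t"
    and "s \<in> carrier R \<Longrightarrow> (\<lambda>n. - s n) \<in> carrier R"
    and "x \<in> L \<Longrightarrow> (\<lambda>n. x) \<in> carrier R \<and> limit_emb (\<lambda>n. x) = \<sigma> x"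
proof -
  assume s: "s \<in> carrier R"
  show "(\<lambda>n. - s n) \<in> carrier R"
  proof (rule mem_RI(1))
    show "(\<lambda>n. \<sigma> (- s n)) \<longlonglongrightarrow> - limit_emb s"
      using tendsto_minus[OF R_limit[OF s]] by (simp add: emb_uminus[OF L \<sigma>] R_L[OF s])
  qed (simp add: R_L[OF s] subfield_uminus[OF L])
  assume t: "t \<in> carrier R"
  have "(\<lambda>n. \<sigma> (s n + t n)) \<longlonglongrightarrow> limit_emb s + limit_emb t"
    using tendsto_add[OF R_limit[OF s] R_limit[OF t]] by (simp add: emb_add[OF L \<sigma>] R_L[OF s] R_L[OF t])
  from mem_RI[OF _ this] show "(\<lambda>n. s n + t n) \<in> carrier R \<and> limit_emb (\<lambda>n. s n + t n) = limit_emb s + limit_emb t"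
    by (simp add: R_L[OF s] R_L[OF t] subfield_add[OF L])
  have "(\<lambda>n. \<sigma> (s n * t n)) \<longlonglongrightarrow> limit_emb s * limit_emb t"
    using tendsto_mult[OF R_limit[OF s] R_limit[OF t]] by (simp add: emb_mult[OF L \<sigma>] R_L[OF s] R_L[OF t])
  from mem_RI[OF _ this] show "(\<lambda>n. s n * t n) \<in> carrier R \<and> limit_emb (\<lambda>n. s n * t n) = limit_emb s * limit_emb t"
    by (simp add: R_L[OF s] R_L[OF t] subfield_mult[OF L])
next
  assume x: "x \<in> L"
  have "(\<lambda>n. \<sigma> x) \<longlonglongrightarrow> \<sigma> x" by simp
  from mem_RI[OF _ this] show "(\<lambda>n. x) \<in> carrier R \<and> limit_emb (\<lambda>n. x) = \<sigma> x" using x by simp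
qed

lemma R_simps:
  "s \<otimes>\<^bsub>R\<^esub> t = (\<lambda>n. s n * t n)" "s \<oplus>\<^bsub>R\<^esub> t = (\<lambda>n. s n + t n)" "\<one>\<^bsub>R\<^esub> = (\<lambda>n. 1)" "\<zero>\<^bsub>R\<^esub> = (\<lambda>n. 0)"
  by (simp_all add: cauchy_ring_def)

lemma R_cring: "cring R"
proof (rule cringI)
  show "abelian_group R"
  proof (rule abelian_groupI)
    fix s assume s: "s \<in> carrier R"
    show "\<exists>t\<in>carrier R. t \<oplus>\<^bsub>R\<^esub> s = \<zero>\<^bsub>R\<^esub>"
      using R_ops(3)[OF s] by (intro bexI[of _ "\<lambda>n. - s n"]) (auto simp: R_simps)
  qed (use R_ops(1) R_ops(4)[OF subfield_zero[OF L]] in \<open>auto simp: R_simps algebra_simps\<close>)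
  show "comm_monoid R"
    by (rule comm_monoidI)
      (use R_ops(2) R_ops(4)[OF subfield_one[OF L]] in \<open>auto simp: R_simps algebra_simps\<close>)
qed (auto simp: R_simps algebra_simps)

lemma limit_emb_hom: "ring_hom_ring R S limit_emb"
proof (rule ring_hom_ringI2)
  show "ring R" by (rule cring.axioms(1)[OF R_cring])
  show "ring S" by (rule ring_from_type_algebra)
  show "limit_emb \<in> Ring.ring_hom R S"
    by (rule ring_hom_memI)
      (use R_ops R_ops(4)[OF subfield_one[OF L]] emb_one[OF L \<sigma>] in \<open>auto simp: R_simps\<close>)
qed

lemma null_ideal_eq: "null_ideal L w = a_kernel R S limit_emb"
proof -
  have "(\<lambda>n. w (s n)) \<longlonglongrightarrow> 0 \<longleftrightarrow> limit_emb s = 0" if s: "s \<in> carrier R" for s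
  proof -
    have "(\<lambda>n. w (s n)) \<longlonglongrightarrow> 0 \<longleftrightarrow> (\<lambda>n. \<sigma> (s n)) \<longlonglongrightarrow> 0"
      using R_L[OF s] by (simp add: tendsto_norm_zero_iff)
    also have "\<dots> \<longleftrightarrow> limit_emb s = 0"
    proof
      assume "(\<lambda>n. \<sigma> (s n)) \<longlonglongrightarrow> 0"
      from LIMSEQ_unique[OF R_limit[OF s] this] show "limit_emb s = 0" .
    next
      assume "limit_emb s = 0"
      thus "(\<lambda>n. \<sigma> (s n)) \<longlonglongrightarrow> 0" using R_limit[OF s] by simp
    qed
    finally show ?thesis .
  qed
  hence "{s \<in> carrier R. (\<lambda>n. w (s n)) \<longlonglongrightarrow> 0} = {s \<in> carrier R. limit_emb s = 0}"
    by (intro Collect_cong conj_cong refl)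
  thus ?thesis unfolding null_ideal_def a_kernel_def' by simp
qed

lemma limit_emb_rational:
  "limit_emb ` {s \<in> carrier R. \<forall>n. s n \<in> \<rat>} = \<real>"
proof (intro equalityI subsetI)
  fix z assume "z \<in> limit_emb ` {s \<in> carrier R. \<forall>n. s n \<in> \<rat>}"
  then obtain s where s: "s \<in> carrier R" "\<And>n. s n \<in> \<rat>" "z = limit_emb s" by blast
  have "\<sigma> (s n) \<in> \<real>" for n using s(2)[of n] by (auto elim!: Rats_cases simp: emb_of_rat[OF L \<sigma>] simp flip: complex_of_rat)
  thus "z \<in> \<real>" unfolding s(3) by (rule Reals_LIMSEQ[OF _ R_limit[OF s(1)]])
next
  fix z :: complex assume "z \<in> \<real>"
  then obtain r where r: "z = of_real r" by (auto elim: Reals_cases)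
  obtain q where q: "(\<lambda>n. of_rat (q n)) \<longlonglongrightarrow> r" by (rule rational_sequence_tendsto)
  have "(\<lambda>n. \<sigma> (of_rat (q n))) \<longlonglongrightarrow> z"
    using tendsto_of_real[OF q, where 'a = complex] by (simp add: emb_of_rat[OF L \<sigma>] r complex_of_rat)
  from mem_RI[OF _ this] show "z \<in> limit_emb ` {s \<in> carrier R. \<forall>n. s n \<in> \<rat>}"
    by (intro image_eqI[of _ _ "\<lambda>n. of_rat (q n)"]) (auto simp: subfield_of_rat[OF L])
qed

text \<open>Limits of rational sequences give all reals. If some \<open>\<sigma> x\<close> is not
  real, the combinations \<open>a + b * \<sigma> x\<close> with real \<open>a\<close> and
  \<open>b\<close> exhaust \<complex>.\<close>

lemma limit_emb_carrier:
  "limit_emb ` carrier R = (if \<sigma> ` L \<subseteq> \<real> then \<real> else UNIV)"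
proof (cases "\<sigma> ` L \<subseteq> \<real>")
  case True
  have "z \<in> \<real>" if z: "z \<in> limit_emb ` carrier R" for z
  proof -
    obtain s where s: "s \<in> carrier R" "z = limit_emb s" using z by blast
    have "\<sigma> (s n) \<in> \<real>" for n using True R_L[OF s(1)] by blast
    thus ?thesis unfolding s(2) by (rule Reals_LIMSEQ[OF _ R_limit[OF s(1)]])
  qed
  thus ?thesis using True limit_emb_rational by auto
next
  case False
  then obtain x where "x \<in> L" "\<sigma> x \<notin> \<real>" by blast
  hence x: "x \<in> L" "Im (\<sigma> x) \<noteq> 0" by (simp_all add: complex_is_Real_iff)
  have "z \<in> limit_emb ` carrier R" for z
  proof -
    define b where "b = Im z / Im (\<sigma> x)"
    define a where "a = Re z - b * Re (\<sigma> x)"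
    have "of_real a \<in> limit_emb ` {s \<in> carrier R. \<forall>n. s n \<in> \<rat>}"
      "of_real b \<in> limit_emb ` {s \<in> carrier R. \<forall>n. s n \<in> \<rat>}"
      unfolding limit_emb_rational by auto
    then obtain s t where s: "s \<in> carrier R" "limit_emb s = of_real a" and t: "t \<in> carrier R" "limit_emb t = of_real b"
      by (metis (no_types, lifting) imageE mem_Collect_eq)
    note c = R_ops(4)[OF x(1)]
    note m = R_ops(2)[OF t(1) conjunct1[OF c]]
    note p = R_ops(1)[OF s(1) conjunct1[OF m]]
    have "limit_emb (\<lambda>n. s n + t n * x) = of_real a + of_real b * \<sigma> x"
      using p m c s t by simp
    also have "\<dots> = z" using x(2) by (simp add: complex_eq_iff a_def b_def)
    finally have "z = limit_emb (\<lambda>n. s n + t n * x)" by (rule sym)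
    thus ?thesis by (rule image_eqI[OF _ conjunct1[OF p]])
  qed
  thus ?thesis using False by auto
qed

text \<open>The first isomorphism theorem identifies the completion with the image of
  \<open>limit_emb\<close>, and under it the rational completion corresponds to \<real>. What
  remains is the dimension of \<real> or \<complex> over \<real>.\<close>

lemma local_degree_eq: "local_degree L w = (if \<sigma> ` L \<subseteq> \<real> then 1 else 2)"
proof -
  interpret h: ring_hom_ring R S limit_emb by (rule limit_emb_hom)
  define Q where "Q = completion L w"
  define S' where "S' = S\<lparr>carrier := limit_emb ` carrier R\<rparr>"
  define ev where "ev = (\<lambda>c. the_elem (limit_emb ` c))"
  have Q: "Q = R Quot a_kernel R S limit_emb" unfolding Q_def completion_def null_ideal_eq ..
  have iso: "ev \<in> ring_iso Q S'"
    unfolding Q S'_def ev_def by (rule h.FactRing_iso_set_aux)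
  have ker: "ideal (a_kernel R S limit_emb) R" by (rule h.kernel_is_ideal)
  have Qring: "ring Q" unfolding Q by (rule ideal.quotient_is_ring[OF ker])
  have S'ring: "ring S'"
    unfolding S'_def
    by (rule amb.subring_is_ring) (rule h.img_is_subring[OF h.R.carrier_is_subring])
  \<comment> \<open>Subfields and dimensions are transported forward along injective homomorphisms,
    so the isomorphism is inverted to carry them from the complex side into the completion.\<close>
  define g where "g = inv_into (carrier Q) ev"
  have g: "g \<in> ring_iso S' Q" unfolding g_def by (rule ring_iso_set_sym[OF Qring iso])
  interpret g: ring_hom_ring S' Q g
    by (rule ring_hom_ringI2[OF S'ring Qring]) (use g in \<open>simp add: ring_iso_def\<close>)
  have bij: "bij_betw ev (carrier Q) (carrier S')" using iso by (simp add: ring_iso_def)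
  have gbij: "bij_betw g (carrier S') (carrier Q)" using g by (simp add: ring_iso_def)
  have ev_coset: "ev (a_kernel R S limit_emb +>\<^bsub>R\<^esub> s) = limit_emb s" if s: "s \<in> carrier R" for s
  proof -
    have "limit_emb ` (a_kernel R S limit_emb +>\<^bsub>R\<^esub> s) = {limit_emb s}"
    proof -
      let ?K = "a_kernel R S limit_emb"
      have "\<zero>\<^bsub>R\<^esub> \<in> ?K" by (rule additive_subgroup.zero_closed[OF ideal.axioms(1)[OF ker]])
      hence "?K \<noteq> {}" by (metis empty_iff)
      have "limit_emb (t \<oplus>\<^bsub>R\<^esub> s) = limit_emb s" if "t \<in> a_kernel R S limit_emb" for t
      proof -
        have t: "t \<in> carrier R" "limit_emb t = 0" using that unfolding a_kernel_def' by simp_all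
        show ?thesis using R_ops(1)[OF t(1) s] t(2) unfolding R_simps by simp
      qed
      hence "(\<Union>t\<in>?K. {limit_emb (t \<oplus>\<^bsub>R\<^esub> s)}) = (\<Union>t\<in>?K. {limit_emb s})"
        by (intro SUP_cong refl arg_cong[of _ _ "\<lambda>z. {z}"])
      also have "\<dots> = {limit_emb s}" by (rule SUP_const[OF \<open>?K \<noteq> {}\<close>])
      finally show ?thesis unfolding a_r_coset_def' image_UN image_insert image_empty .
    qed
    thus ?thesis by (simp add: ev_def)
  qed
  have rat_sub: "rat_completion L w \<subseteq> carrier Q"
    unfolding rat_completion_def null_ideal_eq Q FactRing_def A_RCOSETS_def RCOSETS_def a_r_coset_def by auto
  have ev_rat: "ev ` rat_completion L w = \<real>"
  proof -
    have "ev ` rat_completion L w = limit_emb ` {s \<in> carrier R. \<forall>n. s n \<in> \<rat>}"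
      unfolding rat_completion_def null_ideal_eq image_image by (intro image_cong refl) (auto simp: ev_coset)
    thus ?thesis by (simp add: limit_emb_rational)
  qed
  have g_rat: "g ` \<real> = rat_completion L w"
    unfolding ev_rat[symmetric] g_def using bij rat_sub 
    by (simp add: inv_into_image_cancel bij_betw_def)
  have S'dim: "subfield \<real> S' \<and> ring.dimension S' (if \<sigma> ` L \<subseteq> \<real> then 1 else 2) \<real> (carrier S')"
  proof (cases "\<sigma> ` L \<subseteq> \<real>")
    case True
    hence S': "S' = S\<lparr>carrier := \<real>\<rparr>" unfolding S'_def limit_emb_carrier by simp
    have "field S'" unfolding S' using amb.subfield_iff(2)[OF subfield_Reals] .
    from field.carrier_is_subfield[OF this] have sf: "subfield \<real> S'" by (simp add: S')
    have "ring.dimension S' 1 \<real> \<real>" by (rule ring.dimension_one[OF S'ring sf])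
    thus ?thesis using sf True by (simp add: S')
  next
    case False
    hence "S' = S\<lparr>carrier := UNIV\<rparr>" unfolding S'_def limit_emb_carrier by simp
    hence "S' = S" by (simp add: ring_of_type_algebra_def)
    thus ?thesis using subfield_Reals complex_dimension_Reals False by simp
  qed
  have one_zero: "\<one>\<^bsub>Q\<^esub> \<noteq> \<zero>\<^bsub>Q\<^esub>"
  proof
    assume "\<one>\<^bsub>Q\<^esub> = \<zero>\<^bsub>Q\<^esub>"
    hence "g \<one>\<^bsub>S'\<^esub> = g \<zero>\<^bsub>S'\<^esub>" by simp
    hence "\<one>\<^bsub>S'\<^esub> = \<zero>\<^bsub>S'\<^esub>" using gbij g.R.one_closed g.R.zero_closed by (meson bij_betw_imp_inj_on inj_onD)
    thus False by (simp add: S'_def)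
  qed
  have sf: "subfield (rat_completion L w) Q"
    using g.img_is_subfield(2)[OF conjunct1[OF S'dim] one_zero] by (simp add: g_rat)
  have "ring.dimension Q (if \<sigma> ` L \<subseteq> \<real> then 1 else 2) (g ` \<real>) (g ` carrier S')"
    by (rule g.inj_hom_dimension[OF conjunct1[OF S'dim] one_zero _ conjunct2[OF S'dim]])
      (rule bij_betw_imp_inj_on[OF gbij])
  hence dim: "ring.dimension Q (if \<sigma> ` L \<subseteq> \<real> then 1 else 2) (rat_completion L w) (carrier Q)"
    using bij_betw_imp_surj_on[OF gbij] by (simp add: g_rat)
  show ?thesis using ring.dimI[OF Qring sf dim] unfolding local_degree_def over_def Q_def .
qed

text \<open>The embeddings inducing the place are \<open>\<sigma>\<close> and its conjugate, which
  coincide exactly when \<open>\<sigma>\<close> is real. This links the completion in the definition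
  of the local degree to a count of embeddings.\<close>

lemma card_place_embs: "card (place_embs L w) = local_degree L w"
proof -
  have "\<sigma> = emb_cnj L \<sigma> \<longleftrightarrow> \<sigma> ` L \<subseteq> \<real>"
  proof
    assume eq: "\<sigma> = emb_cnj L \<sigma>"
    show "\<sigma> ` L \<subseteq> \<real>"
    proof safe
      fix x assume "x \<in> L"
      hence "\<sigma> x = cnj (\<sigma> x)" using fun_cong[OF eq, of x] by (simp add: emb_cnj_def)
      thus "\<sigma> x \<in> \<real>" by (simp add: Reals_cnj_iff)
    qed
  next
    assume "\<sigma> ` L \<subseteq> \<real>"
    thus "\<sigma> = emb_cnj L \<sigma>"
      by (intro embs_eqI[OF \<sigma> emb_cnj_in_embs[OF L \<sigma>]]) (auto simp: emb_cnj_def Reals_cnj_iff)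
  qed
  thus ?thesis unfolding place_embs_aval[OF L \<sigma>] local_degree_eq by auto
qed

end

lemma card_place_embs_eq_local_degree:
  fixes L :: "'a::field_char_0 set"
  assumes L: "number_field L" and w: "w \<in> arch_places L"
  shows "card (place_embs L w) = local_degree L w"
proof -
  obtain \<sigma> where \<sigma>: "\<sigma> \<in> embs L" "w = aval L \<sigma>" using w arch_places_eq[OF L] by blast
  show ?thesis unfolding \<sigma>(2)
    by (rule emb_completion.card_place_embs[OF emb_completion.intro[OF number_field_subfield[OF L] \<sigma>(1)]])
qed

section \<open>Units and their logarithms\<close>

lemma emb_ipoly:
  fixes L :: "'a::field_char_0 set"
  assumes L: "subfield L ambient" and \<sigma>: "\<sigma> \<in> embs L" and x: "x \<in> L"
  shows "poly (map_poly of_int p) (\<sigma> x) = \<sigma> (poly (map_poly of_int p) x)"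
proof -
  have "poly (map_poly of_int p) x = (\<Sum>i\<le>Polynomial.degree p. of_int (poly.coeff p i) * x ^ i)"
    for x :: "'b::field_char_0"
    by (simp add: poly_altdef degree_map_poly coeff_map_poly)
  note eq = this
  have "\<sigma> (\<Sum>i\<le>Polynomial.degree p. of_int (poly.coeff p i) * x ^ i) 
      = (\<Sum>i\<le>Polynomial.degree p. \<sigma> (of_int (poly.coeff p i) * x ^ i))"
    by (rule emb_sum[OF L \<sigma>]) (intro subfield_mult[OF L] subfield_of_int[OF L] subfield_power[OF L x])
  also have "\<dots> = (\<Sum>i\<le>Polynomial.degree p. of_int (poly.coeff p i) * \<sigma> x ^ i)"
    by (simp add: emb_mult[OF L \<sigma>] emb_of_int[OF L \<sigma>] emb_power[OF L \<sigma> x] subfield_of_int[OF L] subfield_power[OF L x])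
  finally show ?thesis unfolding eq by simp
qed

lemma algebraic_int_emb_iff:
  fixes L :: "'a::field_char_0 set"
  assumes L: "subfield L ambient" and \<sigma>: "\<sigma> \<in> embs L" and x: "x \<in> L"
  shows "algebraic_int (\<sigma> x) \<longleftrightarrow> algebraic_int x"
proof -
  have "poly (map_poly of_int p) x \<in> L" for p
    unfolding poly_altdef
    by (intro subfield_sum[OF L] subfield_mult[OF L] subfield_power[OF L x]) (simp add: coeff_map_poly subfield_of_int[OF L])
  hence "poly (map_poly of_int p) (\<sigma> x) = 0 \<longleftrightarrow> poly (map_poly of_int p) x = 0" for p
    unfolding emb_ipoly[OF assms] using emb_eq_0_iff[OF L \<sigma>] by blast
  thus ?thesis unfolding algebraic_int_altdef_ipoly by simp
qed

lemma rat_emb_Rats: "q \<in> \<rat> \<Longrightarrow> rat_emb q \<in> \<rat>"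
  by (auto elim!: Rats_cases simp: rat_emb_of_rat)

text \<open>The product is the image of the norm to \<rat>, hence rational, and it is an algebraic
  integer because every conjugate is one.\<close>

lemma prod_embs_Ints:
  fixes L :: "'a::field_char_0 set"
  assumes L: "number_field L" and x: "x \<in> L" "algebraic_int x"
  shows "(\<Prod>\<sigma>\<in>embs L. \<sigma> x) \<in> \<int>"
proof -
  have L': "subfield L ambient" by (rule number_field_subfield[OF L])
  have QL: "\<rat> \<subseteq> L" by (rule Rats_subset_subfield[OF L'])
  note n = field_norm_emb[OF subfield_Rats L' QL number_field_finite_dimension[OF subfield_Rats L QL] x(1) rat_emb_in_embs]
  have "(\<Prod>\<sigma>\<in>embs L. \<sigma> x) \<in> \<rat>"
    using n rat_emb_Rats embs_eq_ext_embs_Rats[OF L'] by metis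
  moreover have "algebraic_int (\<Prod>\<sigma>\<in>embs L. \<sigma> x)"
    by (intro algebraic_int_prod) (simp add: algebraic_int_emb_iff[OF L' _ x(1)] x(2))
  ultimately show ?thesis by (rule rational_algebraic_int_is_int[rotated])
qed

lemma sum_embs_Ints:
  fixes L :: "'a::field_char_0 set"
  assumes L: "number_field L" and x: "x \<in> L" "algebraic_int x"
  shows "(\<Sum>\<sigma>\<in>embs L. \<sigma> x) \<in> \<int>"
proof -
  have L': "subfield L ambient" by (rule number_field_subfield[OF L])
  have QL: "\<rat> \<subseteq> L" by (rule Rats_subset_subfield[OF L'])
  obtain y :: 'a where "y \<in> \<rat>" "rat_emb y = (\<Sum>\<sigma>\<in>ext_embs L \<rat> rat_emb. \<sigma> x)"
    using emb_trace_exists[OF subfield_Rats L' QL number_field_finite_dimension[OF subfield_Rats L QL] x(1) rat_emb_in_embs]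
    by blast
  hence "(\<Sum>\<sigma>\<in>embs L. \<sigma> x) \<in> \<rat>"
    using rat_emb_Rats embs_eq_ext_embs_Rats[OF L'] by metis
  moreover have "algebraic_int (\<Sum>\<sigma>\<in>embs L. \<sigma> x)"
    by (intro algebraic_int_sum) (simp add: algebraic_int_emb_iff[OF L' _ x(1)] x(2))
  ultimately show ?thesis by (rule rational_algebraic_int_is_int[rotated])
qed

section \<open>Finiteness of the set of algebraic integers with bounded conjugates\<close>

lemma common_denominator:
  assumes "finite S" "S \<subseteq> (\<rat> :: 'a::field_char_0 set)"
  shows "\<exists>D::int. D \<noteq> 0 \<and> (\<forall>q\<in>S. of_int D * q \<in> \<int>)"
  using assms
proof (induction S rule: finite_induct)
  case empty
  show ?case by (rule exI[of _ 1]) simp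
next
  case (insert q S)
  then obtain D :: int where D: "D \<noteq> 0" "\<forall>q\<in>S. of_int D * q \<in> \<int>" by auto
  have "q \<in> \<rat>" using insert.prems by simp
  then obtain a b :: int where ab: "b > 0" "q = of_int a / of_int b" by (auto elim: Rats_cases')
  have "of_int (D * b) * q = of_int (D * a)" using ab by simp
  hence "of_int (D * b) * q \<in> \<int>" by (metis Ints_of_int)
  moreover have "of_int (D * b) * p \<in> \<int>" if "p \<in> S" for p
  proof -
    have "of_int (D * b) * p = of_int b * (of_int D * p)" by simp
    also have "\<dots> \<in> \<int>" by (rule Ints_mult[OF Ints_of_int]) (use D(2) that in blast)
    finally show ?thesis .
  qed
  ultimately show ?case using D(1) ab(1) by (intro exI[of _ "D * b"]) auto
qed

text \<open>With \<open>D\<close> a common denominator of the matrix of multiplication by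
  \<open>y\<close>, the element \<open>D * y\<close> maps the \<int>-span of the basis into
  itself.\<close>

lemma algebraic_int_multiple:
  fixes L :: "'a::field_char_0 set"
  assumes L: "number_field L" and y: "y \<in> L"
  shows "\<exists>D::int. D \<noteq> 0 \<and> algebraic_int (of_int D * y)"
proof -
  have L': "subfield L ambient" by (rule number_field_subfield[OF L])
  have QL: "\<rat> \<subseteq> L" by (rule Rats_subset_subfield[OF L'])
  obtain bs where bs: "amb.independent \<rat> bs" "amb.Span \<rat> bs = L" "length bs > 0"
    using number_field_extension_basis[OF subfield_Rats L QL] .
  have fb: "field_basis \<rat> L bs" by (rule field_basis_if_independent_Span[OF subfield_Rats bs(1,2)])
  let ?n = "length bs"
  obtain A where A: "\<And>i j. i < ?n \<Longrightarrow> j < ?n \<Longrightarrow> A i j \<in> \<rat>"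
    "\<And>j. j < ?n \<Longrightarrow> y * bs ! j = (\<Sum>i<?n. A i j * bs ! i)"
    using mult_matrix_exists[OF subfield_Rats L' fb y] by blast
  have "\<exists>D::int. D \<noteq> 0 \<and> (\<forall>q\<in>(\<lambda>(i, j). A i j) ` ({..<?n} \<times> {..<?n}). of_int D * q \<in> \<int>)"
    by (rule common_denominator) (use A in auto)
  then obtain D :: int where D: "D \<noteq> 0" "\<And>i j. i < ?n \<Longrightarrow> j < ?n \<Longrightarrow> of_int D * A i j \<in> \<int>" by auto
  have "algebraic_int (of_int D * y)"
  proof (rule algebraic_int_if_int_span_closed[of "set bs" "bs ! 0"])
    show "bs ! 0 \<in> set bs" using bs(3) by simp
    show "bs ! 0 \<noteq> 0"
    proof
      assume 0: "bs ! 0 = 0"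
      let ?c = "\<lambda>i::nat. if i = 0 then 1 else 0 :: 'a"
      have "(\<Sum>i<?n. ?c i * bs ! i) = 0" using 0 by (intro sum.neutral) auto
      hence "?c 0 = 0" using bs(3) by (intro field_basis_independent[OF fb, where c = ?c and i = 0]) auto
      thus False by simp
    qed
    fix s assume "s \<in> set bs"
    then obtain j where j: "j < ?n" "s = bs ! j" by (auto simp: in_set_conv_nth)
    have "\<forall>i. \<exists>e. i < ?n \<longrightarrow> of_int D * A i j = of_int e" using D(2)[OF _ j(1)] by (auto elim: Ints_cases)
    then obtain e where e: "\<And>i. i < ?n \<Longrightarrow> of_int D * A i j = of_int (e i)" by metis
    have "of_int D * y * s = of_int D * (\<Sum>i<?n. A i j * bs ! i)" using A(2)[OF j(1)] j(2) by (simp add: mult.assoc)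
    also have "\<dots> = (\<Sum>i<?n. (of_int D * A i j) * bs ! i)" by (simp add: sum_distrib_left mult.assoc)
    also have "\<dots> = (\<Sum>i<?n. of_int (e i) * bs ! i)" by (simp add: e)
    also have "\<dots> \<in> int_span (set bs)" by (rule int_span_sum) (auto intro: int_span_base)
    finally show "of_int D * y * s \<in> int_span (set bs)" .
  qed simp
  thus ?thesis using D(1) by blast
qed

text \<open>An algebraic integer is determined by the traces of its products with an integral basis.\<close>

lemma finite_bounded_algebraic_ints:
  fixes L :: "'a::field_char_0 set"
  assumes L: "number_field L"
  shows "finite {x \<in> L. algebraic_int x \<and> (\<forall>\<sigma>\<in>embs L. cmod (\<sigma> x) \<le> B)}" (is "finite ?X")
proof -
  have L': "subfield L ambient" by (rule number_field_subfield[OF L])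
  have QL: "\<rat> \<subseteq> L" by (rule Rats_subset_subfield[OF L'])
  obtain bs where bs: "amb.independent \<rat> bs" "amb.Span \<rat> bs = L"
    using number_field_extension_basis[OF subfield_Rats L QL] .
  have fb: "field_basis \<rat> L bs" by (rule field_basis_if_independent_Span[OF subfield_Rats bs])
  let ?n = "length bs"
  have bsL: "bs ! j \<in> L" if "j < ?n" for j by (rule field_basis_mem[OF fb that])
  have "\<forall>j. \<exists>D::int. j < ?n \<longrightarrow> D \<noteq> 0 \<and> algebraic_int (of_int D * bs ! j)"
    using algebraic_int_multiple[OF L bsL] by blast
  then obtain D :: "nat \<Rightarrow> int" where D: "\<And>j. j < ?n \<Longrightarrow> D j \<noteq> 0" "\<And>j. j < ?n \<Longrightarrow> algebraic_int (of_int (D j) * bs ! j)"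
    by metis
  define c where "c = (\<lambda>j. of_int (D j) * bs ! j)"
  have cL: "c j \<in> L" if "j < ?n" for j
    unfolding c_def by (intro subfield_mult[OF L'] subfield_of_int[OF L'] bsL that)
  \<comment> \<open>The traces of the \<open>x * c j\<close>. For \<open>x\<close> in the set in
    question they are integers bounded by \<open>M\<close>, so \<open>T\<close> takes finitely many
    values there; the absolute value of \<open>B\<close> covers negative bounds.\<close>
  define T where "T = (\<lambda>x. \<lambda>j\<in>{..<?n}. \<Sum>\<sigma>\<in>embs L. \<sigma> (x * c j))"
  define M where "M = (\<Sum>j<?n. \<Sum>\<sigma>\<in>embs L. \<bar>B\<bar> * cmod (\<sigma> (c j)))"
  define Z where "Z = (of_int :: int \<Rightarrow> complex) ` {- \<lceil>M\<rceil>..\<lceil>M\<rceil>}"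
  have T_in: "T ` ?X \<subseteq> PiE {..<?n} (\<lambda>_. Z)"
  proof (rule image_subsetI)
    fix x assume "x \<in> ?X"
    hence x: "x \<in> L" "algebraic_int x" "\<forall>\<sigma>\<in>embs L. cmod (\<sigma> x) \<le> B" by blast+
    show "T x \<in> PiE {..<?n} (\<lambda>_. Z)"
      unfolding T_def
    proof (rule restrict_PiE_iff[THEN iffD2], rule ballI)
      fix j assume "j \<in> {..<?n}"
      hence j: "j < ?n" by simp
      have "(\<Sum>\<sigma>\<in>embs L. \<sigma> (x * c j)) \<in> \<int>"
        by (rule sum_embs_Ints[OF L subfield_mult[OF L' x(1) cL[OF j]]])
          (use x(2) D(2)[OF j] in \<open>auto simp: c_def intro: algebraic_int_mult\<close>)
      then obtain m where m: "(\<Sum>\<sigma>\<in>embs L. \<sigma> (x * c j)) = of_int m" by (auto elim: Ints_cases)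
      have "real_of_int \<bar>m\<bar> = cmod (\<Sum>\<sigma>\<in>embs L. \<sigma> (x * c j))" unfolding m by simp
      also have "\<dots> \<le> (\<Sum>\<sigma>\<in>embs L. cmod (\<sigma> (x * c j)))" by (rule norm_sum)
      also have "\<dots> \<le> (\<Sum>\<sigma>\<in>embs L. \<bar>B\<bar> * cmod (\<sigma> (c j)))"
      proof (rule sum_mono)
        fix \<sigma> assume \<sigma>: "\<sigma> \<in> embs L"
        have "cmod (\<sigma> (x * c j)) = cmod (\<sigma> x) * cmod (\<sigma> (c j))"
          by (simp add: emb_mult[OF L' \<sigma> x(1) cL[OF j]] norm_mult)
        also have "\<dots> \<le> \<bar>B\<bar> * cmod (\<sigma> (c j))" using x(3) \<sigma> by (intro mult_right_mono) force+
        finally show "cmod (\<sigma> (x * c j)) \<le> \<bar>B\<bar> * cmod (\<sigma> (c j))" .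
      qed
      also have "\<dots> \<le> M" unfolding M_def using j
        by (intro member_le_sum[of j "{..<?n}" "\<lambda>j. \<Sum>\<sigma>\<in>embs L. \<bar>B\<bar> * cmod (\<sigma> (c j))"]) (auto intro!: sum_nonneg)
      finally have "\<bar>m\<bar> \<le> \<lceil>M\<rceil>" by linarith
      thus "(\<Sum>\<sigma>\<in>embs L. \<sigma> (x * c j)) \<in> Z" unfolding m Z_def by (intro imageI) auto
    qed
  qed
  \<comment> \<open>Equal traces mean that the conjugates of \<open>x - y\<close> solve the
    homogeneous system given by the conjugates of the basis, so they vanish.\<close>
  have "inj_on T ?X"
  proof (rule inj_onI)
    fix x y assume "x \<in> ?X" "y \<in> ?X" and eq: "T x = T y"
    hence xy: "x \<in> L" "y \<in> L" by auto
    interpret eb: emb_basis \<rat> L bs rat_emb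
      by (rule emb_basis.intro[OF subfield_Rats L' QL bs rat_emb_in_embs])
    obtain t where t: "bij_betw t {..<?n} (ext_embs L \<rat> rat_emb)" using eb.obtain_enum .
    have "(\<Sum>i<?n. t i (bs ! j) * t i (x - y)) = 0" if j: "j < ?n" for j
    proof -
      have "(\<Sum>\<sigma>\<in>embs L. \<sigma> (x * c j)) = (\<Sum>\<sigma>\<in>embs L. \<sigma> (y * c j))"
        using fun_cong[OF eq, of j] j by (simp add: T_def)
      hence "0 = (\<Sum>\<sigma>\<in>embs L. \<sigma> (x * c j) - \<sigma> (y * c j))" by (simp add: sum_subtractf)
      also have "\<dots> = (\<Sum>\<sigma>\<in>embs L. of_int (D j) * (\<sigma> (bs ! j) * \<sigma> (x - y)))"
      proof (intro sum.cong refl)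
        fix \<sigma> assume \<sigma>: "\<sigma> \<in> embs L"
        have "\<sigma> (c j) = of_int (D j) * \<sigma> (bs ! j)"
          unfolding c_def by (simp add: emb_mult[OF L' \<sigma> subfield_of_int[OF L'] bsL[OF j]] emb_of_int[OF L' \<sigma>])
        thus "\<sigma> (x * c j) - \<sigma> (y * c j) = of_int (D j) * (\<sigma> (bs ! j) * \<sigma> (x - y))"
          by (simp add: emb_mult[OF L' \<sigma> xy(1) cL[OF j]] emb_mult[OF L' \<sigma> xy(2) cL[OF j]] emb_diff[OF L' \<sigma> xy] algebra_simps)
      qed
      also have "\<dots> = of_int (D j) * (\<Sum>\<sigma>\<in>embs L. \<sigma> (bs ! j) * \<sigma> (x - y))" by (simp add: sum_distrib_left)
      finally have "(\<Sum>\<sigma>\<in>embs L. \<sigma> (bs ! j) * \<sigma> (x - y)) = 0" using D(1)[OF j] by simp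
      thus ?thesis unfolding embs_eq_ext_embs_Rats[OF L'] by (subst sum.reindex_bij_betw[OF t])
    qed
    hence 0: "t i (x - y) = 0" if "i < ?n" for i
      using ext_embs_vanish[OF subfield_Rats L' QL fb, where m = ?n and t = t and \<sigma> = rat_emb and c = "\<lambda>i. t i (x - y)" and i = i]
        eb.t_ext[OF t] t that by (simp add: bij_betw_def)
    obtain \<sigma> where \<sigma>: "\<sigma> \<in> embs L" using embs_nonempty[OF L] by blast
    then obtain i where "i < ?n" "t i = \<sigma>"
      using bij_betw_imp_surj_on[OF t] unfolding embs_eq_ext_embs_Rats[OF L'] by (metis imageE lessThan_iff)
    hence "\<sigma> (x - y) = 0" using 0 by blast
    thus "x = y" using emb_eq_0_iff[OF L' \<sigma> subfield_diff[OF L' xy]] by simp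
  qed
  moreover have "finite (T ` ?X)"
    by (rule finite_subset[OF T_in]) (auto intro!: finite_PiE simp: Z_def)
  ultimately show ?thesis using finite_imageD by blast
qed

section \<open>Logarithm vectors, the product formula and Kronecker's theorem\<close>

definition units :: "'a::field_char_0 set \<Rightarrow> 'a set" where
  "units L = carrier (unit_group L)"

lemma unit_group_simps:
  "x \<otimes>\<^bsub>unit_group L\<^esub> y = x * y" "\<one>\<^bsub>unit_group L\<^esub> = 1"
  by (simp_all add: unit_group_def units_of_def integers_ring_def ring_of_type_algebra_def)

lemma units_iff:
  fixes L :: "'a::field_char_0 set"
  assumes L: "subfield L ambient"
  shows "u \<in> units L \<longleftrightarrow> u \<in> L \<and> u \<noteq> 0 \<and> algebraic_int u \<and> algebraic_int (inverse u)"
proof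
  assume "u \<in> units L"
  then obtain v where u: "u \<in> L" "algebraic_int u" and v: "algebraic_int v" "u * v = 1"
    by (auto simp: units_def unit_group_def units_of_def Units_def integers_ring_def)
  have "v = inverse u" using v(2) by (simp add: inverse_unique)
  thus "u \<in> L \<and> u \<noteq> 0 \<and> algebraic_int u \<and> algebraic_int (inverse u)" using u v by auto
next
  assume u: "u \<in> L \<and> u \<noteq> 0 \<and> algebraic_int u \<and> algebraic_int (inverse u)"
  show "u \<in> units L"
    using u subfield_inverse[OF L, of u]
    by (auto simp: units_def unit_group_def units_of_def Units_def integers_ring_def intro!: bexI[of _ "inverse u"])
qed

text \<open>The local degree is the weight that turns values at places into sums over embeddings.
  The value 0 off the archimedean places lets equality of functions mean equality at all
  places.\<close>

definition log_vec :: "'a::field_char_0 set \<Rightarrow> 'a \<Rightarrow> ('a \<Rightarrow> real) \<Rightarrow> real" where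
  "log_vec L u = (\<lambda>w. if w \<in> arch_places L then real (local_degree L w) * ln (w u) else 0)"

context
  fixes L :: "'a::field_char_0 set"
  assumes L: "number_field L"
begin

lemma L': "subfield L ambient"
  by (rule number_field_subfield[OF L])

lemma units_mult: "u \<in> units L \<Longrightarrow> v \<in> units L \<Longrightarrow> u * v \<in> units L"
  using subfield_mult[OF L'] by (auto simp: units_iff[OF L'] intro: algebraic_int_mult)

lemma units_one: "1 \<in> units L"
  using subfield_one[OF L'] by (auto simp: units_iff[OF L'])

lemma units_inverse: "u \<in> units L \<Longrightarrow> inverse u \<in> units L"
  using subfield_inverse[OF L'] by (auto simp: units_iff[OF L'])

lemma units_power: "u \<in> units L \<Longrightarrow> u ^ n \<in> units L"
  by (induction n) (auto intro: units_one units_mult)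

lemma units_mem: "u \<in> units L \<Longrightarrow> u \<in> L" and units_nonzero: "u \<in> units L \<Longrightarrow> u \<noteq> 0"
  by (auto simp: units_iff[OF L'])

lemma unit_group_comm_group: "comm_group (unit_group L)"
proof (rule comm_groupI)
  fix u assume u: "u \<in> carrier (unit_group L)"
  show "\<exists>v\<in>carrier (unit_group L). v \<otimes>\<^bsub>unit_group L\<^esub> u = \<one>\<^bsub>unit_group L\<^esub>"
    using units_inverse[of u] units_nonzero[of u] u
    by (intro bexI[of _ "inverse u"]) (auto simp: unit_group_simps units_def)
qed (use units_mult units_one in \<open>auto simp: unit_group_simps units_def\<close>)

lemma place_unit_pos:
  assumes "u \<in> units L" "w \<in> arch_places L" shows "w u > 0"
  using absval_nonneg[OF L' arch_place_absval[OF assms(2)] units_mem[OF assms(1)]]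
    absval_eq_0[OF L' arch_place_absval[OF assms(2)] units_mem[OF assms(1)]] units_nonzero[OF assms(1)] by linarith

text \<open>Each of the \<open>local_degree L w\<close> embeddings inducing \<open>w\<close>
  contributes \<open>ln (w u)\<close>. In this form norms and the product formula can be
  computed.\<close>

lemma log_vec_eq_sum:
  assumes u: "u \<in> L" and w: "w \<in> arch_places L"
  shows "log_vec L u w = (\<Sum>\<sigma>\<in>place_embs L w. ln (cmod (\<sigma> u)))"
proof -
  have "ln (cmod (\<sigma> u)) = ln (w u)" if "\<sigma> \<in> place_embs L w" for \<sigma>
    using that u by (auto simp: place_embs_def)
  hence "(\<Sum>\<sigma>\<in>place_embs L w. ln (cmod (\<sigma> u))) = (\<Sum>\<sigma>\<in>place_embs L w. ln (w u))" by (rule sum.cong[OF refl])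
  thus ?thesis using w by (simp add: log_vec_def card_place_embs_eq_local_degree[OF L w])
qed

lemma log_vec_mult:
  assumes "u \<in> units L" "v \<in> units L"
  shows "log_vec L (u * v) = (\<lambda>w. log_vec L u w + log_vec L v w)"
proof
  fix w
  show "log_vec L (u * v) w = log_vec L u w + log_vec L v w"
  proof (cases "w \<in> arch_places L")
    case True
    show ?thesis using True place_unit_pos[OF assms(1) True] place_unit_pos[OF assms(2) True]
      by (simp add: log_vec_def absval_mult[OF L' arch_place_absval[OF True] units_mem[OF assms(1)] units_mem[OF assms(2)]]
          ln_mult distrib_left)
  qed (simp add: log_vec_def)
qed

lemma log_vec_one: "log_vec L 1 = (\<lambda>_. 0)"
proof -
  have "log_vec L 1 = (\<lambda>w. log_vec L 1 w + log_vec L 1 w)"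
    using log_vec_mult[OF units_one units_one] by simp
  hence "log_vec L 1 w = 0" for w by (metis add_cancel_right_right)
  thus ?thesis by blast
qed

lemma log_vec_power: "u \<in> units L \<Longrightarrow> log_vec L (u ^ n) = (\<lambda>w. of_nat n * log_vec L u w)"
  by (induction n) (simp_all add: log_vec_one log_vec_mult units_power algebra_simps)

lemma log_vec_inverse:
  assumes u: "u \<in> units L" shows "log_vec L (inverse u) = (\<lambda>w. - log_vec L u w)"
proof -
  have "(\<lambda>_. 0) = (\<lambda>w. log_vec L u w + log_vec L (inverse u) w)"
    using log_vec_mult[OF u units_inverse[OF u]] units_nonzero[OF u] by (simp add: log_vec_one)
  hence "0 = log_vec L u w + log_vec L (inverse u) w" for w by meson
  thus ?thesis by (simp add: eq_neg_iff_add_eq_0 add.commute fun_eq_iff)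
qed

text \<open>Product formula: the sum is the logarithm of the modulus of the norm to \<rat>, and the
  norms of \<open>u\<close> and of its inverse are integers with product 1.\<close>

lemma sum_log_vec:
  assumes u: "u \<in> units L" shows "(\<Sum>w\<in>arch_places L. log_vec L u w) = 0"
proof -
  have uL: "u \<in> L" and iL: "inverse u \<in> L" using units_mem u units_inverse by auto
  have "(\<Sum>w\<in>arch_places L. log_vec L u w) = (\<Sum>w\<in>arch_places L. \<Sum>\<sigma>\<in>{\<sigma>\<in>embs L. aval L \<sigma> = w}. ln (cmod (\<sigma> u)))"
    by (intro sum.cong refl) (simp add: log_vec_eq_sum[OF uL] place_embs_def)
  also have "\<dots> = (\<Sum>\<sigma>\<in>embs L. ln (cmod (\<sigma> u)))"
    by (rule sum.group[OF finite_embs[OF L] finite_arch_places[OF L]]) (simp add: arch_places_eq[OF L])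
  also have "\<dots> = ln (\<Prod>\<sigma>\<in>embs L. cmod (\<sigma> u))"
    by (rule ln_prod[symmetric]) (use finite_embs[OF L] emb_eq_0_iff[OF L' _ uL] units_nonzero[OF u] in auto)
  also have "(\<Prod>\<sigma>\<in>embs L. cmod (\<sigma> u)) = 1"
  proof -
    obtain m where m: "(\<Prod>\<sigma>\<in>embs L. \<sigma> u) = of_int m"
      using prod_embs_Ints[OF L uL] u by (auto simp: units_iff[OF L'] elim: Ints_cases)
    obtain n where n: "(\<Prod>\<sigma>\<in>embs L. \<sigma> (inverse u)) = of_int n"
      using prod_embs_Ints[OF L iL] u by (auto simp: units_iff[OF L'] elim: Ints_cases)
    have "(\<Prod>\<sigma>\<in>embs L. \<sigma> u) * (\<Prod>\<sigma>\<in>embs L. \<sigma> (inverse u)) = (\<Prod>\<sigma>\<in>embs L. \<sigma> u * \<sigma> (inverse u))"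
      by (simp add: prod.distrib)
    also have "\<dots> = 1"
    proof (rule prod.neutral, rule ballI)
      fix \<sigma> assume \<sigma>: "\<sigma> \<in> embs L"
      show "\<sigma> u * \<sigma> (inverse u) = 1"
        using emb_inverse[OF L' \<sigma> uL] emb_eq_0_iff[OF L' \<sigma> uL] units_nonzero[OF u] by simp
    qed
    finally have "of_int (m * n) = (1 :: complex)" by (simp add: m n)
    hence "m * n = 1" using of_int_eq_1_iff by blast
    hence "\<bar>m\<bar> = 1" by (metis abs_mult_pos' zmult_eq_1_iff abs_1 abs_minus_cancel)
    moreover have "(\<Prod>\<sigma>\<in>embs L. cmod (\<sigma> u)) = cmod (of_int m)" unfolding m[symmetric] by (rule prod_norm)
    ultimately show ?thesis by simp
  qed
  finally show ?thesis by simp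
qed

lemma local_degree_pos:
  assumes w: "w \<in> arch_places L" shows "local_degree L w > 0"
proof -
  obtain \<sigma> where "\<sigma> \<in> embs L" "w = aval L \<sigma>" using w arch_places_eq[OF L] by blast
  hence "place_embs L w \<noteq> {}" by (auto simp: place_embs_def)
  moreover have "finite (place_embs L w)" using finite_embs[OF L] by (simp add: place_embs_def)
  ultimately show ?thesis unfolding card_place_embs_eq_local_degree[OF L w, symmetric] by (simp add: card_gt_0_iff)
qed

text \<open>Local degrees are at least 1, so bounded weighted logarithms bound all conjugates by
  \<open>exp B\<close>. This finiteness is what makes the logarithm lattice discrete.\<close>

lemma finite_bounded_units: "finite {u \<in> units L. \<forall>w\<in>arch_places L. \<bar>log_vec L u w\<bar> \<le> B}"
proof (rule finite_subset[OF _ finite_bounded_algebraic_ints[OF L, of "exp B"]], safe)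
  fix u assume u: "u \<in> units L" "\<forall>w\<in>arch_places L. \<bar>log_vec L u w\<bar> \<le> B"
  show "u \<in> L" "algebraic_int u" using u by (auto simp: units_iff[OF L'])
  fix \<sigma> assume \<sigma>: "\<sigma> \<in> embs L"
  have w: "aval L \<sigma> \<in> arch_places L" by (rule aval_arch_place[OF L' \<sigma>])
  let ?d = "real (local_degree L (aval L \<sigma>))"
  have pos: "cmod (\<sigma> u) > 0" using place_unit_pos[OF u(1) w] units_mem[OF u(1)] by simp
  have d: "?d \<ge> 1" using local_degree_pos[OF w] by simp
  have "?d * ln (cmod (\<sigma> u)) \<le> B" "0 \<le> B"
    using u(2)[rule_format, OF w] w units_mem[OF u(1)] by (auto simp: log_vec_def)
  hence "ln (cmod (\<sigma> u)) \<le> B"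
  proof (cases "ln (cmod (\<sigma> u)) \<le> 0")
    case False
    hence "1 * ln (cmod (\<sigma> u)) \<le> ?d * ln (cmod (\<sigma> u))" using d by (intro mult_right_mono) auto
    thus ?thesis using \<open>?d * ln (cmod (\<sigma> u)) \<le> B\<close> by linarith
  qed linarith
  thus "cmod (\<sigma> u) \<le> exp B" using pos by (metis exp_le_cancel_iff exp_ln)
qed

text \<open>Kronecker: the powers of a unit with vanishing logarithms form a finite set.\<close>

lemma log_vec_zero_iff_torsion:
  assumes u: "u \<in> units L"
  shows "log_vec L u = (\<lambda>_. 0) \<longleftrightarrow> (\<exists>n>0. u ^ n = 1)"
proof
  assume "\<exists>n>0. u ^ n = 1"
  then obtain n where n: "n > 0" "u ^ n = 1" by blast
  hence "(\<lambda>w. of_nat n * log_vec L u w) = (\<lambda>_. 0)" using log_vec_power[OF u, of n] by (simp add: log_vec_one)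
  hence "of_nat n * log_vec L u w = 0" for w by meson
  thus "log_vec L u = (\<lambda>_. 0)" using n(1) by auto
next
  assume 0: "log_vec L u = (\<lambda>_. 0)"
  have "range (\<lambda>n. u ^ n) \<subseteq> {u \<in> units L. \<forall>w\<in>arch_places L. \<bar>log_vec L u w\<bar> \<le> 0}"
    using units_power[OF u] log_vec_power[OF u] 0 by auto
  hence "finite (range (\<lambda>n. u ^ n))" using finite_subset finite_bounded_units by blast
  hence "\<not> inj (\<lambda>n. u ^ n)" using finite_imageD infinite_UNIV_nat by blast
  then obtain i j where "u ^ i = u ^ j" "i < j" by (metis injI linorder_neqE_nat)
  hence "u ^ i * u ^ (j - i) = u ^ i * 1" using power_add[of u i "j - i"] by simp
  hence "u ^ (j - i) = 1" using units_nonzero[OF u] by simp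
  thus "\<exists>n>0. u ^ n = 1" using \<open>i < j\<close> by (intro exI[of _ "j - i"]) auto
qed

end

section \<open>Groups with an additive coordinate map\<close>

text \<open>Common setting for the units modulo torsion of \<open>k\<close> and of \<open>l\<close>
  and for the relative units. The coordinate map is an injective homomorphism, so independence and
  bases can be tested in the lattice that is its image.\<close>

locale log_group = comm_group G for G :: "('g, 'b) monoid_scheme" (structure) +
  fixes lg :: "'g \<Rightarrow> 'w \<Rightarrow> real"
  assumes lg_mult: "x \<in> carrier G \<Longrightarrow> y \<in> carrier G \<Longrightarrow> lg (x \<otimes> y) = (\<lambda>w. lg x w + lg y w)"
    and lg_eq_zeroD: "x \<in> carrier G \<Longrightarrow> lg x = (\<lambda>_. 0) \<Longrightarrow> x = \<one>"
begin

lemma lg_one: "lg \<one> = (\<lambda>_. 0)"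
proof
  fix w
  show "lg \<one> w = 0" using fun_cong[OF lg_mult[OF one_closed one_closed], of w] by simp
qed

lemma lg_inv: assumes "x \<in> carrier G" shows "lg (inv x) w = - lg x w"
  using fun_cong[OF lg_mult[OF assms inv_closed[OF assms]], of w] assms by (simp add: lg_one)

lemma lg_nat_pow: "x \<in> carrier G \<Longrightarrow> lg (x [^] (n::nat)) w = of_nat n * lg x w"
  by (induction n) (simp_all add: lg_one lg_mult algebra_simps)

lemma lg_int_pow:
  assumes x: "x \<in> carrier G" shows "lg (x [^] (e::int)) w = of_int e * lg x w"
proof (cases "e < 0")
  case True
  have "lg (x [^] e) w = - (of_nat (nat (- e)) * lg x w)"
    unfolding int_pow_def2 using True by (simp only: if_True lg_inv[OF nat_pow_closed[OF x]] lg_nat_pow[OF x])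
  thus ?thesis using True by simp
next
  case False
  have "lg (x [^] e) w = of_nat (nat e) * lg x w"
    unfolding int_pow_def2 using False by (simp only: if_False lg_nat_pow[OF x])
  thus ?thesis using False by simp
qed

lemma lg_finprod:
  assumes "finite I" "f \<in> I \<rightarrow> carrier G" shows "lg (finprod G f I) w = (\<Sum>i\<in>I. lg (f i) w)"
  using assms by (induction I rule: finite_induct) (simp_all add: lg_one lg_mult Pi_iff)

lemma lg_inj:
  assumes x: "x \<in> carrier G" and y: "y \<in> carrier G" and eq: "lg x = lg y" shows "x = y"
proof -
  have "lg (x \<otimes> inv y) = (\<lambda>_. 0)"
    using lg_mult[OF x inv_closed[OF y]] by (simp add: lg_inv[OF y] eq)
  hence "x \<otimes> inv y = \<one>" using lg_eq_zeroD x y by simp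
  thus ?thesis using inv_solve_right'[of \<one> x y] x y by simp
qed

lemma lg_comb:
  assumes "finite I" "x \<in> I \<rightarrow> carrier G"
  shows "lg (finprod G (\<lambda>i. x i [^] (e i :: int)) I) = (\<lambda>w. \<Sum>i\<in>I. of_int (e i) * lg (x i) w)"
proof
  fix w
  have "(\<lambda>i. x i [^] e i) \<in> I \<rightarrow> carrier G" using assms(2) by auto
  thus "lg (finprod G (\<lambda>i. x i [^] e i) I) w = (\<Sum>i\<in>I. of_int (e i) * lg (x i) w)"
    using assms by (subst lg_finprod) (auto intro!: sum.cong lg_int_pow)
qed

lemma mult_independent_iff:
  "mult_independent G I x \<longleftrightarrow> finite I \<and> x \<in> I \<rightarrow> carrier G \<and>
     (\<forall>e. (\<forall>w. (\<Sum>i\<in>I. of_int (e i) * lg (x i) w) = 0) \<longrightarrow> (\<forall>i\<in>I. e i = 0))"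
proof (cases "finite I \<and> x \<in> I \<rightarrow> carrier G")
  case True
  have "finprod G (\<lambda>i. x i [^] (e i :: int)) I = \<one> \<longleftrightarrow> (\<forall>w. (\<Sum>i\<in>I. of_int (e i) * lg (x i) w) = 0)" for e
  proof -
    let ?P = "finprod G (\<lambda>i. x i [^] (e i :: int)) I"
    have "?P \<in> carrier G" using True by (intro finprod_closed) auto
    hence "?P = \<one> \<longleftrightarrow> lg ?P = (\<lambda>_. 0)" using lg_eq_zeroD[of ?P] lg_one by metis
    also have "\<dots> \<longleftrightarrow> (\<forall>w. (\<Sum>i\<in>I. of_int (e i) * lg (x i) w) = 0)"
      using True by (simp add: lg_comb fun_eq_iff)
    finally show ?thesis .
  qed
  thus ?thesis using True unfolding mult_independent_def by simp
qed (auto simp: mult_independent_def)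

lemma add_subgroup_lg: "add_subgroup (lg ` carrier G)"
  unfolding add_subgroup_def
proof (intro conjI ballI)
  show "(\<lambda>_. 0) \<in> lg ` carrier G" by (rule image_eqI[of _ _ \<one>]) (simp_all add: lg_one)
  fix f g assume "f \<in> lg ` carrier G" "g \<in> lg ` carrier G"
  then obtain x y where xy: "x \<in> carrier G" "y \<in> carrier G" "f = lg x" "g = lg y" by (elim imageE) simp
  have "lg (x \<otimes> inv y) = (\<lambda>w. f w - g w)"
    using lg_mult[OF xy(1) inv_closed[OF xy(2)]] by (simp add: lg_inv xy)
  thus "(\<lambda>w. f w - g w) \<in> lg ` carrier G"
    by (intro image_eqI[of _ _ "x \<otimes> inv y"]) (simp_all add: xy)
qed

lemma lat_basis_if_group_basis:
  assumes "group_basis G us"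
  shows "lat_basis (lg ` carrier G) (length us) (\<lambda>i. lg (us ! i))"
proof -
  let ?n = "length us"
  have ind: "mult_independent G {..<?n} (\<lambda>i. us ! i)" and gen: "generate G (set us) = carrier G"
    using assms by (auto simp: group_basis_def)
  have us: "us ! i \<in> carrier G" if "i < ?n" for i using ind that by (auto simp: mult_independent_def)
  have "\<exists>e::nat \<Rightarrow> int. \<forall>w. lg g w = (\<Sum>i<?n. of_int (e i) * lg (us ! i) w)" if "g \<in> generate G (set us)" for g
    using that
  proof (induction g rule: generate.induct)
    case one
    show ?case by (rule exI[of _ "\<lambda>_. 0"]) (simp add: lg_one)
  next
    case (incl h)
    then obtain j where j: "j < ?n" "h = us ! j" by (auto simp: in_set_conv_nth)
    have "lg h w = (\<Sum>i<?n. of_int (if i = j then 1 else 0) * lg (us ! i) w)" for w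
    proof -
      have "(\<Sum>i<?n. of_int (if i = j then 1 else 0) * lg (us ! i) w) = (\<Sum>i<?n. if i = j then lg (us ! i) w else 0)"
        by (intro sum.cong) auto
      thus ?thesis using j by simp
    qed
    thus ?case by (intro exI[of _ "\<lambda>i. if i = j then 1 else 0"]) simp
  next
    case (inv h)
    then obtain j where j: "j < ?n" "h = us ! j" by (auto simp: in_set_conv_nth)
    have "lg (inv h) w = (\<Sum>i<?n. of_int (if i = j then - 1 else 0) * lg (us ! i) w)" for w
    proof -
      have "(\<Sum>i<?n. of_int (if i = j then - 1 else 0) * lg (us ! i) w) = (\<Sum>i<?n. if i = j then - lg (us ! i) w else 0)"
        by (intro sum.cong) auto
      thus ?thesis using j us[OF j(1)] by (simp add: lg_inv)
    qed
    thus ?case by (intro exI[of _ "\<lambda>i. if i = j then - 1 else 0"]) simp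
  next
    case (eng h1 h2)
    then obtain e1 e2 :: "nat \<Rightarrow> int" where e: "\<forall>w. lg h1 w = (\<Sum>i<?n. of_int (e1 i) * lg (us ! i) w)"
      "\<forall>w. lg h2 w = (\<Sum>i<?n. of_int (e2 i) * lg (us ! i) w)" by blast
    have "h1 \<in> carrier G" "h2 \<in> carrier G" using eng.hyps gen by auto
    hence "lg (h1 \<otimes> h2) w = (\<Sum>i<?n. of_int (e1 i + e2 i) * lg (us ! i) w)" for w
      using e by (simp add: lg_mult distrib_right sum.distrib)
    thus ?case by (intro exI[of _ "\<lambda>i. e1 i + e2 i"]) simp
  qed
  hence "\<forall>g\<in>lg ` carrier G. \<exists>e::nat \<Rightarrow> int. \<forall>w. g w = (\<Sum>i<?n. of_int (e i) * lg (us ! i) w)"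
    unfolding gen by simp
  moreover have "int_independent ?n (\<lambda>i. lg (us ! i))"
    using ind unfolding mult_independent_iff int_independent_def by auto
  ultimately show ?thesis using us unfolding lat_basis_def by auto
qed

text \<open>Preimages of a lattice basis form a group basis. This turns discreteness into the
  existence of the bases that the regulators choose from.\<close>

lemma group_basis_if_lat_basis:
  assumes b: "lat_basis (lg ` carrier G) n b"
  shows "\<exists>us. group_basis G us"
proof -
  define u where "u = (\<lambda>i. SOME x. x \<in> carrier G \<and> lg x = b i)"
  have u: "u i \<in> carrier G" "lg (u i) = b i" if "i < n" for i
  proof -
    have "\<exists>x. x \<in> carrier G \<and> lg x = b i" using lat_basis_mem[OF b that] by (elim imageE) auto
    from someI_ex[OF this] show "u i \<in> carrier G" "lg (u i) = b i" unfolding u_def by auto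
  qed
  define us where "us = map u [0..<n]"
  have us: "length us = n" "\<And>i. i < n \<Longrightarrow> us ! i = u i" by (simp_all add: us_def)
  have set_us: "set us \<subseteq> carrier G" using u(1) by (auto simp: us_def)
  have "mult_independent G {..<n} (\<lambda>i. us ! i)"
    unfolding mult_independent_iff
  proof (intro conjI allI impI ballI)
    fix e :: "nat \<Rightarrow> int" and i
    assume e: "\<forall>w. (\<Sum>i<n. of_int (e i) * lg (us ! i) w) = 0" and i: "i \<in> {..<n}"
    have "(\<Sum>i<n. of_int (e i) * b i w) = 0" for w using e[rule_format, of w] us u by simp
    thus "e i = 0" using int_independentD[OF lat_basis_independent[OF b], of e i] i by simp
  qed (use u us in auto)
  moreover have "generate G (set us) = carrier G"
  proof (rule antisym)
    show "generate G (set us) \<subseteq> carrier G" by (rule generate_incl[OF set_us])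
    show "carrier G \<subseteq> generate G (set us)"
    proof
      fix g assume g: "g \<in> carrier G"
      obtain e :: "nat \<Rightarrow> int" where e: "\<And>w. lg g w = (\<Sum>i<n. of_int (e i) * b i w)"
        using lat_basis_generates[OF b imageI[OF g]] by blast
      let ?P = "\<lambda>m. finprod G (\<lambda>i. u i [^] e i) {..<m}"
      interpret H: subgroup "generate G (set us)" G by (rule generate_is_subgroup[OF set_us])
      have "m \<le> n \<Longrightarrow> ?P m \<in> generate G (set us)" for m
      proof (induction m)
        case (Suc m)
        have "u m \<in> generate G (set us)" using Suc.prems by (intro generate.incl) (auto simp: us_def)
        hence "u m [^] e m \<in> generate G (set us)"
          by (rule subgroup_int_pow_closed[OF H.subgroup_axioms])
        thus ?case using Suc u(1) by (simp add: lessThan_Suc Pi_iff)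
      qed simp
      moreover have "g = ?P n"
      proof (rule lg_inj[OF g])
        show "?P n \<in> carrier G" using u(1) by (intro finprod_closed) auto
        have "lg (?P n) = (\<lambda>w. \<Sum>i<n. of_int (e i) * lg (u i) w)" using u(1) by (intro lg_comb) auto
        thus "lg g = lg (?P n)" using e u(2) by (simp add: fun_eq_iff)
      qed
      ultimately show "g \<in> generate G (set us)" by simp
    qed
  qed
  ultimately have "group_basis G us" unfolding group_basis_def us(1) by simp
  thus ?thesis ..
qed

lemma log_group_subgroup:
  assumes H: "subgroup H G" shows "log_group (G\<lparr>carrier := H\<rparr>) lg"
proof -
  interpret H: subgroup H G by (rule H)
  have "group (G\<lparr>carrier := H\<rparr>)" by (rule subgroup_imp_group[OF H])
  hence "comm_group (G\<lparr>carrier := H\<rparr>)"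
    by (rule group.group_comm_groupI) (simp add: m_comm)
  thus ?thesis
    by (rule log_group.intro) (unfold_locales, auto simp: lg_mult intro: lg_eq_zeroD)
qed

end

section \<open>Units modulo torsion\<close>

definition unit_coset :: "'a::field_char_0 set \<Rightarrow> 'a \<Rightarrow> 'a set" where
  "unit_coset L u = torsion (unit_group L) #>\<^bsub>unit_group L\<^esub> u"

definition F_log :: "'a::field_char_0 set \<Rightarrow> 'a set \<Rightarrow> ('a \<Rightarrow> real) \<Rightarrow> real" where
  "F_log L A = (\<lambda>w. if w \<in> arch_places L then real (local_degree L w) * ln (F_abs w A) else 0)"

lemma image_eq_singletonI: "x \<in> A \<Longrightarrow> (\<And>y. y \<in> A \<Longrightarrow> f y = c) \<Longrightarrow> f ` A = {c}"
  by auto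

lemma unit_group_pow: "x [^]\<^bsub>unit_group L\<^esub> (n::nat) = x ^ n"
  by (induction n) (simp_all add: nat_pow_def unit_group_simps mult.commute)

lemma mem_unit_coset: "x \<in> unit_coset L u \<longleftrightarrow> (\<exists>t\<in>torsion (unit_group L). x = t * u)"
  by (auto simp: unit_coset_def r_coset_def unit_group_simps)

context
  fixes L :: "'a::field_char_0 set"
  assumes L: "number_field L"
begin

interpretation U: comm_group "unit_group L"
  by (rule unit_group_comm_group[OF L])

lemma torsion_iff: "t \<in> torsion (unit_group L) \<longleftrightarrow> t \<in> units L \<and> log_vec L t = (\<lambda>_. 0)"
  unfolding torsion_def unit_group_pow unit_group_simps units_def[symmetric]
  by (simp add: log_vec_zero_iff_torsion[OF L] cong: conj_cong)

lemma one_mem_torsion: "1 \<in> torsion (unit_group L)"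
  by (simp add: torsion_iff units_one[OF L] log_vec_one[OF L])

lemma subgroup_torsion: "subgroup (torsion (unit_group L)) (unit_group L)"
proof (rule U.subgroupI)
  show "torsion (unit_group L) \<subseteq> carrier (unit_group L)" by (auto simp: torsion_def)
  show "torsion (unit_group L) \<noteq> {}" using one_mem_torsion by blast
  fix a assume a: "a \<in> torsion (unit_group L)"
  hence "a \<in> units L" by (simp add: torsion_iff)
  hence "inv\<^bsub>unit_group L\<^esub> a = inverse a"
    using units_inverse[OF L] units_nonzero[OF L]
    by (intro U.inv_equality) (auto simp: unit_group_simps units_def)
  thus "inv\<^bsub>unit_group L\<^esub> a \<in> torsion (unit_group L)"
    using a by (simp add: torsion_iff units_inverse[OF L] log_vec_inverse[OF L])
  fix b assume "b \<in> torsion (unit_group L)"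
  thus "a \<otimes>\<^bsub>unit_group L\<^esub> b \<in> torsion (unit_group L)"
    using a by (simp add: torsion_iff unit_group_simps units_mult[OF L] log_vec_mult[OF L])
qed

lemma normal_torsion: "torsion (unit_group L) \<lhd> unit_group L"
  by (rule U.subgroup_imp_normal[OF subgroup_torsion])

lemma carrier_units_mod_tor: "carrier (units_mod_tor L) = unit_coset L ` units L"
  unfolding units_mod_tor_def FactGroup_def RCOSETS_def unit_coset_def units_def by auto

lemma unit_coset_mult:
  assumes "u \<in> units L" "v \<in> units L"
  shows "unit_coset L u \<otimes>\<^bsub>units_mod_tor L\<^esub> unit_coset L v = unit_coset L (u * v)"
  using normal.rcos_sum[OF normal_torsion, of u v] assms
  by (simp add: units_mod_tor_def FactGroup_def unit_coset_def units_def unit_group_simps)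

lemma absval_torsion:
  assumes w: "absolute_value L w" and t: "t \<in> torsion (unit_group L)" shows "w t = 1"
proof -
  obtain n where n: "t \<in> units L" "n > 0" "t ^ n = 1"
    using t by (auto simp: torsion_def unit_group_pow unit_group_simps units_def)
  have tL: "t \<in> L" by (rule units_mem[OF L n(1)])
  have "w t ^ n = 1" using absval_power[OF number_field_subfield[OF L] w tL, of n] n(3)
      absval_one[OF number_field_subfield[OF L] w] by simp
  thus ?thesis
    using power_eq_imp_eq_base[of "w t" n 1] n(2) absval_nonneg[OF number_field_subfield[OF L] w tL] by simp
qed

lemma absval_unit_coset:
  assumes w: "absolute_value L w" and u: "u \<in> units L" and x: "x \<in> unit_coset L u"
  shows "w x = w u"
proof -
  obtain t where t: "t \<in> torsion (unit_group L)" "x = t * u" using x by (auto simp: mem_unit_coset)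
  have "t \<in> L" using t(1) units_mem[OF L] by (simp add: torsion_iff)
  thus ?thesis unfolding t(2)
    using absval_mult[OF number_field_subfield[OF L] w _ units_mem[OF L u]] absval_torsion[OF w t(1)] by simp
qed

lemma unit_coset_self: "u \<in> unit_coset L u"
  using one_mem_torsion by (auto simp: mem_unit_coset)

lemma F_abs_unit_coset:
  assumes w: "absolute_value L w" and u: "u \<in> units L" shows "F_abs w (unit_coset L u) = w u"
proof -
  have "w ` unit_coset L u = {w u}"
    by (rule image_eq_singletonI[OF unit_coset_self absval_unit_coset[OF w u]])
  thus ?thesis by (simp add: F_abs_def)
qed

text \<open>All absolute values are constant on a coset of the torsion subgroup, so
  \<open>the_elem\<close> yields the height of a representative. That is a sum of nonnegative terms;
  the default value 0 of a non-summable \<open>infsum\<close> is nonnegative too.\<close>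

lemma F_height_nonneg:
  assumes A: "A \<in> carrier (units_mod_tor L)" shows "F_height L A \<ge> 0"
proof -
  obtain u where u: "u \<in> units L" "A = unit_coset L u" using A by (auto simp: carrier_units_mod_tor)
  have "weil_height L x = weil_height L u" if x: "x \<in> A" for x
    unfolding weil_height_def
  proof (rule infsum_cong)
    fix w assume "w \<in> arch_places L \<union> finite_places L"
    hence "absolute_value L w" by (auto simp: arch_places_def finite_places_def)
    from absval_unit_coset[OF this u(1)] x u(2) have "w x = w u" by simp
    thus "ln (max 1 (w x powr (real (local_degree L w) / real (field_degree L)))) =
          ln (max 1 (w u powr (real (local_degree L w) / real (field_degree L))))" by simp
  qed
  moreover have "u \<in> A" unfolding u(2) by (rule unit_coset_self)
  ultimately have "weil_height L ` A = {weil_height L u}" by (intro image_eq_singletonI)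
  hence "F_height L A = weil_height L u" by (simp add: F_height_def)
  also have "\<dots> \<ge> 0" unfolding weil_height_def by (intro infsum_nonneg) simp
  finally show ?thesis .
qed

lemma F_log_unit_coset: "u \<in> units L \<Longrightarrow> F_log L (unit_coset L u) = log_vec L u"
  by (auto simp: F_log_def log_vec_def F_abs_unit_coset[OF arch_place_absval])

lemma log_group_units_mod_tor: "log_group (units_mod_tor L) (F_log L)"
proof (rule log_group.intro)
  show "comm_group (units_mod_tor L)"
    unfolding units_mod_tor_def by (rule U.abelian_FactGroup[OF subgroup_torsion])
  show "log_group_axioms (units_mod_tor L) (F_log L)"
  proof
    fix x y assume "x \<in> carrier (units_mod_tor L)" "y \<in> carrier (units_mod_tor L)"
    then obtain u v where "u \<in> units L" "v \<in> units L" "x = unit_coset L u" "y = unit_coset L v"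
      by (auto simp: carrier_units_mod_tor)
    thus "F_log L (x \<otimes>\<^bsub>units_mod_tor L\<^esub> y) = (\<lambda>w. F_log L x w + F_log L y w)"
      by (simp add: unit_coset_mult F_log_unit_coset units_mult[OF L] log_vec_mult[OF L])
  next
    fix x assume "x \<in> carrier (units_mod_tor L)" and 0: "F_log L x = (\<lambda>_. 0)"
    then obtain u where u: "u \<in> units L" "x = unit_coset L u" by (auto simp: carrier_units_mod_tor)
    hence "u \<in> torsion (unit_group L)" using 0 by (simp add: torsion_iff F_log_unit_coset)
    hence "x = torsion (unit_group L)"
      unfolding u(2) unit_coset_def using u(1) by (intro U.coset_join2 subgroup_torsion) (simp_all add: units_def)
    thus "x = \<one>\<^bsub>units_mod_tor L\<^esub>" by (simp add: units_mod_tor_def FactGroup_def)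
  qed
qed

lemma F_log_image: "F_log L ` carrier (units_mod_tor L) = log_vec L ` units L"
  unfolding carrier_units_mod_tor image_image by (intro image_cong refl) (simp add: F_log_unit_coset)

text \<open>The properties that the existence of a basis and the covolume inequality ask of a
  logarithm lattice.\<close>

lemma log_lattice:
  shows "add_subgroup (log_vec L ` units L)"
    and "f \<in> log_vec L ` units L \<Longrightarrow> w \<notin> arch_places L \<Longrightarrow> f w = 0"
    and "finite {f \<in> log_vec L ` units L. \<forall>w\<in>arch_places L. \<bar>f w\<bar> \<le> B}"
    and "f \<in> log_vec L ` units L \<Longrightarrow> (\<Sum>w\<in>arch_places L. f w) = 0"
proof -
  show "add_subgroup (log_vec L ` units L)"
    using log_group.add_subgroup_lg[OF log_group_units_mod_tor] by (simp add: F_log_image)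
  show "f \<in> log_vec L ` units L \<Longrightarrow> w \<notin> arch_places L \<Longrightarrow> f w = 0"
    by (auto simp: log_vec_def)
  show "f \<in> log_vec L ` units L \<Longrightarrow> (\<Sum>w\<in>arch_places L. f w) = 0"
    using sum_log_vec[OF L] by auto
  have "{f \<in> log_vec L ` units L. \<forall>w\<in>arch_places L. \<bar>f w\<bar> \<le> B}
      \<subseteq> log_vec L ` {u \<in> units L. \<forall>w\<in>arch_places L. \<bar>log_vec L u w\<bar> \<le> B}" by auto
  thus "finite {f \<in> log_vec L ` units L. \<forall>w\<in>arch_places L. \<bar>f w\<bar> \<le> B}"
    by (rule finite_subset) (rule finite_imageI[OF finite_bounded_units[OF L]])
qed

end

section \<open>Relative units\<close>

text \<open>On logarithm vectors this is the norm, see \<open>rel_sum_log_vec\<close>; being linear,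
  it is easier to handle than \<open>F_norm\<close>.\<close>

definition rel_sum :: "'a::field_char_0 set \<Rightarrow> 'a set \<Rightarrow> (('a \<Rightarrow> real) \<Rightarrow> real) \<Rightarrow> ('a \<Rightarrow> real) \<Rightarrow> real" where
  "rel_sum l k = (\<lambda>f v. if v \<in> arch_places k then (\<Sum>w\<in>{w \<in> arch_places l. restrict w k = v}. f w) else 0)"

lemma rel_sum_add: "rel_sum l k (\<lambda>w. f w + g w) = (\<lambda>v. rel_sum l k f v + rel_sum l k g v)"
  by (auto simp: rel_sum_def sum.distrib)

lemma rel_sum_uminus: "rel_sum l k (\<lambda>w. - f w) = (\<lambda>v. - rel_sum l k f v)"
  by (auto simp: rel_sum_def sum_negf)

lemma rel_sum_zero: "rel_sum l k (\<lambda>_. 0) = (\<lambda>_. 0)"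
  by (auto simp: rel_sum_def)

lemma rel_sum_comb: "rel_sum l k (\<lambda>w. \<Sum>i\<in>I. e i * f i w) v = (\<Sum>i\<in>I. e i * rel_sum l k (f i) v)"
  by (auto simp: rel_sum_def sum_distrib_left intro: sum.swap)

section \<open>The norm on units and on their logarithms\<close>

locale field_extension =
  fixes k l :: "'a::field_char_0 set"
  assumes k: "number_field k" and l: "number_field l" and kl: "k \<subseteq> l"
begin

lemma k': "subfield k ambient" and l': "subfield l ambient"
  using k l number_field_subfield by auto

lemma norm_emb:
  assumes "u \<in> l" "\<sigma> \<in> embs k"
  shows "field_norm l k u \<in> k" "\<sigma> (field_norm l k u) = (\<Prod>\<tau>\<in>ext_embs l k \<sigma>. \<tau> u)"
  using field_norm_emb[OF k' l' kl number_field_finite_dimension[OF k' l kl] assms] by auto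

lemma norm_mem: "u \<in> l \<Longrightarrow> field_norm l k u \<in> k"
  using norm_emb(1) embs_nonempty[OF k] by blast

text \<open>Checked after applying one embedding of \<open>k\<close>: it is injective and turns the
  norm into a product over extensions, which is multiplicative.\<close>

lemma norm_mult:
  assumes u: "u \<in> l" and v: "v \<in> l"
  shows "field_norm l k (u * v) = field_norm l k u * field_norm l k v"
proof -
  obtain \<sigma> where \<sigma>: "\<sigma> \<in> embs k" using embs_nonempty[OF k] by blast
  have uv: "u * v \<in> l" by (rule subfield_mult[OF l' u v])
  have "\<sigma> (field_norm l k (u * v)) = (\<Prod>\<tau>\<in>ext_embs l k \<sigma>. \<tau> u * \<tau> v)"
    unfolding norm_emb(2)[OF uv \<sigma>]
    by (intro prod.cong refl) (simp add: ext_embs_def emb_mult[OF l' _ u v])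
  also have "\<dots> = \<sigma> (field_norm l k u * field_norm l k v)"
    by (simp add: prod.distrib norm_emb(2)[OF u \<sigma>] norm_emb(2)[OF v \<sigma>] emb_mult[OF k' \<sigma> norm_mem[OF u] norm_mem[OF v]])
  finally show ?thesis
    using emb_eq_iff[OF k' \<sigma> norm_mem[OF uv] subfield_mult[OF k' norm_mem[OF u] norm_mem[OF v]]] by simp
qed

text \<open>\<open>d\<close> is the common number of extensions of the embeddings of
  \<open>k\<close>, that is [l : k]; each extension contributes one factor
  \<open>\<sigma> u\<close>.\<close>

lemma norm_base:
  obtains d where "d > 0" "\<And>u. u \<in> k \<Longrightarrow> field_norm l k u = u ^ d"
proof -
  obtain d where d: "d > 0" "\<And>\<sigma>. \<sigma> \<in> embs k \<Longrightarrow> card (ext_embs l k \<sigma>) = d"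
    using card_ext_embs_const[OF k' l kl] by blast
  have "field_norm l k u = u ^ d" if u: "u \<in> k" for u
  proof -
    obtain \<sigma> where \<sigma>: "\<sigma> \<in> embs k" using embs_nonempty[OF k] by blast
    have ul: "u \<in> l" using u kl by blast
    have "\<sigma> (field_norm l k u) = (\<Prod>\<tau>\<in>ext_embs l k \<sigma>. \<sigma> u)"
      unfolding norm_emb(2)[OF ul \<sigma>] by (intro prod.cong refl) (simp add: ext_embs_def u)
    also have "\<dots> = \<sigma> (u ^ d)" by (simp add: d(2)[OF \<sigma>] emb_power[OF k' \<sigma> u])
    finally show ?thesis using emb_eq_iff[OF k' \<sigma> norm_mem[OF ul] subfield_power[OF k' u]] by simp
  qed
  thus ?thesis using that d(1) by blast
qed

lemma norm_one: "field_norm l k 1 = 1"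
  using norm_base subfield_one[OF k'] by (metis power_one)

lemma algebraic_int_norm:
  assumes u: "u \<in> l" "algebraic_int u" shows "algebraic_int (field_norm l k u)"
proof -
  obtain \<sigma> where \<sigma>: "\<sigma> \<in> embs k" using embs_nonempty[OF k] by blast
  have "algebraic_int (\<sigma> (field_norm l k u))"
    unfolding norm_emb(2)[OF u(1) \<sigma>]
    by (intro algebraic_int_prod) (simp add: ext_embs_def algebraic_int_emb_iff[OF l' _ u(1)] u(2))
  thus ?thesis using algebraic_int_emb_iff[OF k' \<sigma> norm_mem[OF u(1)]] by simp
qed

lemma norm_units:
  assumes u: "u \<in> units l" shows "field_norm l k u \<in> units k"
proof -
  have u': "u \<in> l" "inverse u \<in> l" "algebraic_int u" "algebraic_int (inverse u)" "u \<noteq> 0"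
    using u subfield_inverse[OF l'] by (auto simp: units_iff[OF l'])
  have *: "field_norm l k u * field_norm l k (inverse u) = 1"
    using norm_mult[OF u'(1,2)] u'(5) norm_one by simp
  hence "inverse (field_norm l k u) = field_norm l k (inverse u)" by (rule inverse_unique)
  thus ?thesis using * algebraic_int_norm[OF u'(1,3)] algebraic_int_norm[OF u'(2,4)] norm_mem[OF u'(1)]
    by (auto simp: units_iff[OF k'])
qed

lemma units_subset: "units k \<subseteq> units l"
  using kl by (auto simp: units_iff[OF k'] units_iff[OF l'])

lemma restrict_arch_place:
  assumes w: "w \<in> arch_places l" shows "restrict w k \<in> arch_places k"
proof -
  have "absolute_value k (restrict w k)"
    using arch_place_absval[OF w] kl subfield_add[OF k'] subfield_mult[OF k']
    unfolding absolute_value_def by (auto simp: subset_iff)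
  thus ?thesis using arch_place_of_rat[OF w] subfield_of_rat[OF k'] by (simp add: arch_places_def)
qed

text \<open>The place comes from an embedding of \<open>k\<close>, and any extension of that
  embedding to \<open>l\<close> induces a place above it.\<close>

lemma arch_place_extends:
  assumes v: "v \<in> arch_places k" shows "\<exists>w\<in>arch_places l. restrict w k = v"
proof -
  obtain \<sigma> where \<sigma>: "\<sigma> \<in> embs k" "v = aval k \<sigma>" using v arch_places_eq[OF k] by blast
  obtain \<tau> where \<tau>: "\<tau> \<in> ext_embs l k \<sigma>" using ext_embs_nonempty[OF k' l kl \<sigma>(1)] by blast
  hence \<tau>': "\<tau> \<in> embs l" "\<And>x. x \<in> k \<Longrightarrow> \<tau> x = \<sigma> x" by (auto simp: ext_embs_def)
  have "restrict (aval l \<tau>) k = v" unfolding \<sigma>(2) using kl \<tau>'(2) by (auto simp: aval_def fun_eq_iff)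
  thus ?thesis using aval_arch_place[OF l' \<tau>'(1)] by blast
qed

text \<open>Both sides are the sum of \<open>ln (cmod (\<tau> u))\<close> over the embeddings
  \<open>\<tau>\<close> of \<open>l\<close> lying above \<open>v\<close>. Grouping them by the place
  of \<open>l\<close> that they induce gives the left side, grouping them by their restriction to
  \<open>k\<close> gives the norm.\<close>

lemma rel_sum_log_vec:
  assumes u: "u \<in> units l" shows "rel_sum l k (log_vec l u) = log_vec k (field_norm l k u)"
proof
  fix v
  show "rel_sum l k (log_vec l u) v = log_vec k (field_norm l k u) v"
  proof (cases "v \<in> arch_places k")
    case True
    have ul: "u \<in> l" by (rule units_mem[OF l u])
    define T where "T = {\<tau> \<in> embs l. restrict (aval l \<tau>) k = v}"
    have finT: "finite T" unfolding T_def using finite_embs[OF l] by simp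
    have restr: "aval k (restrict \<tau> k) = restrict (aval l \<tau>) k" for \<tau>
      using kl by (auto simp: aval_def fun_eq_iff)
    have "rel_sum l k (log_vec l u) v = (\<Sum>w\<in>{w \<in> arch_places l. restrict w k = v}. \<Sum>\<tau>\<in>{\<tau> \<in> T. aval l \<tau> = w}. ln (cmod (\<tau> u)))"
      unfolding rel_sum_def using True
      by (auto simp: log_vec_eq_sum[OF l ul] place_embs_def T_def intro!: sum.cong)
    also have "\<dots> = (\<Sum>\<tau>\<in>T. ln (cmod (\<tau> u)))"
      by (rule sum.group[OF finT]) (use finite_arch_places[OF l] aval_arch_place[OF l'] in \<open>auto simp: T_def\<close>)
    also have "\<dots> = (\<Sum>\<sigma>\<in>place_embs k v. \<Sum>\<tau>\<in>{\<tau> \<in> T. restrict \<tau> k = \<sigma>}. ln (cmod (\<tau> u)))"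
    proof (rule sum.group[symmetric, OF finT])
      show "finite (place_embs k v)" using finite_embs[OF k] by (simp add: place_embs_def)
      show "(\<lambda>\<tau>. restrict \<tau> k) ` T \<subseteq> place_embs k v"
        using restrict_emb[OF kl k'] restr by (auto simp: T_def place_embs_def)
    qed
    also have "\<dots> = (\<Sum>\<sigma>\<in>place_embs k v. ln (cmod (\<sigma> (field_norm l k u))))"
    proof (rule sum.cong[OF refl])
      fix \<sigma> assume "\<sigma> \<in> place_embs k v"
      hence \<sigma>: "\<sigma> \<in> embs k" "aval k \<sigma> = v" by (auto simp: place_embs_def)
      have eq: "{\<tau> \<in> T. restrict \<tau> k = \<sigma>} = ext_embs l k \<sigma>"
      proof (intro equalityI subsetI)
        fix \<tau> assume "\<tau> \<in> {\<tau> \<in> T. restrict \<tau> k = \<sigma>}"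
        thus "\<tau> \<in> ext_embs l k \<sigma>" by (auto simp: T_def ext_embs_def)
      next
        fix \<tau> assume \<tau>: "\<tau> \<in> ext_embs l k \<sigma>"
        hence \<tau>': "\<tau> \<in> embs l" "\<And>x. x \<in> k \<Longrightarrow> \<tau> x = \<sigma> x" by (auto simp: ext_embs_def)
        have "restrict \<tau> k = \<sigma>"
          by (rule embs_eqI[OF restrict_emb[OF kl k' \<tau>'(1)] \<sigma>(1)]) (simp add: \<tau>'(2))
        thus "\<tau> \<in> {\<tau> \<in> T. restrict \<tau> k = \<sigma>}" using \<tau>'(1) restr[of \<tau>] \<sigma>(2) by (auto simp: T_def)
      qed
      have "cmod (\<sigma> (field_norm l k u)) = (\<Prod>\<tau>\<in>ext_embs l k \<sigma>. cmod (\<tau> u))"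
        unfolding norm_emb(2)[OF ul \<sigma>(1)] by (rule prod_norm[symmetric])
      moreover have "ln (\<Prod>\<tau>\<in>ext_embs l k \<sigma>. cmod (\<tau> u)) = (\<Sum>\<tau>\<in>ext_embs l k \<sigma>. ln (cmod (\<tau> u)))"
      proof (rule ln_prod[OF finite_ext_embs[OF k' l kl]])
        fix \<tau> assume "\<tau> \<in> ext_embs l k \<sigma>"
        hence "\<tau> u \<noteq> 0" using emb_eq_0_iff[OF l' _ ul, of \<tau>] units_nonzero[OF l u] by (simp add: ext_embs_def)
        thus "cmod (\<tau> u) \<noteq> 0" by simp
      qed
      ultimately have "ln (cmod (\<sigma> (field_norm l k u))) = (\<Sum>\<tau>\<in>ext_embs l k \<sigma>. ln (cmod (\<tau> u)))" by simp
      thus "(\<Sum>\<tau>\<in>{\<tau> \<in> T. restrict \<tau> k = \<sigma>}. ln (cmod (\<tau> u))) = ln (cmod (\<sigma> (field_norm l k u)))"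
        unfolding eq by simp
    qed
    also have "\<dots> = log_vec k (field_norm l k u) v"
      by (rule log_vec_eq_sum[OF k norm_mem[OF ul] True, symmetric])
    finally show ?thesis .
  qed (simp add: rel_sum_def log_vec_def)
qed

lemma torsion_subset: "torsion (unit_group k) \<subseteq> torsion (unit_group l)"
  using units_subset by (auto simp: torsion_def unit_group_pow unit_group_simps units_def)

lemma norm_torsion:
  assumes "t \<in> torsion (unit_group l)" shows "field_norm l k t \<in> torsion (unit_group k)"
proof -
  have t: "t \<in> units l" "log_vec l t = (\<lambda>_. 0)" using assms by (auto simp: torsion_iff[OF l])
  have "log_vec k (field_norm l k t) = (\<lambda>_. 0)"
    using rel_sum_log_vec[OF t(1)] t(2) rel_sum_zero by metis
  thus ?thesis using norm_units[OF t(1)] by (simp add: torsion_iff[OF k])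
qed

lemma torsion_mult:
  assumes L: "number_field L" and st: "s \<in> torsion (unit_group L)" "t \<in> torsion (unit_group L)"
  shows "s * t \<in> torsion (unit_group L)"
  using st by (simp add: torsion_iff[OF L] units_mult[OF L] log_vec_mult[OF L])

text \<open>Norms of torsion units are torsion, so multiplying the image of a coset by the torsion
  of \<open>k\<close> fills exactly one coset.\<close>

lemma F_norm_unit_coset:
  assumes u: "u \<in> units l" shows "F_norm l k (unit_coset l u) = unit_coset k (field_norm l k u)"
proof (intro equalityI subsetI)
  fix x assume "x \<in> F_norm l k (unit_coset l u)"
  then obtain t s where t: "t \<in> torsion (unit_group k)" and s: "s \<in> torsion (unit_group l)"
    and x: "x = t * field_norm l k (s * u)"
    by (auto simp: F_norm_def set_mult_def unit_group_simps mem_unit_coset)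
  have "s \<in> l" using s units_mem[OF l] by (simp add: torsion_iff[OF l])
  hence "x = (t * field_norm l k s) * field_norm l k u"
    unfolding x using norm_mult[OF _ units_mem[OF l u]] by (simp add: mult.assoc)
  thus "x \<in> unit_coset k (field_norm l k u)"
    unfolding mem_unit_coset using torsion_mult[OF k t norm_torsion[OF s]] by blast
next
  fix x assume "x \<in> unit_coset k (field_norm l k u)"
  then obtain t where "t \<in> torsion (unit_group k)" "x = t * field_norm l k u" by (auto simp: mem_unit_coset)
  thus "x \<in> F_norm l k (unit_coset l u)"
    using unit_coset_self[OF l, of u] by (auto simp: F_norm_def set_mult_def unit_group_simps)
qed

lemma F_embed_unit_coset: "F_embed l (unit_coset k b) = unit_coset l b"
proof (intro equalityI subsetI)
  fix x assume "x \<in> F_embed l (unit_coset k b)"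
  then obtain t s where t: "t \<in> torsion (unit_group l)" and s: "s \<in> torsion (unit_group k)"
    and x: "x = t * (s * b)"
    by (auto simp: F_embed_def set_mult_def unit_group_simps mem_unit_coset)
  have "t * s \<in> torsion (unit_group l)" using torsion_mult[OF l t] torsion_subset s by blast
  thus "x \<in> unit_coset l b" unfolding mem_unit_coset x by (metis mult.assoc)
next
  fix x assume "x \<in> unit_coset l b"
  then obtain t where "t \<in> torsion (unit_group l)" "x = t * b" by (auto simp: mem_unit_coset)
  thus "x \<in> F_embed l (unit_coset k b)"
    using unit_coset_self[OF k, of b] by (auto simp: F_embed_def set_mult_def unit_group_simps)
qed

sublocale Fl: log_group "units_mod_tor l" "F_log l"
  by (rule log_group_units_mod_tor[OF l])

sublocale Fk: log_group "units_mod_tor k" "F_log k"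
  by (rule log_group_units_mod_tor[OF k])

section \<open>The relative units as a kernel, and independence of the union\<close>

text \<open>Replaces the condition on \<open>F_norm\<close> by a linear condition on logarithms,
  from which the subgroup property follows by linearity of \<open>rel_sum\<close>.\<close>

definition rel_carrier :: "'a set set" where
  "rel_carrier = {A \<in> carrier (units_mod_tor l). rel_sum l k (F_log l A) = (\<lambda>_. 0)}"

lemma rel_units_eq: "rel_units l k = (units_mod_tor l)\<lparr>carrier := rel_carrier\<rparr>"
proof -
  have "F_norm l k A = \<one>\<^bsub>units_mod_tor k\<^esub> \<longleftrightarrow> rel_sum l k (F_log l A) = (\<lambda>_. 0)"
    if A: "A \<in> carrier (units_mod_tor l)" for A
  proof -
    obtain u where u: "u \<in> units l" "A = unit_coset l u" using A by (auto simp: carrier_units_mod_tor[OF l])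
    have N: "field_norm l k u \<in> units k" by (rule norm_units[OF u(1)])
    have "unit_coset k (field_norm l k u) \<in> carrier (units_mod_tor k)"
      using N by (auto simp: carrier_units_mod_tor[OF k])
    hence "F_norm l k A = \<one>\<^bsub>units_mod_tor k\<^esub> \<longleftrightarrow> F_log k (unit_coset k (field_norm l k u)) = (\<lambda>_. 0)"
      unfolding u(2) F_norm_unit_coset[OF u(1)] using Fk.lg_eq_zeroD Fk.lg_one by metis
    thus ?thesis unfolding F_log_unit_coset[OF k N] u(2) F_log_unit_coset[OF l u(1)] rel_sum_log_vec[OF u(1)] .
  qed
  hence "{A \<in> carrier (units_mod_tor l). F_norm l k A = \<one>\<^bsub>units_mod_tor k\<^esub>} = rel_carrier"
    unfolding rel_carrier_def by (intro Collect_cong conj_cong refl)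
  thus ?thesis unfolding rel_units_def by simp
qed

lemma subgroup_rel_carrier: "subgroup rel_carrier (units_mod_tor l)"
proof (rule Fl.subgroupI)
  show "rel_carrier \<subseteq> carrier (units_mod_tor l)" by (auto simp: rel_carrier_def)
  have "\<one>\<^bsub>units_mod_tor l\<^esub> \<in> rel_carrier" by (simp add: rel_carrier_def Fl.lg_one rel_sum_zero)
  thus "rel_carrier \<noteq> {}" by blast
  fix a assume a: "a \<in> rel_carrier"
  hence a': "a \<in> carrier (units_mod_tor l)" "rel_sum l k (F_log l a) = (\<lambda>_. 0)" by (simp_all add: rel_carrier_def)
  have "F_log l (inv\<^bsub>units_mod_tor l\<^esub> a) = (\<lambda>w. - F_log l a w)" using Fl.lg_inv[OF a'(1)] by blast
  thus "inv\<^bsub>units_mod_tor l\<^esub> a \<in> rel_carrier"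
    using a' by (simp add: rel_carrier_def rel_sum_uminus)
  fix b assume "b \<in> rel_carrier"
  hence b': "b \<in> carrier (units_mod_tor l)" "rel_sum l k (F_log l b) = (\<lambda>_. 0)" by (simp_all add: rel_carrier_def)
  show "a \<otimes>\<^bsub>units_mod_tor l\<^esub> b \<in> rel_carrier"
    using a' b' by (simp add: rel_carrier_def Fl.lg_mult rel_sum_add)
qed

sublocale E: log_group "rel_units l k" "F_log l"
  unfolding rel_units_eq by (rule Fl.log_group_subgroup[OF subgroup_rel_carrier])

lemma carrier_rel_units: "carrier (rel_units l k) = rel_carrier"
  by (simp add: rel_units_eq)

lemma F_log_rel_units:
  "F_log l ` carrier (rel_units l k) = {f \<in> log_vec l ` units l. rel_sum l k f = (\<lambda>_. 0)}"
  unfolding carrier_rel_units rel_carrier_def F_log_image[OF l, symmetric] by blast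

text \<open>In the second part \<open>d\<close> is meant to be the exponent from
  \<open>norm_base\<close>: the norm of a unit of \<open>k\<close> is a power, so on logarithms it
  is multiplication by \<open>d\<close>.\<close>

lemma F_embed_log:
  assumes A: "A \<in> carrier (units_mod_tor k)"
  shows "F_embed l A \<in> carrier (units_mod_tor l)"
    and "field_norm l k u = u ^ d \<Longrightarrow> A = unit_coset k u \<Longrightarrow> u \<in> units k \<Longrightarrow>
      rel_sum l k (F_log l (F_embed l A)) = (\<lambda>v. of_nat d * F_log k A v)"
proof -
  obtain b where b: "b \<in> units k" "A = unit_coset k b" using A by (auto simp: carrier_units_mod_tor[OF k])
  thus "F_embed l A \<in> carrier (units_mod_tor l)"
    using units_subset by (auto simp: F_embed_unit_coset carrier_units_mod_tor[OF l])
next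
  assume u: "field_norm l k u = u ^ d" "A = unit_coset k u" "u \<in> units k"
  have ul: "u \<in> units l" using u(3) units_subset by blast
  show "rel_sum l k (F_log l (F_embed l A)) = (\<lambda>v. of_nat d * F_log k A v)"
    unfolding u(2) F_embed_unit_coset F_log_unit_coset[OF l ul] rel_sum_log_vec[OF ul] u(1)
      log_vec_power[OF k u(3)] F_log_unit_coset[OF k u(3)] ..
qed

text \<open>Taking norms kills the relative units and multiplies the exponents of the units of \<open>k\<close> by \<open>[l : k]\<close>.\<close>

lemma mult_independent_union:
  assumes \<beta>: "mult_independent (units_mod_tor k) I \<beta>" and \<psi>: "mult_independent (rel_units l k) J \<psi>"
  shows "mult_independent (units_mod_tor l) (I <+> J) (case_sum (\<lambda>i. F_embed l (\<beta> i)) \<psi>)"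
proof -
  have \<beta>': "finite I" "\<And>i. i \<in> I \<Longrightarrow> \<beta> i \<in> carrier (units_mod_tor k)"
    "\<And>e. (\<forall>w. (\<Sum>i\<in>I. of_int (e i) * F_log k (\<beta> i) w) = 0) \<Longrightarrow> \<forall>i\<in>I. e i = 0"
    using \<beta> unfolding Fk.mult_independent_iff by auto
  have \<psi>': "finite J" "\<And>j. j \<in> J \<Longrightarrow> \<psi> j \<in> rel_carrier"
    "\<And>e. (\<forall>w. (\<Sum>j\<in>J. of_int (e j) * F_log l (\<psi> j) w) = 0) \<Longrightarrow> \<forall>j\<in>J. e j = 0"
    using \<psi> unfolding E.mult_independent_iff carrier_rel_units by auto
  obtain d where d: "d > 0" "\<And>u. u \<in> k \<Longrightarrow> field_norm l k u = u ^ d" using norm_base by blast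
  have emb: "rel_sum l k (F_log l (F_embed l (\<beta> i))) = (\<lambda>v. of_nat d * F_log k (\<beta> i) v)" if i: "i \<in> I" for i
  proof -
    obtain u where u: "u \<in> units k" "\<beta> i = unit_coset k u" using \<beta>'(2)[OF i] by (auto simp: carrier_units_mod_tor[OF k])
    show ?thesis by (rule F_embed_log(2)[OF \<beta>'(2)[OF i] d(2)[OF units_mem[OF k u(1)]] u(2,1)])
  qed
  show ?thesis
    unfolding Fl.mult_independent_iff
  proof (intro conjI allI impI)
    show "finite (I <+> J)" using \<beta>'(1) \<psi>'(1) by simp
    show "case_sum (\<lambda>i. F_embed l (\<beta> i)) \<psi> \<in> I <+> J \<rightarrow> carrier (units_mod_tor l)"
      using F_embed_log(1)[OF \<beta>'(2)] \<psi>'(2) by (auto simp: rel_carrier_def)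
    fix e :: "'b + 'c \<Rightarrow> int"
    assume "\<forall>w. (\<Sum>i\<in>I <+> J. of_int (e i) * F_log l (case_sum (\<lambda>i. F_embed l (\<beta> i)) \<psi> i) w) = 0"
    hence rel: "(\<Sum>i\<in>I. of_int (e (Inl i)) * F_log l (F_embed l (\<beta> i)) w) + (\<Sum>j\<in>J. of_int (e (Inr j)) * F_log l (\<psi> j) w) = 0" for w
      using \<beta>'(1) \<psi>'(1) by (simp add: sum.Plus)
    have "(\<Sum>i\<in>I. of_int (int d * e (Inl i)) * F_log k (\<beta> i) v) = 0" for v
    proof -
      let ?f = "\<lambda>w. \<Sum>i\<in>I. of_int (e (Inl i)) * F_log l (F_embed l (\<beta> i)) w"
      let ?g = "\<lambda>w. \<Sum>j\<in>J. of_int (e (Inr j)) * F_log l (\<psi> j) w"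
      have "rel_sum l k (\<lambda>w. ?f w + ?g w) v = 0" unfolding rel by (simp add: rel_sum_zero)
      hence "rel_sum l k ?f v + rel_sum l k ?g v = 0" unfolding rel_sum_add .
      moreover have "rel_sum l k ?g v = 0"
        unfolding rel_sum_comb by (rule sum.neutral) (use \<psi>'(2) in \<open>auto simp: rel_carrier_def\<close>)
      moreover have "rel_sum l k ?f v = (\<Sum>i\<in>I. of_int (int d * e (Inl i)) * F_log k (\<beta> i) v)"
        unfolding rel_sum_comb by (intro sum.cong refl) (simp add: emb)
      ultimately show ?thesis by simp
    qed
    hence "\<forall>i\<in>I. int d * e (Inl i) = 0" using \<beta>'(3)[of "\<lambda>i. int d * e (Inl i)"] by simp
    hence eI: "e (Inl i) = 0" if "i \<in> I" for i using d(1) that by simp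
    hence "(\<Sum>j\<in>J. of_int (e (Inr j)) * F_log l (\<psi> j) w) = 0" for w using rel[of w] by simp
    hence "\<forall>j\<in>J. e (Inr j) = 0" using \<psi>'(3)[of "\<lambda>j. e (Inr j)"] by simp
    thus "\<forall>i\<in>I <+> J. e i = 0" using eI by auto
  qed
qed

end

section \<open>Regulators\<close>

lemma log_det_eq_fdet:
  assumes "length ws = length us" "set ws \<subseteq> arch_places L"
  shows "log_det L ws us = \<bar>fdet (length us) (\<lambda>i j. F_log L (us ! j) (ws ! i))\<bar>"
proof -
  have "ws ! i \<in> arch_places L" if "i < length us" for i using assms that by (metis nth_mem subsetD)
  hence "mat (length ws) (length us) (\<lambda>(i, j). real (local_degree L (ws ! i)) * ln (F_abs (ws ! i) (us ! j)))
      = mat (length us) (length us) (\<lambda>(i, j). F_log L (us ! j) (ws ! i))"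
    using assms(1) by (intro eq_matI) (auto simp: F_log_def)
  thus ?thesis by (simp add: log_det_def fdet_def)
qed

lemma log_det_nonsquare: "length ws \<noteq> length us \<Longrightarrow> log_det L ws us = 0"
  by (simp add: log_det_def Determinant.det_def)

lemma log_det_nonneg: "log_det L ws us \<ge> 0"
  by (simp add: log_det_def)

text \<open>\<open>SOME\<close> says nothing without a witness. A basis exists because the logarithm
  lattice is discrete; afterwards the regulator is available as the determinant for some unspecified
  choices.\<close>

lemma regulator_witness:
  assumes L: "number_field L"
  obtains w0 ws us where "w0 \<in> arch_places L" "distinct ws" "set ws = arch_places L - {w0}"
    "group_basis (units_mod_tor L) us" "regulator L = log_det L ws us"
proof -
  let ?P = "\<lambda>R. \<exists>w0 ws us. w0 \<in> arch_places L \<and> distinct ws \<and> set ws = arch_places L - {w0} \<and>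
     group_basis (units_mod_tor L) us \<and> R = log_det L ws us"
  interpret G: log_group "units_mod_tor L" "F_log L" by (rule log_group_units_mod_tor[OF L])
  have "\<exists>n b. lat_basis (log_vec L ` units L) n b"
    by (rule discrete_lattice_has_basis[OF log_lattice(1)[OF L] finite_arch_places[OF L]])
      (rule log_lattice(2)[OF L], assumption+, rule log_lattice(3)[OF L])
  then obtain n b where "lat_basis (F_log L ` carrier (units_mod_tor L)) n b"
    unfolding F_log_image[OF L] by blast
  then obtain us where us: "group_basis (units_mod_tor L) us" using G.group_basis_if_lat_basis by blast
  obtain w0 where w0: "w0 \<in> arch_places L" using arch_places_nonempty[OF L] by blast
  obtain ws where ws: "set ws = arch_places L - {w0}" "distinct ws"
    using finite_distinct_list[of "arch_places L - {w0}"] finite_arch_places[OF L] by auto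
  have "?P (log_det L ws us)" using us w0 ws by blast
  hence "?P (regulator L)" unfolding regulator_def by (rule someI)
  thus ?thesis using that by blast
qed

lemma regulator_nonneg: "number_field L \<Longrightarrow> regulator L \<ge> 0"
  using regulator_witness log_det_nonneg by metis

context field_extension
begin

text \<open>The lattice of relative units is contained in the discrete logarithm lattice of
  \<open>l\<close>, so it has a basis; the choice of one place above each place of \<open>k\<close>
  exists by \<open>arch_place_extends\<close>.\<close>

lemma rel_regulator_witness:
  obtains c ws us where "\<And>v. v \<in> arch_places k \<Longrightarrow> c v \<in> arch_places l"
    "\<And>v. v \<in> arch_places k \<Longrightarrow> restrict (c v) k = v"
    "distinct ws" "set ws = arch_places l - c ` arch_places k"
    "group_basis (rel_units l k) us" "rel_regulator l k = log_det l ws us"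
proof -
  let ?P = "\<lambda>R. \<exists>c ws us. (\<forall>v\<in>arch_places k. c v \<in> arch_places l \<and> restrict (c v) k = v) \<and>
     distinct ws \<and> set ws = arch_places l - c ` arch_places k \<and>
     group_basis (rel_units l k) us \<and> R = log_det l ws us"
  have "add_subgroup (F_log l ` carrier (rel_units l k))" by (rule E.add_subgroup_lg)
  hence "\<exists>n b. lat_basis (F_log l ` carrier (rel_units l k)) n b"
  proof (rule discrete_lattice_has_basis[OF _ finite_arch_places[OF l]])
    show "f w = 0" if "f \<in> F_log l ` carrier (rel_units l k)" "w \<notin> arch_places l" for f w
      using that log_lattice(2)[OF l] unfolding F_log_rel_units by simp
    show "finite {f \<in> F_log l ` carrier (rel_units l k). \<forall>w\<in>arch_places l. \<bar>f w\<bar> \<le> B}" for B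
      by (rule finite_subset[OF _ log_lattice(3)[OF l, of B]]) (simp add: F_log_rel_units subset_iff)
  qed
  then obtain us where us: "group_basis (rel_units l k) us" using E.group_basis_if_lat_basis by blast
  obtain c where c: "\<forall>v\<in>arch_places k. c v \<in> arch_places l \<and> restrict (c v) k = v"
    using bchoice[of "arch_places k" "\<lambda>v w. w \<in> arch_places l \<and> restrict w k = v"] arch_place_extends by blast
  obtain ws where ws: "set ws = arch_places l - c ` arch_places k" "distinct ws"
    using finite_distinct_list[of "arch_places l - c ` arch_places k"] finite_arch_places[OF l] by auto
  have "?P (log_det l ws us)" using us c ws by blast
  hence "?P (rel_regulator l k)" unfolding rel_regulator_def by (rule someI)
  thus ?thesis using that by blast
qed

text \<open>The three regulators come with unrelated bases and omitted places, which
  \<open>lattice_covolume_le\<close> permits.\<close>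

theorem regulator_mult_rel_regulator_le: "regulator k * rel_regulator l k \<le> regulator l"
proof -
  obtain v0 vs uk where K: "v0 \<in> arch_places k" "distinct vs" "set vs = arch_places k - {v0}"
    "group_basis (units_mod_tor k) uk" "regulator k = log_det k vs uk" using regulator_witness[OF k] .
  obtain w0 ws ul where L: "w0 \<in> arch_places l" "distinct ws" "set ws = arch_places l - {w0}"
    "group_basis (units_mod_tor l) ul" "regulator l = log_det l ws ul" using regulator_witness[OF l] .
  obtain c ss ue where R: "\<And>v. v \<in> arch_places k \<Longrightarrow> c v \<in> arch_places l"
    "\<And>v. v \<in> arch_places k \<Longrightarrow> restrict (c v) k = v"
    "distinct ss" "set ss = arch_places l - c ` arch_places k"
    "group_basis (rel_units l k) ue" "rel_regulator l k = log_det l ss ue" using rel_regulator_witness by blast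
  show ?thesis
  proof (cases "length vs = length uk \<and> length ss = length ue")
    case False
    hence "regulator k * rel_regulator l k = 0" unfolding K(5) R(6) using log_det_nonsquare by fastforce
    thus ?thesis using regulator_nonneg[OF l] by linarith
  next
    case True
    obtain d where d: "d > 0" "\<And>u. u \<in> k \<Longrightarrow> field_norm l k u = u ^ d" using norm_base by blast
    have bl: "lat_basis (log_vec l ` units l) (length ul) (\<lambda>i. F_log l (ul ! i))"
      using Fl.lat_basis_if_group_basis[OF L(4)] by (simp add: F_log_image[OF l])
    have bk: "lat_basis (log_vec k ` units k) (length uk) (\<lambda>i. F_log k (uk ! i))"
      using Fk.lat_basis_if_group_basis[OF K(4)] by (simp add: F_log_image[OF k])
    have be: "lat_basis {f \<in> log_vec l ` units l. rel_sum l k f = (\<lambda>_. 0)} (length ue) (\<lambda>i. F_log l (ue ! i))"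
      using E.lat_basis_if_group_basis[OF R(5)] by (simp add: F_log_rel_units)
    have norm_image: "rel_sum l k f \<in> log_vec k ` units k" if "f \<in> log_vec l ` units l" for f
      using that rel_sum_log_vec norm_units by auto
    have multiples: "\<exists>f\<in>log_vec l ` units l. rel_sum l k f = (\<lambda>v. of_int (int d) * g v)"
      if "g \<in> log_vec k ` units k" for g
    proof -
      obtain u where u: "u \<in> units k" "g = log_vec k u" using \<open>g \<in> log_vec k ` units k\<close> by (elim imageE)
      have u': "u \<in> units l" using u(1) units_subset by blast
      have "rel_sum l k (log_vec l u) = (\<lambda>v. of_int (int d) * g v)"
        using rel_sum_log_vec[OF u'] d(2)[OF units_mem[OF k u(1)]] log_vec_power[OF k u(1)] u(2) by simp
      thus ?thesis using u' by blast
    qed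
    have wl: "bij_betw (\<lambda>i. ws ! i) {..<length ws} (arch_places l - {w0})"
      using bij_betw_nth[OF L(2) refl refl] L(3) by simp
    have vk: "bij_betw (\<lambda>i. vs ! i) {..<length uk} (arch_places k - {v0})"
      using bij_betw_nth[OF K(2) refl refl] K(3) True by simp
    have se: "bij_betw (\<lambda>i. ss ! i) {..<length ue} (arch_places l - c ` arch_places k)"
      using bij_betw_nth[OF R(3) refl refl] R(4) True by simp
    have d0: "int d \<noteq> 0" using d(1) by simp
    note hyps = rel_sum_def[of l k] finite_arch_places[OF l] finite_arch_places[OF k]
      restrict_arch_place R(1) R(2) log_lattice(1)[OF l] log_lattice(4)[OF l] log_lattice(1)[OF k]
      log_lattice(2)[OF k] log_lattice(3)[OF k] norm_image d0 multiples bl bk be L(1) wl K(1) vk se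
    note cov = lattice_covolume_le[where \<pi> = "\<lambda>w. restrict w k" and c = c and d = "int d"
        and Wl = "arch_places l" and Wk = "arch_places k"
        and Al = "log_vec l ` units l" and Ak = "log_vec k ` units k" and Nm = "rel_sum l k"
        and nl = "length ul" and nk = "length uk" and ne = "length ue" and ml = "length ws"
        and fl = "\<lambda>i. F_log l (ul ! i)" and fk = "\<lambda>i. F_log k (uk ! i)" and fe = "\<lambda>i. F_log l (ue ! i)"
        and ?w0.0 = w0 and ?v0.0 = v0 and wl = "\<lambda>i. ws ! i" and vk = "\<lambda>i. vs ! i" and ws = "\<lambda>i. ss ! i"]
    \<comment> \<open>The matrix for \<open>l\<close> is square because the two others are.
      Otherwise \<open>log_det\<close> would return 0 for it and the bound could fail.\<close>
    have len: "length ul = length ws" by (rule cov(1)) (fact hyps)+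
    have "\<bar>fdet (length uk) (\<lambda>i j. F_log k (uk ! j) (vs ! i))\<bar> * \<bar>fdet (length ue) (\<lambda>i j. F_log l (ue ! j) (ss ! i))\<bar>
        \<le> \<bar>fdet (length ul) (\<lambda>i j. F_log l (ul ! j) (ws ! i))\<bar>" by (rule cov(2)) (fact hyps)+
    thus ?thesis unfolding K(5) L(5) R(6)
      using True len K(3) L(3) R(4) by (simp add: log_det_eq_fdet)
  qed
qed

end

theorem theorem1p4:
  fixes k l :: "'a::field_char_0 set"
    and \<beta> \<psi> :: "nat \<Rightarrow> 'a set"
  assumes "number_field k" and "number_field l" and "k \<subset> l"
    and "k \<noteq> \<rat>" and "\<not> imaginary_quadratic k"
    and "unit_rank l > unit_rank k"
    and "mult_independent (units_mod_tor k) {1..unit_rank k} \<beta>"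
    and "(\<Prod>i=1..unit_rank k. real (field_degree k) * F_height k (\<beta> i))
           \<le> fact (unit_rank k) * regulator k"
    and "mult_independent (rel_units l k) {1..rel_unit_rank l k} \<psi>"
    and "(\<Prod>j=1..rel_unit_rank l k. real (field_degree l) * F_height l (\<psi> j))
           \<le> fact (rel_unit_rank l k) * rel_regulator l k"
  shows "mult_independent (units_mod_tor l) ({1..unit_rank k} <+> {1..rel_unit_rank l k})
           (case_sum (\<lambda>i. F_embed l (\<beta> i)) \<psi>)
         \<and> (\<Prod>i=1..unit_rank k. real (field_degree k) * F_height k (\<beta> i))
           * (\<Prod>j=1..rel_unit_rank l k. real (field_degree l) * F_height l (\<psi> j))
           \<le> fact (unit_rank l) * regulator l"
proof (intro conjI)
  interpret field_extension k l
    by (rule field_extension.intro) (use assms(1-3) in auto)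
  show "mult_independent (units_mod_tor l) ({1..unit_rank k} <+> {1..rel_unit_rank l k})
      (case_sum (\<lambda>i. F_embed l (\<beta> i)) \<psi>)"
    by (rule mult_independent_union[OF assms(7,9)])
  let ?r = "unit_rank k" and ?s = "rel_unit_rank l k"
  let ?P = "\<Prod>i=1..?r. real (field_degree k) * F_height k (\<beta> i)"
  let ?Q = "\<Prod>j=1..?s. real (field_degree l) * F_height l (\<psi> j)"
  \<comment> \<open>Multiplying the two assumed bounds requires the second left-hand side and the
    first right-hand side to be nonnegative; this is the former, from nonnegative heights.\<close>
  have "?Q \<ge> 0"
    using assms(9) unfolding E.mult_independent_iff carrier_rel_units rel_carrier_def
    by (intro prod_nonneg mult_nonneg_nonneg F_height_nonneg[OF l]) auto
  have "?P * ?Q \<le> (fact ?r * regulator k) * (fact ?s * rel_regulator l k)"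
    using assms(8,10) \<open>?Q \<ge> 0\<close> regulator_nonneg[OF k] by (intro mult_mono) auto
  also have "\<dots> = (fact ?r * fact ?s) * (regulator k * rel_regulator l k)" by (simp only: mult_ac)
  also have "\<dots> \<le> (fact ?r * fact ?s) * regulator l"
    by (intro mult_left_mono regulator_mult_rel_regulator_le) simp
  also have "\<dots> \<le> fact (unit_rank l) * regulator l"
  proof (intro mult_right_mono regulator_nonneg[OF l])
    have "?s = unit_rank l - ?r" by (simp add: rel_unit_rank_def)
    \<comment> \<open>The quotient of r(l)! by r(k)! r(l/k)! is a binomial coefficient, hence at
      least 1.\<close>
    hence "fact ?r * fact ?s * (unit_rank l choose ?r) = (fact (unit_rank l) :: nat)"
      using binomial_fact_lemma[of ?r "unit_rank l"] assms(6) by simp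
    moreover have "(unit_rank l choose ?r) \<ge> 1" using assms(6) by (simp add: Suc_leI)
    ultimately have "fact ?r * fact ?s \<le> (fact (unit_rank l) :: nat)"
      by (metis mult.right_neutral mult_le_mono2)
    hence "real (fact ?r * fact ?s) \<le> real (fact (unit_rank l))" by (rule of_nat_mono)
    thus "fact ?r * fact ?s \<le> (fact (unit_rank l) :: real)" by simp
  qed
  finally show "?P * ?Q \<le> fact (unit_rank l) * regulator l" .
qed

end
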